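(* Let $X$ be a separable Banach space, let $\mu$ be a non-degenerate centred Gaussian probability measure on $X$ with Cameron--Martin space $(E,|\cdot|_E)$, let $\Phi\colon X\to\mathbb R$ be an admissible potential, let $\mu^y$ be the corresponding posterior probability measure, and let $I\colon E\to\mathbb R$, $I(u)=\Phi(u)+\tfrac12|u|_E^2$, be the Onsager--Machlup functional. Let $(\zeta^\delta)_{\delta>0}$ be any asymptotic maximizing family for $\mu^y$ in $X$. Then there exist constants $K>0$ and $\delta_0>0$ such that, for every $0<\delta<\delta_0$, $$\frac{\mu(B_\delta(\zeta^\delta))}{\mu(B_\delta(0))}\ge K.$$ Moreover, with the properties (C1)--(C4) of $\mu$ defined in the context: (a) If (C1), (C2), (C3) and (C4) hold, $(\zeta^\delta)_{\delta>0}$ is an asymptotic maximizing family for $\mu^y$ and $(\delta_m)_{m\in\mathbb N}$ is a null sequence in $(0,\infty)$, then $(\zeta^{\delta_m})_{m\in\mathbb N}$ has a subsequence which converges strongly in $X$ to an element $\bar w\in E$, and any limit point $\bar z$ (strong in $X$, as $\delta\to0$) of $(\zeta^\delta)_{\delta>0}$ lies in $E$ and is a MAP estimator for $\mu^y$. (b) If (C3) holds, then any MAP estimator for $\mu^y$ is an element of $E$, minimizes $I$ over $E$, and is a limit point of some asymptotic maximizing family for $\mu^y$. (c) If (C3) holds and $\mu^y$ has a MAP estimator $\bar z$, then any minimizer $\bar x\in E$ of $I$ is also a MAP estimator for $\mu^y$. In particular, if (C1)--(C4) are satisfied, then there exists at least one MAP estimator for $\mu^y$, and for every $\bar z\in X$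 the following are equivalent: (i) $\bar z$ is an $X$-strong limit point, as $\delta\to0$, of some asymptotic maximizing family for $\mu^y$; (ii) $\bar z\in E$ and $\bar z$ minimizes $I$ over $E$; (iii) $\bar z$ is a MAP estimator for $\mu^y$.
   Context: $B_\delta(x)$ denotes the open ball of radius $\delta$ centred at $x$ in $(X,\|\cdot\|_X)$. A centred Gaussian measure $\mu$ on $X$ is non-degenerate if every nonzero continuous linear functional on $X$ has strictly positive variance under $\mu$. A null sequence is a sequence converging to $0$. A function $\Phi\colon X\to\mathbb R$ is called an admissible potential if: (1) there is $M\in\mathbb R$ with $\Phi(u)\ge M$ for all $u\in X$; (2) for every $r>0$ there is $K(r)>0$ with $\Phi(u)\le K(r)$ for all $\|u\|_X<r$; (3) for every $r>0$ there is $L(r)>0$ with $|\Phi(u_1)-\Phi(u_2)|\le L(r)\|u_1-u_2\|_X$ whenever $\|u_1\|_X,\|u_2\|_X\le r$; and (normalization) $\Phi(0)=0$. The posterior $\mu^y$ is the probability measure on $X$ given by $\frac{d\mu^y}{d\mu}(u)=Z^{-1}\exp(-\Phi(u))$ with $Z=\int_X\exp(-\Phi(u))\,\mu(du)$. A MAP estimator for $\mu^y$ is a point $z\in X$ with $\lim_{\delta\searrow0}\frac{\mu^y(B_\delta(z))}{\sup_{x\in X}\mu^y(B_\delta(x))}=1$. A family $(\zeta^\delta)_{\delta>0}\subset X$ is an asymptotic maximizing family for $\mu^y$ if there is a family $(\varepsilon^\delta)_{\delta>0}$ in $(0,1)$ with $\varepsilon^\delta\to0$ as $\delta\searrow0$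 such that $\frac{\mu^y(B_\delta(\zeta^\delta))}{\sup_{x\in X}\mu^y(B_\delta(x))}>1-\varepsilon^\delta$ for every $\delta>0$. $\bar z$ is an ($X$-strong) limit point of $(\zeta^\delta)_{\delta>0}$ as $\delta\to0$ if there is a sequence $\delta_n\searrow0$ with $\|\zeta^{\delta_n}-\bar z\|_X\to0$. Properties of $\mu$: (C1) (vanishing condition for unbounded sequences) For any null sequence $(\delta_m)_{m\in\mathbb N}$ in $(0,\infty)$ and any unbounded sequence $(x_m)_{m\in\mathbb N}$ in $X$, $\liminf_{m\to\infty}\frac{\mu(B_{\delta_m}(x_m))}{\mu(B_{\delta_m}(0))}=0$. (C2) (weakly convergent subsequence condition) If $(\delta_m)_{m\in\mathbb N}$ is a null sequence in $(0,\infty)$ and $(x_m)_{m\in\mathbb N}$ is a bounded sequence in $X$ for which there is $K>0$ with $\frac{\mu(B_{\delta_m}(x_m))}{\mu(B_{\delta_m}(0))}\ge K$ for all $m\in\mathbb N$, then $(x_m)_{m\in\mathbb N}$ has a weakly convergent subsequence. (C3) (vanishing condition for weak limits outside $E$) For any null sequence $(\delta_m)_{m\in\mathbb N}$ in $(0,\infty)$ and any weakly convergent sequence $(x_m)_{m\in\mathbb N}$ in $X$ with weak limit $\bar z\notin E$, $\liminf_{m\to\infty}\frac{\mu(B_{\delta_m}(x_m))}{\mu(B_{\delta_m}(0))}=0$. (C4) (vanishing condition for weakly, but not strongly convergent sequences) For any null sequence $(\delta_m)_{m\in\mathbb N}$ in $(0,\infty)$ and any weakly, but not strongly, convergent sequence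 $(x_m)_{m\in\mathbb N}$ in $X$ with weak limit $\bar z\in E$, $\liminf_{m\to\infty}\frac{\mu(B_{\delta_m}(x_m))}{\mu(B_{\delta_m}(0))}=0$. *)

theory Defs
  imports "HOL-Probability.Probability"
begin

section \<open>Gaussian measures and the Cameron--Martin space\<close>

text \<open>Separable real Banach spaces are types of sort \<open>{banach, second_countable_topology}\<close>:
  a metric space is separable iff it is second countable.\<close>

text \<open>Gaussian laws on the line; point masses count as Gaussians of variance zero.\<close>

definition gaussian_law :: "real measure \<Rightarrow> bool" where
  "gaussian_law \<nu> \<longleftrightarrow>
     (\<exists>m \<sigma>. \<sigma> > 0 \<and> \<nu> = density lborel (\<lambda>t. ennreal (normal_density m \<sigma> t))) \<or>
     (\<exists>m. \<nu> = return borel m)"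

definition gaussian_measure :: "'a::{banach, second_countable_topology} measure \<Rightarrow> bool" where
  "gaussian_measure \<mu> \<longleftrightarrow>
     prob_space \<mu> \<and> sets \<mu> = sets borel \<and>
     (\<forall>f::'a \<Rightarrow> real. bounded_linear f \<longrightarrow> gaussian_law (distr \<mu> borel f))"

definition centred :: "'a::{banach, second_countable_topology} measure \<Rightarrow> bool" where
  "centred \<mu> \<longleftrightarrow>
     (\<forall>f::'a \<Rightarrow> real. bounded_linear f \<longrightarrow> prob_space.expectation \<mu> f = 0)"

definition nondegenerate :: "'a::{banach, second_countable_topology} measure \<Rightarrow> bool" where
  "nondegenerate \<mu> \<longleftrightarrow>
     (\<forall>f::'a \<Rightarrow> real. bounded_linear f \<and> f \<noteq> (\<lambda>x. 0) \<longrightarrow> prob_space.variance \<mu> f > 0)"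

text \<open>The Cameron--Martin norm of a centred Gaussian measure is
  \<open>|h|\<^sub>E = sup {f h | f \<in> X*, \<parallel>f\<parallel> \<le> 1 in L\<^sup>2(\<mu>)}\<close>, and the Cameron--Martin space consists of
  the \<open>h\<close> at which it is finite (Bogachev, Gaussian Measures, Section 2.2). The supremum is
  taken in the reals, so \<open>cm_norm\<close> is meaningful on \<open>cm_space\<close> only.\<close>

definition cm_values :: "'a::{banach, second_countable_topology} measure \<Rightarrow> 'a \<Rightarrow> real set" where
  "cm_values \<mu> h =
     {f h | f. bounded_linear f \<and> (\<integral>x. (f x)\<^sup>2 \<partial>\<mu>) \<le> 1}"

definition cm_space :: "'a::{banach, second_countable_topology} measure \<Rightarrow> 'a set" where
  "cm_space \<mu> = {h. bdd_above (cm_values \<mu> h)}"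

definition cm_norm :: "'a::{banach, second_countable_topology} measure \<Rightarrow> 'a \<Rightarrow> real" where
  "cm_norm \<mu> h = Sup (cm_values \<mu> h)"


section \<open>Potential, posterior and Onsager--Machlup functional\<close>

definition admissible_potential :: "('a::{banach, second_countable_topology} \<Rightarrow> real) \<Rightarrow> bool" where
  "admissible_potential \<Phi> \<longleftrightarrow>
     (\<exists>M. \<forall>u. \<Phi> u \<ge> M) \<and>
     (\<forall>r>0. \<exists>K>0. \<forall>u. norm u < r \<longrightarrow> \<Phi> u \<le> K) \<and>
     (\<forall>r>0. \<exists>L>0. \<forall>u v. norm u \<le> r \<and> norm v \<le> r \<longrightarrow> \<bar>\<Phi> u - \<Phi> v\<bar> \<le> L * norm (u - v)) \<and>
     \<Phi> 0 = 0"

definition posterior ::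
  "'a::{banach, second_countable_topology} measure \<Rightarrow> ('a \<Rightarrow> real) \<Rightarrow> 'a measure" where
  "posterior \<mu> \<Phi> =
     (let Z = (\<integral>u. exp (- \<Phi> u) \<partial>\<mu>) in density \<mu> (\<lambda>u. ennreal (exp (- \<Phi> u) / Z)))"

definition onsager_machlup ::
  "'a::{banach, second_countable_topology} measure \<Rightarrow> ('a \<Rightarrow> real) \<Rightarrow> 'a \<Rightarrow> real" where
  "onsager_machlup \<mu> \<Phi> u = \<Phi> u + (cm_norm \<mu> u)\<^sup>2 / 2"

definition minimizes_OM ::
  "'a::{banach, second_countable_topology} measure \<Rightarrow> ('a \<Rightarrow> real) \<Rightarrow> 'a \<Rightarrow> bool" where
  "minimizes_OM \<mu> \<Phi> z \<longleftrightarrow> is_arg_min (onsager_machlup \<mu> \<Phi>) (\<lambda>u. u \<in> cm_space \<mu>) z"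


section \<open>MAP estimators and asymptotic maximizing families\<close>

definition MAP_estimator ::
  "'a::{banach, second_countable_topology} measure \<Rightarrow> 'a \<Rightarrow> bool" where
  "MAP_estimator \<nu> z \<longleftrightarrow>
     ((\<lambda>\<delta>. measure \<nu> (ball z \<delta>) / (SUP x. measure \<nu> (ball x \<delta>))) \<longlongrightarrow> 1) (at_right 0)"

text \<open>Families indexed by \<open>\<delta> > 0\<close> are functions on the reals; only their values at positive
  arguments matter.\<close>

definition asymptotic_maximizing_family ::
  "'a::{banach, second_countable_topology} measure \<Rightarrow> (real \<Rightarrow> 'a) \<Rightarrow> bool" where
  "asymptotic_maximizing_family \<nu> \<zeta> \<longleftrightarrow>
     (\<exists>\<epsilon> :: real \<Rightarrow> real.
        (\<forall>\<delta>>0. 0 < \<epsilon> \<delta> \<and> \<epsilon> \<delta> < 1) \<and>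
        (\<epsilon> \<longlongrightarrow> 0) (at_right 0) \<and>
        (\<forall>\<delta>>0. measure \<nu> (ball (\<zeta> \<delta>) \<delta>) / (SUP x. measure \<nu> (ball x \<delta>)) > 1 - \<epsilon> \<delta>))"

definition positive_null_seq :: "(nat \<Rightarrow> real) \<Rightarrow> bool" where
  "positive_null_seq \<delta> \<longleftrightarrow> (\<forall>m. \<delta> m > 0) \<and> \<delta> \<longlonglongrightarrow> 0"

definition family_limit_point ::
  "(real \<Rightarrow> 'a::{banach, second_countable_topology}) \<Rightarrow> 'a \<Rightarrow> bool" where
  "family_limit_point \<zeta> z \<longleftrightarrow>
     (\<exists>\<delta>. positive_null_seq \<delta> \<and> decseq \<delta> \<and> (\<lambda>n. \<zeta> (\<delta> n)) \<longlonglongrightarrow> z)"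


section \<open>The conditions (C1)--(C4)\<close>

definition weakly_converges_to ::
  "(nat \<Rightarrow> 'a::{banach, second_countable_topology}) \<Rightarrow> 'a \<Rightarrow> bool" where
  "weakly_converges_to x z \<longleftrightarrow>
     (\<forall>f::'a \<Rightarrow> real. bounded_linear f \<longrightarrow> (\<lambda>n. f (x n)) \<longlonglongrightarrow> f z)"

definition ball_ratio ::
  "'a::{banach, second_countable_topology} measure \<Rightarrow> real \<Rightarrow> 'a \<Rightarrow> real" where
  "ball_ratio \<mu> \<delta> x = measure \<mu> (ball x \<delta>) / measure \<mu> (ball 0 \<delta>)"

definition C1 :: "'a::{banach, second_countable_topology} measure \<Rightarrow> bool" where
  "C1 \<mu> \<longleftrightarrow>
     (\<forall>\<delta> x. positive_null_seq \<delta> \<and> \<not> bounded (range x) \<longrightarrow>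
        liminf (\<lambda>m. ereal (ball_ratio \<mu> (\<delta> m) (x m))) = 0)"

definition C2 :: "'a::{banach, second_countable_topology} measure \<Rightarrow> bool" where
  "C2 \<mu> \<longleftrightarrow>
     (\<forall>\<delta> x. positive_null_seq \<delta> \<and> bounded (range x) \<and>
        (\<exists>K>0. \<forall>m. ball_ratio \<mu> (\<delta> m) (x m) \<ge> K) \<longrightarrow>
        (\<exists>r z. strict_mono r \<and> weakly_converges_to (x \<circ> r) z))"

definition C3 :: "'a::{banach, second_countable_topology} measure \<Rightarrow> bool" where
  "C3 \<mu> \<longleftrightarrow>
     (\<forall>\<delta> x z. positive_null_seq \<delta> \<and> weakly_converges_to x z \<and> z \<notin> cm_space \<mu> \<longrightarrow>
        liminf (\<lambda>m. ereal (ball_ratio \<mu> (\<delta> m) (x m))) = 0)"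

definition C4 :: "'a::{banach, second_countable_topology} measure \<Rightarrow> bool" where
  "C4 \<mu> \<longleftrightarrow>
     (\<forall>\<delta> x z. positive_null_seq \<delta> \<and> weakly_converges_to x z \<and> \<not> convergent x \<and> z \<in> cm_space \<mu> \<longrightarrow>
        liminf (\<lambda>m. ereal (ball_ratio \<mu> (\<delta> m) (x m))) = 0)"

end

theory Submission
  imports Defs
begin

text \<open>
  All statements reduce to two estimates for small balls. For a continuous functional \<open>f\<close> with
  variance \<open>q\<close>, the measure \<open>exp (f - q/2) \<mu>\<close> gives a symmetric convex set translated by any \<open>x\<close> at
  most the \<open>\<mu>\<close>-mass of the untranslated set; hence
  \<open>\<mu> (B\<^sub>\<delta> x) \<le> exp (q/2 - f x + o(1)) \<mu> (B\<^sub>\<delta> 0)\<close>, where optimizing over \<open>f\<close> yields the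
  exponent \<open>- |x|\<^sup>2/2\<close>. The tilted inequality is the Prekopa--Leindler inequality for the pair
  \<open>1\<^bsub>C + x\<^esub> exp f\<close>, \<open>1\<^bsub>C - x\<^esub> exp (- f)\<close>, and it contains Anderson's inequality as the case \<open>f = 0\<close>. In
  the other direction the Cameron--Martin formula and the symmetry of \<open>C\<close> give
  \<open>\<mu> (C + h) \<ge> exp (- |h|\<^sup>2/2) \<mu> C\<close>. Both are proved for finite intersections of strips, which
  depend on finitely many orthonormal, hence independent, functionals; balls are limits of such
  intersections by Hahn--Banach and separability.

  Consequently the posterior mass of \<open>B\<^sub>\<delta> z\<close>, divided by \<open>\<mu> (B\<^sub>\<delta> 0)\<close>, tends to a multiple of
  \<open>exp (- I z)\<close>, and this bound holds from above uniformly along centres converging to \<open>z\<close>. So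
  limits of maximizing centres minimize \<open>I\<close> and determine the asymptotics of the supremum.
\<close>

section \<open>The Prekopa--Leindler inequality on the line\<close>

text \<open>The hypotheses describe the law of one functional at a time, whereas strips involve
  joint laws. Independence of orthonormal functionals is therefore derived from characteristic
  functions on the line, applied to images of \<open>\<mu>\<close> under one functional after
  reweighting by cylinder indicators and by 1 + cos h or 1 + sin h; the added 1 keeps the weights
  nonnegative.

  The Cameron--Martin norm is finite only on E and in general discontinuous in the norm of X, so it
  cannot be evaluated along moving centres. A single functional f, nearly optimal at the limit z,
  takes its place: f is continuous, it varies on a ball by at most its bound times the radius (the
  o(1) of the overview), and f z - q/2 comes arbitrarily close to |z|^2/2. In the lower bound, the
  coordinates of h along finitely many orthonormal functionals have squared sum at most |h|^2, which
  makes the finite-dimensional estimate uniform in the number of strips.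

  The tilt is paid for by the factor exp ((x - y)^2/4) that the Gaussian density gains at
  midpoints.\<close>

lemma emeasure_lborel_midpoint_vimage:
  fixes C :: "real set"
  assumes [measurable]: "C \<in> sets borel"
  shows "emeasure lborel {b. (a + b) / 2 \<in> C} = 2 * emeasure lborel C"
proof -
  have "emeasure lborel C = (\<integral>\<^sup>+x. indicator C x \<partial>lborel)"
    by simp
  also have "\<dots> = ennreal (1/2) * (\<integral>\<^sup>+x. indicator C (a/2 + (1/2) * x) \<partial>lborel)"
    by (subst nn_integral_real_affine[where c = "1/2" and t = "a/2"]) auto
  also have "(\<integral>\<^sup>+x. indicator C (a/2 + (1/2) * x) \<partial>lborel)
      = (\<integral>\<^sup>+x. indicator {b. (a + b) / 2 \<in> C} x \<partial>lborel)"
    by (intro nn_integral_cong) (auto simp: indicator_def add_divide_distrib)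
  also have "\<dots> = emeasure lborel {b. (a + b) / 2 \<in> C}"
    by (subst nn_integral_indicator) auto
  finally have "2 * emeasure lborel C
      = (2 * ennreal (1/2)) * emeasure lborel {b. (a + b) / 2 \<in> C}"
    by (simp add: mult.assoc)
  also have "2 * ennreal (1/2) = ennreal (2 * (1/2))"
    by (subst ennreal_mult') auto
  finally show ?thesis by simp
qed

text \<open>Choose a in A near its supremum and b in B near its infimum. Then (a + B)/2 and (A +
  b)/2 both lie in C, carry half the measures of B and A, and overlap in an interval of length at
  most e/2 only.\<close>

lemma midpoint_Brunn_Minkowski_bounded:
  fixes A B C :: "real set"
  assumes [measurable]: "A \<in> sets borel" "B \<in> sets borel" "C \<in> sets borel"
    and "A \<noteq> {}" "B \<noteq> {}" "bounded A" "bounded B"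
    and mid: "\<And>a b. a \<in> A \<Longrightarrow> b \<in> B \<Longrightarrow> (a + b) / 2 \<in> C"
  shows "emeasure lborel A + emeasure lborel B \<le> 2 * emeasure lborel C"
proof (rule ennreal_le_epsilon)
  fix e :: real assume "e > 0"
  have bA: "bdd_above A" and bB: "bdd_below B"
    using assms by (simp_all add: bounded_imp_bdd_above bounded_imp_bdd_below)
  obtain a where a: "a \<in> A" "Sup A - e/2 < a"
    using less_cSupD[OF \<open>A \<noteq> {}\<close>, of "Sup A - e/2"] \<open>e > 0\<close> by auto
  obtain b where b: "b \<in> B" "b < Inf B + e/2"
    using cInf_lessD[OF \<open>B \<noteq> {}\<close>, of "Inf B + e/2"] \<open>e > 0\<close> by auto
  define C1 where "C1 = C \<inter> {(a + Inf B) / 2..}"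
  define C2 where "C2 = C \<inter> {..(b + Sup A) / 2}"
  have [measurable]: "C1 \<in> sets borel" "C2 \<in> sets borel"
    by (auto simp: C1_def C2_def)
  have "emeasure lborel B \<le> emeasure lborel {x. (a + x) / 2 \<in> C1}"
    using a mid bB by (intro emeasure_mono) (auto simp: C1_def cInf_lower)
  then have B: "emeasure lborel B \<le> 2 * emeasure lborel C1"
    by (simp add: emeasure_lborel_midpoint_vimage)
  have "emeasure lborel A \<le> emeasure lborel {x. (b + x) / 2 \<in> C2}"
    using b mid bA by (intro emeasure_mono) (auto simp: C2_def cSup_upper add.commute)
  then have A: "emeasure lborel A \<le> 2 * emeasure lborel C2"
    by (simp add: emeasure_lborel_midpoint_vimage)
  have "C1 \<inter> C2 \<subseteq> {(a + Inf B) / 2..(b + Sup A) / 2}"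
    by (auto simp: C1_def C2_def)
  then have "emeasure lborel (C1 \<inter> C2) \<le> emeasure lborel {(a + Inf B) / 2..(b + Sup A) / 2}"
    by (intro emeasure_mono) auto
  also have "\<dots> \<le> ennreal (e / 2)"
    using a b by (cases "(a + Inf B) / 2 \<le> (b + Sup A) / 2")
      (auto intro!: ennreal_leI simp: field_simps)
  finally have I: "emeasure lborel (C1 \<inter> C2) \<le> ennreal (e / 2)" .
  have "emeasure lborel C1 + emeasure lborel C2
      = emeasure lborel (C1 \<union> C2) + emeasure lborel (C1 \<inter> C2)"
    by (rule emeasure_Un_Int) auto
  also have "\<dots> \<le> emeasure lborel C + ennreal (e / 2)"
    using I by (intro add_mono emeasure_mono) (auto simp: C1_def C2_def)
  finally have "2 * (emeasure lborel C1 + emeasure lborel C2)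
      \<le> 2 * (emeasure lborel C + ennreal (e / 2))"
    by (rule mult_left_mono) simp
  also have "\<dots> = 2 * emeasure lborel C + ennreal e"
    using \<open>e > 0\<close> by (simp add: distrib_left flip: ennreal_mult' ennreal_numeral)
  finally have "2 * emeasure lborel C1 + 2 * emeasure lborel C2 \<le> 2 * emeasure lborel C + ennreal e"
    by (simp add: distrib_left)
  with A B show "emeasure lborel A + emeasure lborel B \<le> 2 * emeasure lborel C + ennreal e"
    using add_mono[OF A B] by (simp add: add.commute order_trans)
qed

lemma midpoint_Brunn_Minkowski:
  fixes A B C :: "real set"
  assumes [measurable]: "A \<in> sets borel" "B \<in> sets borel" "C \<in> sets borel"
    and "A \<noteq> {}" "B \<noteq> {}"
    and mid: "\<And>a b. a \<in> A \<Longrightarrow> b \<in> B \<Longrightarrow> (a + b) / 2 \<in> C"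
  shows "emeasure lborel A + emeasure lborel B \<le> 2 * emeasure lborel C"
proof -
  obtain a b where ab: "a \<in> A" "b \<in> B" using assms by auto
  define A' B' where "A' n = A \<inter> {-real n..real n}" and "B' n = B \<inter> {-real n..real n}" for n
  have m[measurable]: "A' n \<in> sets borel" "B' n \<in> sets borel" for n
    by (auto simp: A'_def B'_def)
  have U: "(\<Union>n. A' n) = A" "(\<Union>n. B' n) = B"
    by (auto simp: A'_def B'_def) (meson abs_le_iff minus_le_iff real_arch_simple)+
  have "(\<lambda>n. emeasure lborel (A' n)) \<longlonglongrightarrow> emeasure lborel (\<Union>n. A' n)"
    by (rule Lim_emeasure_incseq) (auto simp: incseq_def A'_def)
  moreover have "(\<lambda>n. emeasure lborel (B' n)) \<longlonglongrightarrow> emeasure lborel (\<Union>n. B' n)"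
    by (rule Lim_emeasure_incseq) (auto simp: incseq_def B'_def)
  ultimately have "(\<lambda>n. emeasure lborel (A' n) + emeasure lborel (B' n))
      \<longlonglongrightarrow> emeasure lborel A + emeasure lborel B"
    unfolding U by (rule tendsto_add)
  moreover have "\<forall>\<^sub>F n in sequentially.
      emeasure lborel (A' n) + emeasure lborel (B' n) \<le> 2 * emeasure lborel C"
  proof -
    \<comment> \<open>The bounded case demands nonempty sets, so it applies from the truncation on
      that contains both a and b.\<close>
    obtain N where "real N \<ge> max \<bar>a\<bar> \<bar>b\<bar>" using real_arch_simple by blast
    then have "a \<in> A' n" "b \<in> B' n" if "n \<ge> N" for n
      using ab that by (auto simp: A'_def B'_def)
    then have "A' n \<noteq> {}" "B' n \<noteq> {}" if "n \<ge> N" for n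
      using that by blast+
    then have "emeasure lborel (A' n) + emeasure lborel (B' n) \<le> 2 * emeasure lborel C" if "n \<ge> N" for n
      using that mid
      by (intro midpoint_Brunn_Minkowski_bounded m assms)
        (auto simp: A'_def B'_def intro: bounded_subset[OF bounded_closed_interval])
    then show ?thesis by (auto simp: eventually_sequentially)
  qed
  ultimately show ?thesis
    by (rule tendsto_upperbound) simp
qed

text \<open>Levels in [0, 1) suit two functions of supremum 1: their superlevel sets are nonempty at
  all these levels, as Brunn--Minkowski demands. Capping by 1 lets the same formula serve a third
  function that may be larger.\<close>

lemma nn_integral_unit_layer_cake:
  fixes f :: "real \<Rightarrow> real"
  assumes [measurable]: "f \<in> borel_measurable borel"
  shows "(\<integral>\<^sup>+x. ennreal (min 1 (f x)) \<partial>lborel)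
    = (\<integral>\<^sup>+s. indicator {0..<1} s * emeasure lborel {x. s < f x} \<partial>lborel)"
proof -
  let ?g = "\<lambda>x s. if 0 \<le> s \<and> s < 1 \<and> s < f x then 1 else 0 :: ennreal"
  have "(\<integral>\<^sup>+x. ennreal (min 1 (f x)) \<partial>lborel) = (\<integral>\<^sup>+x. (\<integral>\<^sup>+s. ?g x s \<partial>lborel) \<partial>lborel)"
  proof (rule nn_integral_cong)
    fix x
    have "(\<integral>\<^sup>+s. ?g x s \<partial>lborel) = (\<integral>\<^sup>+s. indicator {0..<min 1 (f x)} s \<partial>lborel)"
      by (intro nn_integral_cong) (auto simp: indicator_def)
    also have "\<dots> = ennreal (min 1 (f x))"
      by (cases "0 \<le> f x") (auto simp: ennreal_neg)
    finally show "ennreal (min 1 (f x)) = (\<integral>\<^sup>+s. ?g x s \<partial>lborel)" ..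
  qed
  also have "\<dots> = (\<integral>\<^sup>+s. (\<integral>\<^sup>+x. ?g x s \<partial>lborel) \<partial>lborel)"
    by (rule lborel_pair.Fubini') (measurable; simp)
  also have "\<dots> = (\<integral>\<^sup>+s. indicator {0..<1} s * emeasure lborel {x. s < f x} \<partial>lborel)"
  proof (rule nn_integral_cong)
    fix s
    have "(\<integral>\<^sup>+x. ?g x s \<partial>lborel)
        = (\<integral>\<^sup>+x. indicator {0..<1} s * indicator {x. s < f x} x \<partial>lborel)"
      by (intro nn_integral_cong) (auto simp: indicator_def)
    also have "\<dots> = indicator {0..<1} s * emeasure lborel {x. s < f x}"
      by (simp add: nn_integral_cmult)
    finally show "(\<integral>\<^sup>+x. ?g x s \<partial>lborel) = indicator {0..<1} s * emeasure lborel {x. s < f x}" .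
  qed
  finally show ?thesis .
qed


lemma ennreal_four_mult_le_power2_add:
  fixes x y :: ennreal
  shows "4 * (x * y) \<le> (x + y)\<^sup>2"
proof (cases x; cases y)
  fix a b assume ab: "x = ennreal a" "0 \<le> a" "y = ennreal b" "0 \<le> b"
  have "4 * (a * b) \<le> (a + b)\<^sup>2"
    using zero_le_power2[of "a - b"] by (simp add: power2_eq_square algebra_simps)
  then have "ennreal (4 * (a * b)) \<le> ennreal ((a + b)\<^sup>2)"
    by (rule ennreal_leI)
  then show ?thesis
    using ab by (simp add: ennreal_mult' ennreal_power flip: ennreal_plus)
qed (auto simp: power2_eq_square ennreal_top_mult ennreal_mult_top)

text \<open>Superlevel sets of f and g at a common level s average into that of h, so
  Brunn--Minkowski can be integrated over s. Equal suprema yield an additive bound, from which the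
  product form follows.\<close>

lemma Prekopa_Leindler_unit_sup:
  fixes f g h :: "real \<Rightarrow> real"
  assumes [measurable]: "f \<in> borel_measurable borel" "g \<in> borel_measurable borel" "h \<in> borel_measurable borel"
    and f: "\<And>x. 0 \<le> f x" "\<And>x. f x \<le> 1" "\<And>s. s < 1 \<Longrightarrow> \<exists>x. s < f x"
    and g: "\<And>x. 0 \<le> g x" "\<And>x. g x \<le> 1" "\<And>s. s < 1 \<Longrightarrow> \<exists>x. s < g x"
    and h: "\<And>x. 0 \<le> h x"
    and fgh: "\<And>x y. f x * g y \<le> (h ((x + y) / 2))\<^sup>2"
  shows "(\<integral>\<^sup>+x. f x \<partial>lborel) + (\<integral>\<^sup>+x. g x \<partial>lborel) \<le> 2 * (\<integral>\<^sup>+x. h x \<partial>lborel)"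
proof -
  let ?e = "\<lambda>f s. emeasure lborel {x. s < (f x :: real)}"
  have "(\<integral>\<^sup>+x. f x \<partial>lborel) + (\<integral>\<^sup>+x. g x \<partial>lborel)
      = (\<integral>\<^sup>+x. ennreal (min 1 (f x)) \<partial>lborel) + (\<integral>\<^sup>+x. ennreal (min 1 (g x)) \<partial>lborel)"
    using f g by (simp add: min_absorb2)
  also have "\<dots> = (\<integral>\<^sup>+s. indicator {0..<1} s * ?e f s \<partial>lborel)
      + (\<integral>\<^sup>+s. indicator {0..<1} s * ?e g s \<partial>lborel)"
    by (simp add: nn_integral_unit_layer_cake)
  also have "\<dots> = (\<integral>\<^sup>+s. indicator {0..<1} s * ?e f s + indicator {0..<1} s * ?e g s \<partial>lborel)"
    by (rule nn_integral_add[symmetric]; measurable)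
  also have "\<dots> \<le> (\<integral>\<^sup>+s. 2 * (indicator {0..<1} s * ?e h s) \<partial>lborel)"
  proof (rule nn_integral_mono)
    fix s :: real
    show "indicator {0..<1} s * ?e f s + indicator {0..<1} s * ?e g s
        \<le> 2 * (indicator {0..<1} s * ?e h s)"
    proof (cases "s \<in> {0..<1}")
      case True
      have "?e f s + ?e g s \<le> 2 * ?e h s"
      proof (rule midpoint_Brunn_Minkowski)
        fix a b assume "a \<in> {x. s < f x}" "b \<in> {x. s < g x}"
        then have "s\<^sup>2 < f a * g b"
          using True by (simp add: power2_eq_square mult_strict_mono')
        also have "\<dots> \<le> (h ((a + b) / 2))\<^sup>2" by (rule fgh)
        finally show "(a + b) / 2 \<in> {x. s < h x}"
          using h power2_less_imp_less by blast
      qed (use True f g in auto)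
      then show ?thesis using True by simp
    qed simp
  qed
  also have "\<dots> = 2 * (\<integral>\<^sup>+s. indicator {0..<1} s * ?e h s \<partial>lborel)"
    by (rule nn_integral_cmult; measurable)
  also have "\<dots> = 2 * (\<integral>\<^sup>+x. ennreal (min 1 (h x)) \<partial>lborel)"
    by (simp add: nn_integral_unit_layer_cake)
  also have "\<dots> \<le> 2 * (\<integral>\<^sup>+x. h x \<partial>lborel)"
    by (intro mult_left_mono nn_integral_mono ennreal_leI) auto
  finally show ?thesis .
qed

text \<open>Dividing f and g by their suprema a and b, and h by c = sqrt (a * b), preserves the
  hypothesis; 4xy \<le> (x + y)^2 then turns the sum into a product. If a or b is not positive, f or
  g vanishes identically.\<close>

lemma Prekopa_Leindler_bounded:
  fixes f g h :: "real \<Rightarrow> real"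
  assumes [measurable]: "f \<in> borel_measurable borel" "g \<in> borel_measurable borel" "h \<in> borel_measurable borel"
    and f: "\<And>x. 0 \<le> f x" "bdd_above (range f)"
    and g: "\<And>x. 0 \<le> g x" "bdd_above (range g)"
    and h: "\<And>x. 0 \<le> h x"
    and fgh: "\<And>x y. f x * g y \<le> (h ((x + y) / 2))\<^sup>2"
  shows "(\<integral>\<^sup>+x. f x \<partial>lborel) * (\<integral>\<^sup>+x. g x \<partial>lborel) \<le> (\<integral>\<^sup>+x. h x \<partial>lborel)\<^sup>2"
proof -
  define a b where "a = (SUP x. f x)" and "b = (SUP x. g x)"
  have fa: "f x \<le> a" and gb: "g x \<le> b" for x
    unfolding a_def b_def using f g by (auto intro: cSUP_upper)
  show ?thesis
  proof (cases "a > 0 \<and> b > 0")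
    case False
    then have "(\<forall>x. f x = 0) \<or> (\<forall>x. g x = 0)"
      using fa gb f(1) g(1) by (meson order.antisym order.trans not_less)
    then show ?thesis by auto
  next
    case True
    define c where "c = sqrt (a * b)"
    have c: "c > 0" "c\<^sup>2 = a * b" using True by (auto simp: c_def)
    have "(\<integral>\<^sup>+x. f x / a \<partial>lborel) + (\<integral>\<^sup>+x. g x / b \<partial>lborel) \<le> 2 * (\<integral>\<^sup>+x. h x / c \<partial>lborel)"
    proof (rule Prekopa_Leindler_unit_sup)
      show "\<exists>x. s < f x / a" if "s < 1" for s
      proof -
        have "s * a < a" using True that by simp
        then obtain x where "s * a < f x"
          unfolding a_def using less_cSUP_iff[OF _ f(2)] by auto
        then show ?thesis using True by (auto simp: field_simps)
      qed
      show "\<exists>x. s < g x / b" if "s < 1" for s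
      proof -
        have "s * b < b" using True that by simp
        then obtain x where "s * b < g x"
          unfolding b_def using less_cSUP_iff[OF _ g(2)] by auto
        then show ?thesis using True by (auto simp: field_simps)
      qed
      show "f x / a * (g y / b) \<le> (h ((x + y) / 2) / c)\<^sup>2" for x y
        using fgh[of x y] True c by (simp add: power_divide divide_right_mono)
    qed (use True c f g h fa gb in auto)
    then have "((\<integral>\<^sup>+x. f x / a \<partial>lborel) + (\<integral>\<^sup>+x. g x / b \<partial>lborel))\<^sup>2 \<le> (2 * (\<integral>\<^sup>+x. h x / c \<partial>lborel))\<^sup>2"
      by (rule power_mono) simp
    then have "4 * ((\<integral>\<^sup>+x. f x / a \<partial>lborel) * (\<integral>\<^sup>+x. g x / b \<partial>lborel)) \<le> (2 * (\<integral>\<^sup>+x. h x / c \<partial>lborel))\<^sup>2"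
      by (rule order_trans[OF ennreal_four_mult_le_power2_add])
    also have "\<dots> = 4 * (\<integral>\<^sup>+x. h x / c \<partial>lborel)\<^sup>2"
      by (simp add: power_mult_distrib)
    finally have *: "(\<integral>\<^sup>+x. f x / a \<partial>lborel) * (\<integral>\<^sup>+x. g x / b \<partial>lborel) \<le> (\<integral>\<^sup>+x. h x / c \<partial>lborel)\<^sup>2"
      by (subst (asm) ennreal_mult_le_mult_iff) auto
    have scale: "(\<integral>\<^sup>+x. k x \<partial>lborel) = ennreal d * (\<integral>\<^sup>+x. k x / d \<partial>lborel)"
      if [measurable]: "k \<in> borel_measurable borel" and "d > 0" for d :: real and k :: "real \<Rightarrow> real"
      using that by (subst nn_integral_cmult[symmetric]) (auto simp flip: ennreal_mult')
    have "(\<integral>\<^sup>+x. f x \<partial>lborel) * (\<integral>\<^sup>+x. g x \<partial>lborel)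
       = ennreal (a * b) * ((\<integral>\<^sup>+x. f x / a \<partial>lborel) * (\<integral>\<^sup>+x. g x / b \<partial>lborel))"
      using True by (simp add: scale[of f a] scale[of g b] ennreal_mult' mult_ac)
    also have "\<dots> \<le> ennreal (c\<^sup>2) * (\<integral>\<^sup>+x. h x / c \<partial>lborel)\<^sup>2"
      unfolding c by (intro mult_left_mono *) simp
    also have "\<dots> = (\<integral>\<^sup>+x. h x \<partial>lborel)\<^sup>2"
      using c by (subst scale[of h c]) (auto simp: power_mult_distrib ennreal_power)
    finally show ?thesis .
  qed
qed

text \<open>Truncating all three functions at the same level n preserves the midpoint hypothesis;
  monotone convergence removes the truncation.\<close>

theorem Prekopa_Leindler:
  fixes F G H :: "real \<Rightarrow> ennreal"
  assumes [measurable]: "F \<in> borel_measurable borel" "G \<in> borel_measurable borel" "H \<in> borel_measurable borel"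
    and FGH: "\<And>x y. F x * G y \<le> (H ((x + y) / 2))\<^sup>2"
  shows "(\<integral>\<^sup>+x. F x \<partial>lborel) * (\<integral>\<^sup>+x. G x \<partial>lborel) \<le> (\<integral>\<^sup>+x. H x \<partial>lborel)\<^sup>2"
proof -
  define t where "t K n x = enn2real (min (K x) (of_nat n))" for K :: "real \<Rightarrow> ennreal" and n x
  have fin: "min k (of_nat n) < top" for k :: ennreal and n
    by (simp add: min_less_iff_disj of_nat_less_top)
  have t: "ennreal (t K n x) = min (K x) (of_nat n)" for K n x
    using fin by (simp add: t_def)
  have t_le: "t K n x \<le> real n" for K n x
    unfolding t_def by (rule enn2real_leI) (auto simp: ennreal_of_nat_eq_real_of_nat)
  have t_nn: "0 \<le> t K n x" for K n x
    by (simp add: t_def)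
  have [measurable]: "t K n \<in> borel_measurable borel" if [measurable]: "K \<in> borel_measurable borel" for K n
    unfolding t_def by measurable
  have SUP: "(\<integral>\<^sup>+x. K x \<partial>lborel) = (SUP n. \<integral>\<^sup>+x. t K n x \<partial>lborel)"
    if [measurable]: "K \<in> borel_measurable borel" for K
  proof -
    have "(\<integral>\<^sup>+x. K x \<partial>lborel) = (\<integral>\<^sup>+x. (SUP n. ennreal (t K n x)) \<partial>lborel)"
    proof (rule nn_integral_cong)
      fix x
      have "(SUP n. min (K x) (of_nat n)) = min (K x) (SUP n. of_nat n)"
        by (simp add: inf_SUP flip: inf_min)
      then show "K x = (SUP n. ennreal (t K n x))"
        by (simp add: t ennreal_SUP_of_nat_eq_top)
    qed
    also have "\<dots> = (SUP n. \<integral>\<^sup>+x. t K n x \<partial>lborel)"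
    proof (rule nn_integral_monotone_convergence_SUP)
      show "incseq (\<lambda>n x. ennreal (t K n x))"
        unfolding t by (intro incseq_SucI le_funI min.mono) (auto intro: of_nat_mono)
    qed measurable
    finally show ?thesis .
  qed
  have mono: "(\<integral>\<^sup>+x. t K n x \<partial>lborel) \<le> (\<integral>\<^sup>+x. t K m x \<partial>lborel)" if "n \<le> m" for K n m
    unfolding t using that by (intro nn_integral_mono min.mono) (auto intro: of_nat_mono)
  have step: "(\<integral>\<^sup>+x. t F n x \<partial>lborel) * (\<integral>\<^sup>+x. t G n x \<partial>lborel) \<le> (\<integral>\<^sup>+x. H x \<partial>lborel)\<^sup>2" for n
  proof -
    have "(\<integral>\<^sup>+x. t F n x \<partial>lborel) * (\<integral>\<^sup>+x. t G n x \<partial>lborel) \<le> (\<integral>\<^sup>+x. t H n x \<partial>lborel)\<^sup>2"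
    proof (rule Prekopa_Leindler_bounded)
      fix x y
      have "min (F x) (of_nat n) * min (G y) (of_nat n) \<le> (min (H ((x + y) / 2)) (of_nat n))\<^sup>2"
      proof (cases "H ((x + y) / 2) \<le> of_nat n")
        case True
        have "min (F x) (of_nat n) * min (G y) (of_nat n) \<le> F x * G y"
          by (intro mult_mono) auto
        with FGH[of x y] True show ?thesis by (auto simp: min_def)
      next
        case False
        have "min (F x) (of_nat n) * min (G y) (of_nat n) \<le> of_nat n * of_nat n"
          by (intro mult_mono) auto
        then show ?thesis using False by (simp add: min_def power2_eq_square)
      qed
      then show "t F n x * t G n y \<le> (t H n ((x + y) / 2))\<^sup>2"
        by (subst ennreal_le_iff[symmetric])
          (auto simp: ennreal_mult t_nn t simp flip: ennreal_power)
    qed (auto simp: t_nn intro!: bdd_aboveI2 t_le)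
    also have "\<dots> \<le> (\<integral>\<^sup>+x. H x \<partial>lborel)\<^sup>2"
      by (intro power_mono nn_integral_mono) (auto simp: t)
    finally show ?thesis .
  qed
  \<comment> \<open>The two suprema run over independent indices; the truncation at max n m
    dominates both.\<close>
  have "(\<integral>\<^sup>+x. t F n x \<partial>lborel) * (\<integral>\<^sup>+x. t G m x \<partial>lborel) \<le> (\<integral>\<^sup>+x. H x \<partial>lborel)\<^sup>2" for n m
    using step[of "max n m"] by (rule order_trans[rotated]) (auto intro!: mult_mono mono)
  then show ?thesis
    unfolding SUP[of F, simplified] SUP[of G, simplified] SUP_mult_right_ennreal
    unfolding SUP_mult_left_ennreal by (intro SUP_least)
qed

section \<open>Product Gaussian measures\<close>

abbreviation std_normal_product :: "'i set \<Rightarrow> ('i \<Rightarrow> real) measure" where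
  "std_normal_product I \<equiv> \<Pi>\<^sub>M i\<in>I. std_normal_distribution"

interpretation std_normal: prob_space std_normal_distribution
  by (rule prob_space_normal_density) simp

interpretation std_normal_product: product_sigma_finite "\<lambda>_. std_normal_distribution"
  by standard

lemma nn_integral_std_normal:
  assumes "F \<in> borel_measurable borel"
  shows "(\<integral>\<^sup>+x. F x \<partial>std_normal_distribution) = (\<integral>\<^sup>+x. ennreal (std_normal_density x) * F x \<partial>lborel)"
  using assms by (subst nn_integral_density) auto

text \<open>This is the parallelogram identity in the exponents. The factor exp ((x - y)^2/4)
  quantifies the strong log-concavity of the density.\<close>

lemma std_normal_density_midpoint:
  "std_normal_density x * std_normal_density y * exp ((x - y)\<^sup>2 / 4) = (std_normal_density ((x + y) / 2))\<^sup>2"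
proof -
  have "- x\<^sup>2 / 2 + - y\<^sup>2 / 2 + (x - y)\<^sup>2 / 4 = - ((x + y) / 2)\<^sup>2 / 2 + - ((x + y) / 2)\<^sup>2 / 2"
    by (simp add: power2_eq_square field_simps)
  then have "exp (- x\<^sup>2 / 2) * exp (- y\<^sup>2 / 2) * exp ((x - y)\<^sup>2 / 4)
      = exp (- ((x + y) / 2)\<^sup>2 / 2) * exp (- ((x + y) / 2)\<^sup>2 / 2)"
    by (simp only: flip: exp_add)
  then show ?thesis
    unfolding std_normal_density_def power2_eq_square[of "_ * exp _"]
    by (simp only: mult_ac)
qed

text \<open>Prekopa--Leindler is applied to the functions multiplied by the density, whose midpoint
  gain absorbs the surplus factor allowed in the hypothesis.\<close>

lemma Gaussian_Prekopa_Leindler_1: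
  assumes [measurable]: "F \<in> borel_measurable borel" "G \<in> borel_measurable borel" "H \<in> borel_measurable borel"
    and FGH: "\<And>x y. F x * G y \<le> (H ((x + y) / 2))\<^sup>2 * ennreal (exp ((x - y)\<^sup>2 / 4))"
  shows "(\<integral>\<^sup>+x. F x \<partial>std_normal_distribution) * (\<integral>\<^sup>+x. G x \<partial>std_normal_distribution)
    \<le> (\<integral>\<^sup>+x. H x \<partial>std_normal_distribution)\<^sup>2"
proof -
  let ?d = "\<lambda>x. ennreal (std_normal_density x)"
  have "(\<integral>\<^sup>+x. ?d x * F x \<partial>lborel) * (\<integral>\<^sup>+x. ?d x * G x \<partial>lborel) \<le> (\<integral>\<^sup>+x. ?d x * H x \<partial>lborel)\<^sup>2"
  proof (rule Prekopa_Leindler)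
    fix x y :: real
    have "(?d x * F x) * (?d y * G y) = (?d x * ?d y) * (F x * G y)"
      by (simp add: mult_ac)
    also have "\<dots> \<le> (?d x * ?d y) * ((H ((x + y) / 2))\<^sup>2 * ennreal (exp ((x - y)\<^sup>2 / 4)))"
      by (intro mult_left_mono FGH) simp
    also have "\<dots> = ennreal (std_normal_density x * std_normal_density y * exp ((x - y)\<^sup>2 / 4)) * (H ((x + y) / 2))\<^sup>2"
      by (simp add: ennreal_mult' mult_ac)
    also have "\<dots> = (?d ((x + y) / 2) * H ((x + y) / 2))\<^sup>2"
      by (simp only: std_normal_density_midpoint) (simp add: power_mult_distrib ennreal_power)
    finally show "(?d x * F x) * (?d y * G y) \<le> (?d ((x + y) / 2) * H ((x + y) / 2))\<^sup>2" .
  qed measurable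
  then show ?thesis by (simp add: nn_integral_std_normal)
qed

lemma measurable_fun_upd_std_normal_product:
  assumes "F \<in> borel_measurable (std_normal_product (insert j I))"
  shows "(\<lambda>(x, s). F (x(j := s))) \<in> borel_measurable (std_normal_product I \<Otimes>\<^sub>M std_normal_distribution)"
  using measurable_compose[OF measurable_add_dim assms] by (simp add: split_beta')

lemma borel_measurable_section_std_normal_product:
  assumes "F \<in> borel_measurable (std_normal_product (insert j I))" "x \<in> space (std_normal_product I)"
  shows "(\<lambda>s. F (x(j := s))) \<in> borel_measurable borel"
proof -
  have "(\<lambda>s. F (x(j := s))) \<in> borel_measurable std_normal_distribution"
    using measurable_Pair2[OF measurable_fun_upd_std_normal_product[OF assms(1)] assms(2)] by simp
  then show ?thesis by simp
qed

lemma borel_measurable_integral_section_std_normal_product: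
  assumes "F \<in> borel_measurable (std_normal_product (insert j I))"
  shows "(\<lambda>x. \<integral>\<^sup>+s. F (x(j := s)) \<partial>std_normal_distribution) \<in> borel_measurable (std_normal_product I)"
  using std_normal.borel_measurable_nn_integral[OF measurable_fun_upd_std_normal_product[OF assms]] by simp

lemma extensional_insert_fun_upd: "x \<in> extensional I \<Longrightarrow> x(j := s) \<in> extensional (insert j I)"
  by (simp add: extensional_def)

lemma in_space_std_normal_product:
  "x \<in> space (std_normal_product I) \<longleftrightarrow> x \<in> extensional I"
  by (auto simp: space_PiM PiE_def)

text \<open>Tensorization: the inequality on the line, applied to sections in the coordinate j,
  shows that the partial integrals satisfy the hypothesis over the remaining coordinates.\<close>

theorem Gaussian_Prekopa_Leindler:
  assumes "finite I"
    and "F \<in> borel_measurable (std_normal_product I)" "G \<in> borel_measurable (std_normal_product I)"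
      "H \<in> borel_measurable (std_normal_product I)"
    and "\<And>x y. x \<in> extensional I \<Longrightarrow> y \<in> extensional I \<Longrightarrow>
      F x * G y \<le> (H (\<lambda>i\<in>I. (x i + y i) / 2))\<^sup>2 * ennreal (exp (\<Sum>i\<in>I. (x i - y i)\<^sup>2 / 4))"
  shows "(\<integral>\<^sup>+x. F x \<partial>std_normal_product I) * (\<integral>\<^sup>+x. G x \<partial>std_normal_product I)
    \<le> (\<integral>\<^sup>+x. H x \<partial>std_normal_product I)\<^sup>2"
  using assms
proof (induction I arbitrary: F G H)
  case empty
  then show ?case
    by (simp add: PiM_empty nn_integral_count_space_finite restrict_def)
next
  case (insert j I)
  note meas = insert.prems(1-3)
  let ?S = "\<lambda>F x. \<integral>\<^sup>+s. F (x(j := s)) \<partial>std_normal_distribution"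
  have "(\<integral>\<^sup>+x. ?S F x \<partial>std_normal_product I) * (\<integral>\<^sup>+x. ?S G x \<partial>std_normal_product I)
      \<le> (\<integral>\<^sup>+x. ?S H x \<partial>std_normal_product I)\<^sup>2"
  proof (rule insert.IH)
    fix x y :: "'a \<Rightarrow> real"
    assume x: "x \<in> extensional I" and y: "y \<in> extensional I"
    let ?m = "\<lambda>i\<in>I. (x i + y i) / 2"
    let ?E = "\<Sum>i\<in>I. (x i - y i)\<^sup>2 / 4"
    have sec: "(\<lambda>s. F (x(j := s))) \<in> borel_measurable borel"
      "(\<lambda>s. G (y(j := s))) \<in> borel_measurable borel"
      "(\<lambda>s. H (?m(j := s))) \<in> borel_measurable borel"
      using meas x y by (auto intro!: borel_measurable_section_std_normal_product simp: in_space_std_normal_product)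
    \<comment> \<open>For the inner integral the surplus of the outer coordinates is a constant;
      half of its exponent goes to each of the two factors H.\<close>
    have "?S F x * ?S G y \<le> (\<integral>\<^sup>+s. H (?m(j := s)) * ennreal (exp (?E / 2)) \<partial>std_normal_distribution)\<^sup>2"
    proof (rule Gaussian_Prekopa_Leindler_1)
      fix s t :: real
      have m: "(\<lambda>i\<in>insert j I. ((x(j := s)) i + (y(j := t)) i) / 2) = ?m(j := (s + t) / 2)"
        using insert.hyps by (auto simp: fun_eq_iff)
      have E: "(\<Sum>i\<in>insert j I. ((x(j := s)) i - (y(j := t)) i)\<^sup>2 / 4) = (s - t)\<^sup>2 / 4 + ?E"
        using insert.hyps by (simp cong: sum.cong) (intro sum.cong, auto)
      have "F (x(j := s)) * G (y(j := t)) \<le> (H (?m(j := (s + t) / 2)))\<^sup>2 * ennreal (exp ((s - t)\<^sup>2 / 4 + ?E))"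
        by (rule insert.prems(4)[of "x(j := s)" "y(j := t)", unfolded m E,
              OF extensional_insert_fun_upd[OF x] extensional_insert_fun_upd[OF y]])
      also have "exp ((s - t)\<^sup>2 / 4 + ?E) = (exp (?E / 2))\<^sup>2 * exp ((s - t)\<^sup>2 / 4)"
        by (simp add: exp_add power2_eq_square flip: exp_add)
      also have "(H (?m(j := (s + t) / 2)))\<^sup>2 * ennreal ((exp (?E / 2))\<^sup>2 * exp ((s - t)\<^sup>2 / 4))
          = (H (?m(j := (s + t) / 2)) * ennreal (exp (?E / 2)))\<^sup>2 * ennreal (exp ((s - t)\<^sup>2 / 4))"
        by (simp add: power_mult_distrib ennreal_mult' ennreal_power mult_ac)
      finally show "F (x(j := s)) * G (y(j := t))
          \<le> (H (?m(j := (s + t) / 2)) * ennreal (exp (?E / 2)))\<^sup>2 * ennreal (exp ((s - t)\<^sup>2 / 4))" .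
    qed (use sec in measurable)
    also have "\<dots> = (?S H ?m)\<^sup>2 * ennreal ((exp (?E / 2))\<^sup>2)"
      using sec by (subst nn_integral_multc) (auto simp: power_mult_distrib ennreal_power)
    also have "(exp (?E / 2))\<^sup>2 = exp ?E"
      by (simp add: power2_eq_square flip: exp_add)
    finally show "?S F x * ?S G y \<le> (?S H ?m)\<^sup>2 * ennreal (exp ?E)" .
  qed (rule borel_measurable_integral_section_std_normal_product, rule meas)+
  then show ?case
    unfolding meas[THEN std_normal_product.product_nn_integral_insert[OF insert.hyps]] .
qed

section \<open>Reflection and translation of product Gaussian measures\<close>

lemma nn_integral_std_normal_uminus:
  assumes [measurable]: "F \<in> borel_measurable borel"
  shows "(\<integral>\<^sup>+x. F (- x) \<partial>std_normal_distribution) = (\<integral>\<^sup>+x. F x \<partial>std_normal_distribution)"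
proof -
  have "(\<integral>\<^sup>+x. F x \<partial>std_normal_distribution)
      = (\<integral>\<^sup>+x. ennreal (std_normal_density (0 + (-1) * x)) * F (0 + (-1) * x) \<partial>lborel)"
    by (subst nn_integral_std_normal, simp)
      (subst nn_integral_real_affine[where c = "-1" and t = 0], simp_all)
  also have "\<dots> = (\<integral>\<^sup>+x. ennreal (std_normal_density x) * F (- x) \<partial>lborel)"
    by (simp add: std_normal_density_def)
  also have "\<dots> = (\<integral>\<^sup>+x. F (- x) \<partial>std_normal_distribution)"
    by (simp add: nn_integral_std_normal)
  finally show ?thesis by (rule sym)
qed

text \<open>The Cameron--Martin formula on the line; the weight is the quotient of the translated
  and the original density.\<close>

lemma nn_integral_std_normal_shift:
  assumes [measurable]: "F \<in> borel_measurable borel"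
  shows "(\<integral>\<^sup>+x. F (x + a) * ennreal (exp (- a * x - a\<^sup>2 / 2)) \<partial>std_normal_distribution)
    = (\<integral>\<^sup>+x. F x \<partial>std_normal_distribution)"
proof -
  have d: "std_normal_density (a + x) = std_normal_density x * exp (- a * x - a\<^sup>2 / 2)" for x
  proof -
    have "- (a + x)\<^sup>2 / 2 = - x\<^sup>2 / 2 + (- a * x - a\<^sup>2 / 2)"
      by (simp add: power2_eq_square field_simps)
    then show ?thesis
      unfolding std_normal_density_def by (simp only: exp_add mult.assoc)
  qed
  have "(\<integral>\<^sup>+x. F x \<partial>std_normal_distribution) = (\<integral>\<^sup>+x. ennreal (std_normal_density (a + x)) * F (a + x) \<partial>lborel)"
    by (simp add: nn_integral_std_normal)
      (subst nn_integral_real_affine[where c = 1 and t = a], auto)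
  also have "\<dots> = (\<integral>\<^sup>+x. F (x + a) * ennreal (exp (- a * x - a\<^sup>2 / 2)) \<partial>std_normal_distribution)"
    by (simp only: d) (simp add: nn_integral_std_normal ennreal_mult' mult_ac add.commute)
  finally show ?thesis by (rule sym)
qed

lemma measurable_restrict_std_normal_product [measurable]:
  assumes [measurable]: "\<And>i. i \<in> I \<Longrightarrow> f i \<in> borel_measurable M"
  shows "(\<lambda>x. \<lambda>i\<in>I. f i x) \<in> M \<rightarrow>\<^sub>M std_normal_product I"
  by (rule measurable_restrict) simp

lemma measurable_component_std_normal_product:
  "i \<in> I \<Longrightarrow> (\<lambda>x. x i) \<in> borel_measurable (std_normal_product I)"
  using measurable_component_singleton[of i I "\<lambda>_. std_normal_distribution"] by simp

lemma nn_integral_std_normal_product_uminus: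
  assumes "finite I" "F \<in> borel_measurable (std_normal_product I)"
  shows "(\<integral>\<^sup>+x. F (\<lambda>i\<in>I. - x i) \<partial>std_normal_product I) = (\<integral>\<^sup>+x. F x \<partial>std_normal_product I)"
  using assms
proof (induction I arbitrary: F)
  case empty
  then show ?case by (simp add: PiM_empty nn_integral_count_space_finite restrict_def)
next
  case (insert j I)
  note [measurable] = insert.prems
  note [measurable (raw)] = measurable_component_std_normal_product
  have neg[measurable]: "(\<lambda>x. F (\<lambda>i\<in>insert j I. - x i)) \<in> borel_measurable (std_normal_product (insert j I))"
    by measurable
  have "(\<integral>\<^sup>+x. F (\<lambda>i\<in>insert j I. - x i) \<partial>std_normal_product (insert j I))
      = (\<integral>\<^sup>+x. (\<integral>\<^sup>+s. F ((\<lambda>i\<in>I. - x i)(j := - s)) \<partial>std_normal_distribution) \<partial>std_normal_product I)"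
    using insert.hyps
    by (subst std_normal_product.product_nn_integral_insert)
      (auto intro!: nn_integral_cong arg_cong[where f = F] simp: fun_eq_iff)
  also have "\<dots> = (\<integral>\<^sup>+x. (\<integral>\<^sup>+s. F ((\<lambda>i\<in>I. - x i)(j := s)) \<partial>std_normal_distribution) \<partial>std_normal_product I)"
    by (intro nn_integral_cong nn_integral_std_normal_uminus[where F = "\<lambda>s. F ((\<lambda>i\<in>I. - x i)(j := s))" for x]
        borel_measurable_section_std_normal_product[OF insert.prems])
      (simp add: in_space_std_normal_product)
  also have "\<dots> = (\<integral>\<^sup>+x. (\<integral>\<^sup>+s. F (x(j := s)) \<partial>std_normal_distribution) \<partial>std_normal_product I)"
    by (rule insert.IH) (rule borel_measurable_integral_section_std_normal_product, rule insert.prems)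
  also have "\<dots> = (\<integral>\<^sup>+x. F x \<partial>std_normal_product (insert j I))"
    by (rule std_normal_product.product_nn_integral_insert[OF insert.hyps insert.prems, symmetric])
  finally show ?case .
qed

lemma nn_integral_std_normal_product_shift:
  assumes "finite I" "F \<in> borel_measurable (std_normal_product I)"
  shows "(\<integral>\<^sup>+x. F (\<lambda>i\<in>I. x i + a i) * ennreal (exp (\<Sum>i\<in>I. - a i * x i - (a i)\<^sup>2 / 2)) \<partial>std_normal_product I)
    = (\<integral>\<^sup>+x. F x \<partial>std_normal_product I)"
  using assms
proof (induction I arbitrary: F)
  case empty
  then show ?case by (simp add: PiM_empty nn_integral_count_space_finite restrict_def)
next
  case (insert j I)
  note [measurable] = insert.prems
  note [measurable (raw)] = measurable_component_std_normal_product
  let ?w = "\<lambda>I x. ennreal (exp (\<Sum>i\<in>I. - a i * x i - (a i)\<^sup>2 / 2))"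
  have shift[measurable]: "(\<lambda>x. F (\<lambda>i\<in>insert j I. x i + a i) * ?w (insert j I) x)
      \<in> borel_measurable (std_normal_product (insert j I))"
    by measurable
  have sec: "(\<lambda>s. F ((\<lambda>i\<in>I. x i + a i)(j := s))) \<in> borel_measurable borel" for x
    by (intro borel_measurable_section_std_normal_product[OF insert.prems])
      (simp add: in_space_std_normal_product)
  have "(\<integral>\<^sup>+x. F (\<lambda>i\<in>insert j I. x i + a i) * ?w (insert j I) x \<partial>std_normal_product (insert j I))
      = (\<integral>\<^sup>+x. (\<integral>\<^sup>+s. F ((\<lambda>i\<in>I. x i + a i)(j := s + a j)) * ennreal (exp (- a j * s - (a j)\<^sup>2 / 2))
           * ?w I x \<partial>std_normal_distribution) \<partial>std_normal_product I)"
  proof (subst std_normal_product.product_nn_integral_insert, goal_cases)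
    case 4
    show ?case
    proof (intro nn_integral_cong)
      fix x s
      have "(\<lambda>i\<in>insert j I. (x(j := s)) i + a i) = (\<lambda>i\<in>I. x i + a i)(j := s + a j)"
        using insert.hyps by (auto simp: fun_eq_iff)
      moreover have "(\<Sum>i\<in>insert j I. - a i * (x(j := s)) i - (a i)\<^sup>2 / 2)
          = (- a j * s - (a j)\<^sup>2 / 2) + (\<Sum>i\<in>I. - a i * x i - (a i)\<^sup>2 / 2)"
        using insert.hyps by (subst sum.insert) (auto intro!: sum.cong)
      ultimately show "F (\<lambda>i\<in>insert j I. (x(j := s)) i + a i) * ?w (insert j I) (x(j := s))
          = F ((\<lambda>i\<in>I. x i + a i)(j := s + a j)) * ennreal (exp (- a j * s - (a j)\<^sup>2 / 2)) * ?w I x"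
        by (simp only: exp_add) (simp add: ennreal_mult' mult.assoc)
    qed
  qed (use insert.hyps in auto)
  also have "\<dots> = (\<integral>\<^sup>+x. (\<integral>\<^sup>+s. F ((\<lambda>i\<in>I. x i + a i)(j := s + a j)) * ennreal (exp (- a j * s - (a j)\<^sup>2 / 2))
           \<partial>std_normal_distribution) * ?w I x \<partial>std_normal_product I)"
  proof (intro nn_integral_cong nn_integral_multc)
    fix x
    have [measurable]: "(\<lambda>s. F ((\<lambda>i\<in>I. x i + a i)(j := s + a j))) \<in> borel_measurable borel"
      using measurable_compose[OF _ sec[of x], of "\<lambda>s. s + a j" borel] by simp
    show "(\<lambda>s. F ((\<lambda>i\<in>I. x i + a i)(j := s + a j)) * ennreal (exp (- a j * s - (a j)\<^sup>2 / 2)))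
        \<in> borel_measurable std_normal_distribution"
      by simp
  qed
  also have "\<dots> = (\<integral>\<^sup>+x. (\<integral>\<^sup>+s. F ((\<lambda>i\<in>I. x i + a i)(j := s)) \<partial>std_normal_distribution) * ?w I x \<partial>std_normal_product I)"
    by (intro nn_integral_cong arg_cong2[where f = "(*)"] nn_integral_std_normal_shift[OF sec] refl)
  also have "\<dots> = (\<integral>\<^sup>+x. (\<integral>\<^sup>+s. F (x(j := s)) \<partial>std_normal_distribution) \<partial>std_normal_product I)"
    by (rule insert.IH) (rule borel_measurable_integral_section_std_normal_product, rule insert.prems)
  also have "\<dots> = (\<integral>\<^sup>+x. F x \<partial>std_normal_product (insert j I))"
    by (rule std_normal_product.product_nn_integral_insert[OF insert.hyps insert.prems, symmetric])
  finally show ?case .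
qed


section \<open>Translates of symmetric midpoint-convex sets\<close>

lemma ennreal_power2_le_imp_le:
  fixes x y :: ennreal
  assumes "x\<^sup>2 \<le> y\<^sup>2"
  shows "x \<le> y"
proof (cases x; cases y)
  fix a b assume ab: "x = ennreal a" "0 \<le> a" "y = ennreal b" "0 \<le> b"
  then have "a\<^sup>2 \<le> b\<^sup>2"
    using assms by (simp add: ennreal_power)
  then show ?thesis
    using ab by (auto intro: ennreal_leI power2_le_imp_le)
qed (use assms in \<open>auto simp: ennreal_power top_unique\<close>)

text \<open>The integrand F is paired with its reflection. If F x and F (- y) are both nonzero, then
  x - p and - y - p lie in C, hence so do y + p by symmetry and (x + y)/2 by convexity: the
  translation cancels. The tilts contribute b (x - y) \<le> b^2 + (x - y)^2/4 in each coordinate,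
  and the last term is the surplus that Gaussian Prekopa--Leindler admits. F and its reflection have
  the same integral, so the result is an inequality between squares.\<close>

lemma nn_integral_std_normal_product_tilt_le:
  assumes "finite I" and C: "C \<in> sets (std_normal_product I)"
    and sym: "\<And>x. x \<in> C \<Longrightarrow> (\<lambda>i\<in>I. - x i) \<in> C"
    and mid: "\<And>x y. x \<in> C \<Longrightarrow> y \<in> C \<Longrightarrow> (\<lambda>i\<in>I. (x i + y i) / 2) \<in> C"
  shows "(\<integral>\<^sup>+x. indicator C (\<lambda>i\<in>I. x i - p i) * ennreal (exp (\<Sum>i\<in>I. b i * x i)) \<partial>std_normal_product I)
    \<le> ennreal (exp ((\<Sum>i\<in>I. (b i)\<^sup>2) / 2)) * emeasure (std_normal_product I) C"
    (is "?L \<le> ?R")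
proof -
  note [measurable] = C
  note [measurable (raw)] = measurable_component_std_normal_product
  let ?S = "\<Sum>i\<in>I. (b i)\<^sup>2"
  define F where "F x = indicator C (\<lambda>i\<in>I. x i - p i) * ennreal (exp (\<Sum>i\<in>I. b i * x i))" for x
  define H where "H x = ennreal (exp (?S / 2)) * indicator C x" for x
  have F: "F \<in> borel_measurable (std_normal_product I)"
    unfolding F_def by measurable
  have H: "H \<in> borel_measurable (std_normal_product I)"
    unfolding H_def by measurable
  have F': "(\<lambda>x. F (\<lambda>i\<in>I. - x i)) \<in> borel_measurable (std_normal_product I)"
    by (rule measurable_compose[OF _ F]) measurable
  have "?L * (\<integral>\<^sup>+x. F (\<lambda>i\<in>I. - x i) \<partial>std_normal_product I) \<le> (\<integral>\<^sup>+x. H x \<partial>std_normal_product I)\<^sup>2"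
    unfolding F_def[symmetric]
  proof (rule Gaussian_Prekopa_Leindler[OF \<open>finite I\<close> F F' H])
    fix x y :: "'a \<Rightarrow> real"
    show "F x * F (\<lambda>i\<in>I. - y i)
        \<le> (H (\<lambda>i\<in>I. (x i + y i) / 2))\<^sup>2 * ennreal (exp (\<Sum>i\<in>I. (x i - y i)\<^sup>2 / 4))"
    proof (cases "(\<lambda>i\<in>I. x i - p i) \<in> C \<and> (\<lambda>i\<in>I. - y i - p i) \<in> C")
      case False
      then show ?thesis by (auto simp: F_def cong: restrict_cong)
    next
      case True
      have eq1: "(\<lambda>i\<in>I. - (\<lambda>i\<in>I. - y i - p i) i) = (\<lambda>i\<in>I. y i + p i)"
        by (auto simp: fun_eq_iff)
      have eq2: "(\<lambda>i\<in>I. ((\<lambda>i\<in>I. x i - p i) i + (\<lambda>i\<in>I. y i + p i) i) / 2) = (\<lambda>i\<in>I. (x i + y i) / 2)"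
        by (auto simp: fun_eq_iff)
      have "(\<lambda>i\<in>I. (x i + y i) / 2) \<in> C"
        using mid[OF conjunct1[OF True] sym[OF conjunct2[OF True]]] unfolding eq1 eq2 .
      then have Hm: "H (\<lambda>i\<in>I. (x i + y i) / 2) = ennreal (exp (?S / 2))"
        by (simp add: H_def)
      have "(\<Sum>i\<in>I. b i * x i) + (\<Sum>i\<in>I. b i * - y i) \<le> ?S + (\<Sum>i\<in>I. (x i - y i)\<^sup>2 / 4)"
        unfolding sum.distrib[symmetric]
      proof (rule sum_mono)
        fix i
        show "b i * x i + b i * - y i \<le> (b i)\<^sup>2 + (x i - y i)\<^sup>2 / 4"
          using zero_le_power2[of "b i - (x i - y i) / 2"] by (simp add: power2_eq_square algebra_simps)
      qed
      moreover have "(exp (?S / 2))\<^sup>2 = exp ?S"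
        by (simp add: power2_eq_square flip: exp_add)
      ultimately have "exp (\<Sum>i\<in>I. b i * x i) * exp (\<Sum>i\<in>I. b i * - y i)
          \<le> (exp (?S / 2))\<^sup>2 * exp (\<Sum>i\<in>I. (x i - y i)\<^sup>2 / 4)"
        by (simp flip: exp_add)
      then have "ennreal (exp (\<Sum>i\<in>I. b i * x i) * exp (\<Sum>i\<in>I. b i * - y i))
          \<le> ennreal ((exp (?S / 2))\<^sup>2 * exp (\<Sum>i\<in>I. (x i - y i)\<^sup>2 / 4))"
        by (rule ennreal_leI)
      moreover have "F x * F (\<lambda>i\<in>I. - y i)
          = ennreal (exp (\<Sum>i\<in>I. b i * x i) * exp (\<Sum>i\<in>I. b i * - y i))"
        using True by (simp add: F_def ennreal_mult' cong: restrict_cong sum.cong)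
      ultimately show ?thesis
        unfolding Hm by (simp add: ennreal_mult' ennreal_power)
    qed
  qed
  also have "(\<integral>\<^sup>+x. F (\<lambda>i\<in>I. - x i) \<partial>std_normal_product I) = ?L"
    unfolding F_def[symmetric] by (rule nn_integral_std_normal_product_uminus[OF \<open>finite I\<close> F])
  also have "(\<integral>\<^sup>+x. H x \<partial>std_normal_product I) = ?R"
    unfolding H_def by (subst nn_integral_cmult) auto
  finally have "?L\<^sup>2 \<le> ?R\<^sup>2"
    unfolding power2_eq_square .
  then show ?thesis
    by (rule ennreal_power2_le_imp_le)
qed

text \<open>After the translation formula, symmetry of C allows the weight to be averaged with its
  reflection. The average is exp (- |p|^2/2) times cosh of the inner product of p and x, and cosh is
  at least 1.\<close>

lemma emeasure_std_normal_product_shift_ge: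
  assumes "finite I" and C: "C \<in> sets (std_normal_product I)"
    and sym: "\<And>x. x \<in> extensional I \<Longrightarrow> (\<lambda>i\<in>I. - x i) \<in> C \<longleftrightarrow> x \<in> C"
  shows "ennreal (exp (- (\<Sum>i\<in>I. (p i)\<^sup>2) / 2)) * emeasure (std_normal_product I) C
    \<le> emeasure (std_normal_product I) {x \<in> space (std_normal_product I). (\<lambda>i\<in>I. x i - p i) \<in> C}"
proof -
  note [measurable] = C
  note [measurable (raw)] = measurable_component_std_normal_product
  define F where "F x = (indicator C (\<lambda>i\<in>I. x i - p i) :: ennreal)" for x
  define w where "w x = exp (\<Sum>i\<in>I. - p i * x i - (p i)\<^sup>2 / 2)" for x
  have F[measurable]: "F \<in> borel_measurable (std_normal_product I)"
    unfolding F_def by measurable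
  have w[measurable]: "w \<in> borel_measurable (std_normal_product I)"
    unfolding w_def by measurable
  have G: "(\<lambda>x. indicator C x * ennreal (w x)) \<in> borel_measurable (std_normal_product I)"
    by measurable
  have G': "(\<lambda>x. indicator C x * ennreal (w (\<lambda>i\<in>I. - x i))) \<in> borel_measurable (std_normal_product I)"
    by measurable
  let ?E = "emeasure (std_normal_product I) {x \<in> space (std_normal_product I). (\<lambda>i\<in>I. x i - p i) \<in> C}"
  have "?E = (\<integral>\<^sup>+x. F x \<partial>std_normal_product I)"
  proof -
    have "(\<integral>\<^sup>+x. F x \<partial>std_normal_product I)
        = (\<integral>\<^sup>+x. indicator {x \<in> space (std_normal_product I). (\<lambda>i\<in>I. x i - p i) \<in> C} x \<partial>std_normal_product I)"
      unfolding F_def by (intro nn_integral_cong) (auto simp: indicator_def)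
    then show ?thesis by simp
  qed
  also have "\<dots> = (\<integral>\<^sup>+x. F (\<lambda>i\<in>I. x i + p i) * ennreal (w x) \<partial>std_normal_product I)"
    unfolding w_def by (rule nn_integral_std_normal_product_shift[OF \<open>finite I\<close> F, symmetric])
  also have "\<dots> = (\<integral>\<^sup>+x. indicator C x * ennreal (w x) \<partial>std_normal_product I)"
  proof (rule nn_integral_cong)
    fix x assume "x \<in> space (std_normal_product I)"
    then have "(\<lambda>i\<in>I. (\<lambda>i\<in>I. x i + p i) i - p i) = x"
      by (auto simp: in_space_std_normal_product fun_eq_iff extensional_def)
    then show "F (\<lambda>i\<in>I. x i + p i) * ennreal (w x) = indicator C x * ennreal (w x)"
      unfolding F_def by (simp only:)
  qed
  finally have E: "?E = (\<integral>\<^sup>+x. indicator C x * ennreal (w x) \<partial>std_normal_product I)" .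
  also have "\<dots> = (\<integral>\<^sup>+x. indicator C (\<lambda>i\<in>I. - x i) * ennreal (w (\<lambda>i\<in>I. - x i)) \<partial>std_normal_product I)"
    by (rule nn_integral_std_normal_product_uminus[OF \<open>finite I\<close> G, symmetric])
  also have "\<dots> = (\<integral>\<^sup>+x. indicator C x * ennreal (w (\<lambda>i\<in>I. - x i)) \<partial>std_normal_product I)"
    using sym by (intro nn_integral_cong) (auto simp: in_space_std_normal_product indicator_def)
  finally have E': "?E = (\<integral>\<^sup>+x. indicator C x * ennreal (w (\<lambda>i\<in>I. - x i)) \<partial>std_normal_product I)" .
  have "2 * (ennreal (exp (- (\<Sum>i\<in>I. (p i)\<^sup>2) / 2)) * emeasure (std_normal_product I) C)
     = (\<integral>\<^sup>+x. 2 * ennreal (exp (- (\<Sum>i\<in>I. (p i)\<^sup>2) / 2)) * indicator C x \<partial>std_normal_product I)"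
    by (subst nn_integral_cmult) (auto simp: mult.assoc)
  also have "\<dots> \<le> (\<integral>\<^sup>+x. indicator C x * ennreal (w x) + indicator C x * ennreal (w (\<lambda>i\<in>I. - x i)) \<partial>std_normal_product I)"
  proof (rule nn_integral_mono)
    fix x
    let ?s = "\<Sum>i\<in>I. (p i)\<^sup>2 / 2" and ?t = "\<Sum>i\<in>I. p i * x i"
    have "2 * exp (- ?s) \<le> exp (- ?t - ?s) + exp (?t - ?s)"
    proof -
      have "2 \<le> exp (- ?t) + exp ?t"
        using exp_ge_add_one_self[of ?t] exp_ge_add_one_self[of "- ?t"] by linarith
      then have "2 * exp (- ?s) \<le> (exp (- ?t) + exp ?t) * exp (- ?s)"
        by (intro mult_right_mono) auto
      then show ?thesis
        by (simp add: distrib_right flip: exp_add)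
    qed
    moreover have "w x = exp (- ?t - ?s)"
      by (simp add: w_def sum_subtractf sum_negf)
    moreover have "w (\<lambda>i\<in>I. - x i) = exp (?t - ?s)"
      by (simp add: w_def sum_subtractf cong: sum.cong)
    ultimately have "2 * exp (- (\<Sum>i\<in>I. (p i)\<^sup>2) / 2) \<le> w x + w (\<lambda>i\<in>I. - x i)"
      by (simp add: sum_divide_distrib)
    then have "ennreal (2 * exp (- (\<Sum>i\<in>I. (p i)\<^sup>2) / 2)) \<le> ennreal (w x + w (\<lambda>i\<in>I. - x i))"
      by (rule ennreal_leI)
    then have "2 * ennreal (exp (- (\<Sum>i\<in>I. (p i)\<^sup>2) / 2)) \<le> ennreal (w x) + ennreal (w (\<lambda>i\<in>I. - x i))"
      by (simp add: w_def ennreal_mult')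
    then show "2 * ennreal (exp (- (\<Sum>i\<in>I. (p i)\<^sup>2) / 2)) * indicator C x
        \<le> indicator C x * ennreal (w x) + indicator C x * ennreal (w (\<lambda>i\<in>I. - x i))"
      by (auto simp: indicator_def)
  qed
  also have "\<dots> = ?E + ?E"
    unfolding nn_integral_add[OF G G'] by (simp only: flip: E E')
  finally show ?thesis
    by (subst (asm) mult_2[symmetric], subst (asm) ennreal_mult_le_mult_iff) auto
qed

section \<open>Functionals under a centred Gaussian measure\<close>

lemma bounded_linear_imp_borel_measurable:
  "bounded_linear f \<Longrightarrow> f \<in> borel_measurable borel"
  by (intro borel_measurable_continuous_onI linear_continuous_on)

locale centred_gaussian = prob_space \<mu>
  for \<mu> :: "'a::{banach, second_countable_topology} measure" +
  assumes gaussian: "gaussian_measure \<mu>"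
    and centred: "centred \<mu>"
    and nondegenerate: "nondegenerate \<mu>"
begin

lemma sets_borel [measurable_cong, simp]: "sets \<mu> = sets borel"
  using gaussian by (simp add: gaussian_measure_def)

lemma space_UNIV [simp]: "space \<mu> = UNIV"
  using sets_eq_imp_space_eq[OF sets_borel] by simp

lemma functional_measurable: "bounded_linear (f :: 'a \<Rightarrow> real) \<Longrightarrow> f \<in> borel_measurable \<mu>"
  using bounded_linear_imp_borel_measurable measurable_cong_sets[OF sets_borel refl] by blast

lemma expectation_functional:
  "bounded_linear (f :: 'a \<Rightarrow> real) \<Longrightarrow> expectation f = 0"
  using centred by (simp add: centred_def)

lemma functional_law:
  assumes f: "bounded_linear (f :: 'a \<Rightarrow> real)"
  obtains (normal) \<sigma> where "\<sigma> > 0" "distributed \<mu> lborel f (normal_density 0 \<sigma>)"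
  | (dirac) "distr \<mu> borel f = return borel 0"
proof -
  note [measurable] = functional_measurable[OF f]
  have "gaussian_law (distr \<mu> borel f)"
    using gaussian f by (simp add: gaussian_measure_def)
  then consider m \<sigma> where "\<sigma> > 0" "distr \<mu> borel f = density lborel (normal_density m \<sigma>)"
    | m where "distr \<mu> borel f = return borel m"
    by (auto simp: gaussian_law_def)
  then show thesis
  proof cases
    case (1 m \<sigma>)
    have d: "distributed \<mu> lborel f (normal_density m \<sigma>)"
      using 1 by (auto simp: distributed_def cong: distr_cong)
    have "m = 0"
      using normal_distributed_expectation[OF 1(1) d] expectation_functional[OF f] by simp
    with 1 d show thesis by (auto intro: normal)
  next
    case (2 m)
    have "expectation f = (\<integral>x. x \<partial>distr \<mu> borel f)"
      by (simp add: integral_distr)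
    also have "\<dots> = m" unfolding 2 by (subst integral_return) auto
    finally have "m = 0" using expectation_functional[OF f] by simp
    with 2 show thesis by (auto intro: dirac)
  qed
qed

section \<open>Covariance and independence of functionals\<close>

lemma integrable_functional_power2:
  assumes f: "bounded_linear (f :: 'a \<Rightarrow> real)"
  shows "integrable \<mu> (\<lambda>x. (f x)\<^sup>2)"
  using f
proof (cases rule: functional_law)
  case (normal \<sigma>)
  have "integrable lborel (\<lambda>x. normal_density 0 \<sigma> x * (x - 0) ^ 2)"
    by (rule integrable_normal_moment) (use normal in simp)
  then show ?thesis
    using distributed_integrable[OF normal(2), of "\<lambda>x. x\<^sup>2"] by simp
next
  case dirac
  note [measurable] = functional_measurable[OF f]
  have "integrable (return borel 0) (\<lambda>x::real. x\<^sup>2)"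
    by (rule integrableI_bounded) (auto simp: nn_integral_return)
  then show ?thesis
    using integrable_distr[of f \<mu> borel "\<lambda>x. x\<^sup>2"] by (simp add: dirac)
qed

lemma integrable_functional_mult:
  assumes f: "bounded_linear (f :: 'a \<Rightarrow> real)" and g: "bounded_linear (g :: 'a \<Rightarrow> real)"
  shows "integrable \<mu> (\<lambda>x. f x * g x)"
proof (rule Bochner_Integration.integrable_bound)
  show "integrable \<mu> (\<lambda>x. (f x)\<^sup>2 + (g x)\<^sup>2)"
    using f g by (intro Bochner_Integration.integrable_add integrable_functional_power2)
  show "AE x in \<mu>. norm (f x * g x) \<le> norm ((f x)\<^sup>2 + (g x)\<^sup>2)"
  proof (rule AE_I2)
    fix x
    have "2 * (\<bar>f x\<bar> * \<bar>g x\<bar>) \<le> (f x)\<^sup>2 + (g x)\<^sup>2"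
      using zero_le_power2[of "\<bar>f x\<bar> - \<bar>g x\<bar>"] by (simp add: power2_eq_square algebra_simps)
    moreover have "0 \<le> \<bar>f x\<bar> * \<bar>g x\<bar>" by simp
    ultimately have "\<bar>f x\<bar> * \<bar>g x\<bar> \<le> (f x)\<^sup>2 + (g x)\<^sup>2" by linarith
    then show "norm (f x * g x) \<le> norm ((f x)\<^sup>2 + (g x)\<^sup>2)"
      by (simp add: abs_mult)
  qed
  show "(\<lambda>x. f x * g x) \<in> borel_measurable \<mu>"
    using functional_measurable[OF f] functional_measurable[OF g] by measurable
qed

text \<open>As functionals are centred, the covariance is their inner product in L2. Nondegeneracy
  makes it definite on the dual space, so orthonormalization is possible there.\<close>

definition cov :: "('a \<Rightarrow> real) \<Rightarrow> ('a \<Rightarrow> real) \<Rightarrow> real" where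
  "cov f g = (\<integral>x. f x * g x \<partial>\<mu>)"

lemma cov_commute: "cov f g = cov g f"
  by (simp add: cov_def mult.commute)

lemma cov_self: "cov f f = (\<integral>x. (f x)\<^sup>2 \<partial>\<mu>)"
  by (simp add: cov_def power2_eq_square)

lemma cov_add_left:
  "bounded_linear f \<Longrightarrow> bounded_linear g \<Longrightarrow> bounded_linear h \<Longrightarrow> cov (\<lambda>x. f x + g x) h = cov f h + cov g h"
  by (simp add: cov_def distrib_right integrable_functional_mult)

lemma cov_diff_left:
  "bounded_linear f \<Longrightarrow> bounded_linear g \<Longrightarrow> bounded_linear h \<Longrightarrow> cov (\<lambda>x. f x - g x) h = cov f h - cov g h"
  by (simp add: cov_def left_diff_distrib integrable_functional_mult)

lemma cov_scale_left: "cov (\<lambda>x. c * f x) h = c * cov f h"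
  by (simp add: cov_def mult.assoc)

lemma cov_sum_left:
  assumes "\<And>i. i \<in> I \<Longrightarrow> bounded_linear (f i)" "bounded_linear h"
  shows "cov (\<lambda>x. \<Sum>i\<in>I. f i x) h = (\<Sum>i\<in>I. cov (f i) h)"
  using assms by (simp add: cov_def sum_distrib_right integrable_functional_mult)

lemma cov_self_pos:
  assumes "bounded_linear f" "f \<noteq> (\<lambda>x. 0)"
  shows "0 < cov f f"
  using nondegenerate assms by (simp add: nondegenerate_def expectation_functional cov_self)

lemma cov_self_std_normal:
  assumes f: "bounded_linear f" and "cov f f = 1"
  shows "distr \<mu> borel f = std_normal_distribution"
  using f
proof (cases rule: functional_law)
  case (normal \<sigma>)
  have "\<sigma>\<^sup>2 = 1"
    using normal_distributed_variance[OF normal] assms expectation_functional[OF f] by (simp add: cov_self)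
  then have "\<sigma> = 1"
    using normal by (simp add: power2_eq_1_iff)
  with normal show ?thesis
    by (auto simp: distributed_def cong: distr_cong)
next
  case dirac
  note [measurable] = functional_measurable[OF f]
  have "cov f f = (\<integral>x. x\<^sup>2 \<partial>distr \<mu> borel f)"
    by (simp add: cov_self integral_distr)
  also have "\<dots> = 0" unfolding dirac by (subst integral_return) auto
  finally show ?thesis using assms by simp
qed

text \<open>The real and imaginary parts of the characteristic function, obtained by scaling f to
  unit variance. In real form they can be combined with nonnegative weights.\<close>

lemma expectation_cos_sin_functional:
  assumes f: "bounded_linear f"
  shows "expectation (\<lambda>x. cos (f x)) = exp (- cov f f / 2)" "expectation (\<lambda>x. sin (f x)) = 0"
proof -
  have "expectation (\<lambda>x. cos (f x)) = exp (- cov f f / 2) \<and> expectation (\<lambda>x. sin (f x)) = 0"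
  proof (cases "f = (\<lambda>x. 0)")
    case True
    then show ?thesis using prob_space by (simp add: cov_def)
  next
    case False
    then have pos: "0 < cov f f" using cov_self_pos f by blast
    define s where "s = sqrt (cov f f)"
    have s: "s > 0" "s\<^sup>2 = cov f f" using pos by (auto simp: s_def)
    define g where "g x = (1 / s) * f x" for x
    have g: "bounded_linear g"
      unfolding g_def by (rule bounded_linear_const_mult[OF f])
    note [measurable] = functional_measurable[OF g]
    have "cov g g = (1 / s) * ((1 / s) * cov f f)"
      unfolding g_def by (simp only: cov_scale_left cov_commute[of f "\<lambda>x. 1 / s * f x"])
    also have "\<dots> = 1" using s(1) unfolding s(2)[symmetric] by (simp add: power2_eq_square)
    finally have std: "distr \<mu> borel g = std_normal_distribution"
      by (rule cov_self_std_normal[OF g])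
    have "char (distr \<mu> borel g) s = (CLINT x|\<mu>. iexp (s * g x))"
      by (simp add: char_def integral_distr)
    also have "\<dots> = (CLINT x|\<mu>. iexp (f x))"
      using s by (simp add: g_def)
    finally have "(CLINT x|\<mu>. iexp (f x)) = complex_of_real (exp (- cov f f / 2))"
      unfolding std char_std_normal_distribution s by simp
    moreover have "integrable \<mu> (\<lambda>x. iexp (f x))"
      using functional_measurable[OF f] by (intro integrable_const_bound[where B = 1]) auto
    ultimately show ?thesis
      using integral_Re[of \<mu> "\<lambda>x. iexp (f x)"] integral_Im[of \<mu> "\<lambda>x. iexp (f x)"]
      by (simp add: Re_exp Im_exp)
  qed
  then show "expectation (\<lambda>x. cos (f x)) = exp (- cov f f / 2)" "expectation (\<lambda>x. sin (f x)) = 0"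
    by auto
qed

text \<open>If c > 0, the image under e of the probability measure with density w/c has the standard
  normal characteristic function, and uniqueness on the line identifies it. If c = 0, the weight
  vanishes almost everywhere. The weight is what carries the events already treated while a further
  functional is added.\<close>

lemma weighted_law_std_normal:
  assumes [measurable]: "w \<in> borel_measurable \<mu>" "e \<in> borel_measurable \<mu>" and A[measurable]: "A \<in> sets borel"
    and w: "\<And>x. 0 \<le> w x" "\<And>x. w x \<le> B"
    and cos: "\<And>t. (\<integral>x. w x * cos (t * e x) \<partial>\<mu>) = c * exp (- t\<^sup>2 / 2)"
    and sin: "\<And>t. (\<integral>x. w x * sin (t * e x) \<partial>\<mu>) = 0"
  shows "(\<integral>x. w x * indicator A (e x) \<partial>\<mu>) = c * measure std_normal_distribution A"
proof -
  have int_w: "integrable \<mu> w"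
    using w by (intro integrable_const_bound[where B = B]) auto
  have c: "(\<integral>x. w x \<partial>\<mu>) = c"
    using cos[of 0] by simp
  show ?thesis
  proof (cases "c = 0")
    case True
    have "AE x in \<mu>. w x = 0"
      using integral_nonneg_eq_0_iff_AE[OF int_w] w c True by simp
    then have "AE x in \<mu>. w x * indicator A (e x) = 0"
      by eventually_elim simp
    then have "(\<integral>x. w x * indicator A (e x) \<partial>\<mu>) = (\<integral>x. 0 \<partial>\<mu>)"
      by (intro integral_cong_AE) auto
    then show ?thesis using True by simp
  next
    case False
    have "0 \<le> (\<integral>x. w x \<partial>\<mu>)"
      by (simp add: w)
    with False c have c_pos: "c > 0" by simp
    define D where "D = density \<mu> (\<lambda>x. ennreal (w x / c))"
    define \<nu> where "\<nu> = distr D borel e"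
    have [measurable]: "e \<in> borel_measurable D"
      by (simp add: D_def)
    have LD: "(\<integral>x. h x \<partial>D) = (\<integral>x. (w x / c) *\<^sub>R h x \<partial>\<mu>)"
      if [measurable]: "h \<in> borel_measurable \<mu>" for h :: "'a \<Rightarrow> 'b::{banach, second_countable_topology}"
      unfolding D_def using c_pos w by (intro integral_density) auto
    have "emeasure D (space D) = (\<integral>\<^sup>+x. ennreal (w x / c) \<partial>\<mu>)"
      unfolding D_def by (subst emeasure_density) auto
    also have "\<dots> = ennreal (\<integral>x. w x / c \<partial>\<mu>)"
      using int_w w c_pos by (intro nn_integral_eq_integral) auto
    also have "\<dots> = 1" using c c_pos by simp
    finally interpret D: prob_space D by (rule prob_spaceI)
    interpret \<nu>: real_distribution \<nu>
      unfolding \<nu>_def by (rule D.real_distribution_distr) measurable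
    have "char \<nu> t = char std_normal_distribution t" for t
    proof -
      let ?h = "\<lambda>x. (w x / c) *\<^sub>R iexp (t * e x)"
      have "char \<nu> t = (\<integral>x. ?h x \<partial>\<mu>)"
        unfolding char_def \<nu>_def by (subst integral_distr) (auto simp: LD)
      moreover have "integrable \<mu> ?h"
      proof (rule integrable_const_bound[where B = "B / c"])
        show "AE x in \<mu>. norm (?h x) \<le> B / c"
          using w c_pos by (simp add: divide_right_mono)
      qed measurable
      ultimately have "Re (char \<nu> t) = (\<integral>x. Re (?h x) \<partial>\<mu>)" "Im (char \<nu> t) = (\<integral>x. Im (?h x) \<partial>\<mu>)"
        using integral_Re[of \<mu> ?h] integral_Im[of \<mu> ?h] by (simp_all only:)
      moreover have "(\<integral>x. Re (?h x) \<partial>\<mu>) = (\<integral>x. (w x * cos (t * e x)) / c \<partial>\<mu>)"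
        by (simp add: Re_exp)
      moreover have "(\<integral>x. Im (?h x) \<partial>\<mu>) = (\<integral>x. (w x * sin (t * e x)) / c \<partial>\<mu>)"
        by (simp add: Im_exp)
      ultimately have "Re (char \<nu> t) = exp (- t\<^sup>2 / 2)" "Im (char \<nu> t) = 0"
        using c_pos by (simp_all add: cos sin)
      then show ?thesis
        unfolding char_std_normal_distribution by (simp add: complex_eq_iff)
    qed
    then have "\<nu> = std_normal_distribution"
      by (intro Levy_uniqueness \<nu>.real_distribution_axioms real_dist_normal_dist) auto
    moreover have "measure \<nu> A = (\<integral>x. indicator A (e x) \<partial>D)"
    proof -
      have "measure \<nu> A = (\<integral>x. indicator A x \<partial>\<nu>)" by simp
      also have "\<dots> = (\<integral>x. indicator A (e x) \<partial>D)"
        unfolding \<nu>_def by (rule integral_distr) auto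
      finally show ?thesis .
    qed
    moreover have "\<dots> = (\<integral>x. w x * indicator A (e x) / c \<partial>\<mu>)"
      by (subst LD) auto
    ultimately show ?thesis using c_pos by (simp add: field_simps)
  qed
qed

definition orthonormal_on :: "'i set \<Rightarrow> ('i \<Rightarrow> 'a \<Rightarrow> real) \<Rightarrow> bool" where
  "orthonormal_on I e \<longleftrightarrow> (\<forall>i\<in>I. bounded_linear (e i)) \<and> (\<forall>i\<in>I. \<forall>j\<in>I. cov (e i) (e j) = (if i = j then 1 else 0))"

text \<open>The extra functional h strengthens the induction: to add the event for
  \<open>e j\<close>, the hypothesis is applied to combinations of \<open>e j\<close> and h, which
  gives the law of \<open>e j\<close> under weights built from the old cylinder and h.\<close>

lemma orthonormal_cylinder_cos_sin:
  assumes "finite I" "orthonormal_on I e" "\<And>i. i \<in> I \<Longrightarrow> A i \<in> sets borel"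
    and "bounded_linear h" "\<And>i. i \<in> I \<Longrightarrow> cov h (e i) = 0"
  shows "(\<integral>x. (\<Prod>i\<in>I. indicator (A i) (e i x)) * cos (h x) \<partial>\<mu>)
      = exp (- cov h h / 2) * (\<Prod>i\<in>I. measure std_normal_distribution (A i)) \<and>
    (\<integral>x. (\<Prod>i\<in>I. indicator (A i) (e i x)) * sin (h x) \<partial>\<mu>) = 0"
  using assms
proof (induction I arbitrary: h)
  case empty
  then show ?case using expectation_cos_sin_functional by simp
next
  case (insert j I)
  define C where "C x = (\<Prod>i\<in>I. indicator (A i) (e i x) :: real)" for x
  define P where "P = (\<Prod>i\<in>I. measure std_normal_distribution (A i))"
  have orth: "orthonormal_on I e" and ej: "bounded_linear (e j)" and qj: "cov (e j) (e j) = 1"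
    and orthj: "\<And>i. i \<in> I \<Longrightarrow> cov (e j) (e i) = 0"
    using insert.prems insert.hyps by (auto simp: orthonormal_on_def)
  have h: "bounded_linear h" and hj: "cov h (e j) = 0" and hI: "\<And>i. i \<in> I \<Longrightarrow> cov h (e i) = 0"
    using insert.prems by auto
  have e_meas: "\<And>i. i \<in> insert j I \<Longrightarrow> e i \<in> borel_measurable \<mu>"
    using insert.prems by (auto simp: orthonormal_on_def intro: functional_measurable)
  have [measurable]: "C \<in> borel_measurable \<mu>"
    unfolding C_def
  proof (rule borel_measurable_prod)
    fix i assume i: "i \<in> I"
    have [measurable]: "A i \<in> sets borel" "e i \<in> borel_measurable \<mu>"
      using i insert.prems e_meas by auto
    show "(\<lambda>x. indicator (A i) (e i x) :: real) \<in> borel_measurable \<mu>" by measurable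
  qed
  have [measurable]: "e j \<in> borel_measurable \<mu>" "h \<in> borel_measurable \<mu>" "A j \<in> sets borel"
    using e_meas insert.prems functional_measurable[OF h] by auto
  have C01: "0 \<le> C x" "C x \<le> 1" for x
    unfolding C_def by (auto intro!: prod_nonneg prod_le_1)
  have int: "integrable \<mu> (\<lambda>x. C x * k x)" if [measurable]: "k \<in> borel_measurable \<mu>" and "\<And>x. \<bar>k x\<bar> \<le> 1" for k
    using that C01 by (intro integrable_const_bound[where B = 1]) (auto simp: abs_mult intro!: AE_I2 mult_le_one)
  \<comment> \<open>Such a combination is again uncorrelated with the functionals indexed by I. The
    values s = 0, 1 and - 1 are the ones used below.\<close>
  have comb: "(\<integral>x. C x * cos (t * e j x + s * h x) \<partial>\<mu>) = exp (- (t\<^sup>2 + s\<^sup>2 * cov h h) / 2) * P"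
    "(\<integral>x. C x * sin (t * e j x + s * h x) \<partial>\<mu>) = 0" for t s
  proof -
    let ?k = "\<lambda>x. t * e j x + s * h x"
    have te: "bounded_linear (\<lambda>x. t * e j x)" and sh: "bounded_linear (\<lambda>x. s * h x)"
      using ej h by (auto intro: bounded_linear_const_mult)
    have k: "bounded_linear ?k"
      using te sh by (rule bounded_linear_add)
    have "cov ?k (e i) = 0" if "i \<in> I" for i
      using that orth orthj hI te sh by (subst cov_add_left) (auto simp: cov_scale_left orthonormal_on_def)
    moreover have "cov ?k ?k = t\<^sup>2 + s\<^sup>2 * cov h h"
    proof -
      have "cov (e j) ?k = t" "cov h ?k = s * cov h h"
        using ej h hj qj te sh
        by (simp_all add: cov_commute[of _ ?k] cov_add_left cov_scale_left cov_commute[of "e j" h])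
      then show ?thesis
        using te sh k by (subst cov_add_left) (simp_all add: cov_scale_left power2_eq_square)
    qed
    ultimately show "(\<integral>x. C x * cos (?k x) \<partial>\<mu>) = exp (- (t\<^sup>2 + s\<^sup>2 * cov h h) / 2) * P"
      "(\<integral>x. C x * sin (?k x) \<partial>\<mu>) = 0"
      using insert.IH[OF orth _ k] insert.prems by (auto simp: C_def P_def)
  qed
  have comb0: "(\<integral>x. C x * cos (t * e j x) \<partial>\<mu>) = exp (- t\<^sup>2 / 2) * P"
    "(\<integral>x. C x * sin (t * e j x) \<partial>\<mu>) = 0" for t
    using comb[of t 0] by simp_all
  have comb1: "(\<integral>x. C x * cos (t * e j x + h x) \<partial>\<mu>) = exp (- t\<^sup>2 / 2) * (exp (- cov h h / 2) * P)"
    "(\<integral>x. C x * cos (t * e j x - h x) \<partial>\<mu>) = exp (- t\<^sup>2 / 2) * (exp (- cov h h / 2) * P)"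
    "(\<integral>x. C x * sin (t * e j x + h x) \<partial>\<mu>) = 0"
    "(\<integral>x. C x * sin (t * e j x - h x) \<partial>\<mu>) = 0" for t
    using comb[of t 1] comb[of t "-1"]
    by (simp_all add: add_divide_distrib diff_divide_distrib flip: exp_add mult.assoc)
  let ?N = "measure std_normal_distribution (A j)"
  have 1: "(\<integral>x. C x * indicator (A j) (e j x) \<partial>\<mu>) = P * ?N"
  proof (rule weighted_law_std_normal[where B = 1])
    show "(\<integral>x. C x * cos (t * e j x) \<partial>\<mu>) = P * exp (- t\<^sup>2 / 2)" for t
      by (simp add: comb0 mult.commute)
  qed (use C01 comb0 in auto)
  \<comment> \<open>Since cos h changes sign, 1 + cos h serves as the weight; its products with cos
    and sin of t times \<open>e j\<close> split by the addition formulas into the integrals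
    \<open>comb0\<close> and \<open>comb1\<close>.\<close>
  have 2: "(\<integral>x. (C x * (1 + cos (h x))) * indicator (A j) (e j x) \<partial>\<mu>) = (P * (1 + exp (- cov h h / 2))) * ?N"
  proof (rule weighted_law_std_normal[where B = 2])
    fix t x
    have b: "0 \<le> 1 + cos (h x)" "1 + cos (h x) \<le> 2"
      using cos_ge_minus_one[of "h x"] cos_le_one[of "h x"] by linarith+
    show "0 \<le> C x * (1 + cos (h x))"
      using C01[of x] b by simp
    show "C x * (1 + cos (h x)) \<le> 2"
      using mult_mono[of "C x" 1 "1 + cos (h x)" 2] C01[of x] b by simp
    have "(\<integral>x. (C x * (1 + cos (h x))) * cos (t * e j x) \<partial>\<mu>)
       = (\<integral>x. C x * cos (t * e j x) + (C x * cos (t * e j x + h x) + C x * cos (t * e j x - h x)) / 2 \<partial>\<mu>)"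
      by (intro Bochner_Integration.integral_cong) (auto simp: cos_add cos_diff algebra_simps)
    also have "\<dots> = (P * (1 + exp (- cov h h / 2))) * exp (- t\<^sup>2 / 2)"
      by (simp add: int comb0 comb1) (simp add: algebra_simps)
    finally show "(\<integral>x. (C x * (1 + cos (h x))) * cos (t * e j x) \<partial>\<mu>)
       = (P * (1 + exp (- cov h h / 2))) * exp (- t\<^sup>2 / 2)" .
    have "(\<integral>x. (C x * (1 + cos (h x))) * sin (t * e j x) \<partial>\<mu>)
       = (\<integral>x. C x * sin (t * e j x) + (C x * sin (t * e j x + h x) + C x * sin (t * e j x - h x)) / 2 \<partial>\<mu>)"
      by (intro Bochner_Integration.integral_cong) (auto simp: sin_add sin_diff algebra_simps)
    also have "\<dots> = 0"
      by (simp add: int comb0 comb1)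
    finally show "(\<integral>x. (C x * (1 + cos (h x))) * sin (t * e j x) \<partial>\<mu>) = 0" .
  qed measurable
  have 3: "(\<integral>x. (C x * (1 + sin (h x))) * indicator (A j) (e j x) \<partial>\<mu>) = P * ?N"
  proof (rule weighted_law_std_normal[where B = 2])
    fix t x
    have b: "0 \<le> 1 + sin (h x)" "1 + sin (h x) \<le> 2"
      using sin_ge_minus_one[of "h x"] sin_le_one[of "h x"] by linarith+
    show "0 \<le> C x * (1 + sin (h x))"
      using C01[of x] b by simp
    show "C x * (1 + sin (h x)) \<le> 2"
      using mult_mono[of "C x" 1 "1 + sin (h x)" 2] C01[of x] b by simp
    have "(\<integral>x. (C x * (1 + sin (h x))) * cos (t * e j x) \<partial>\<mu>)
       = (\<integral>x. C x * cos (t * e j x) + (C x * sin (t * e j x + h x) - C x * sin (t * e j x - h x)) / 2 \<partial>\<mu>)"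
      by (intro Bochner_Integration.integral_cong) (auto simp: sin_add sin_diff algebra_simps)
    also have "\<dots> = P * exp (- t\<^sup>2 / 2)"
      by (simp add: int comb0 comb1)
    finally show "(\<integral>x. (C x * (1 + sin (h x))) * cos (t * e j x) \<partial>\<mu>) = P * exp (- t\<^sup>2 / 2)" .
    have "(\<integral>x. (C x * (1 + sin (h x))) * sin (t * e j x) \<partial>\<mu>)
       = (\<integral>x. C x * sin (t * e j x) + (C x * cos (t * e j x - h x) - C x * cos (t * e j x + h x)) / 2 \<partial>\<mu>)"
      by (intro Bochner_Integration.integral_cong) (auto simp: cos_add cos_diff algebra_simps)
    also have "\<dots> = 0"
      by (simp add: int comb0 comb1)
    finally show "(\<integral>x. (C x * (1 + sin (h x))) * sin (t * e j x) \<partial>\<mu>) = 0" .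
  qed measurable
  have prod: "(\<Prod>i\<in>insert j I. indicator (A i) (e i x)) = C x * indicator (A j) (e j x)" for x
    using insert.hyps by (simp add: C_def mult.commute)
  have int': "integrable \<mu> (\<lambda>x. C x * indicator (A j) (e j x) * k x)"
    if [measurable]: "k \<in> borel_measurable \<mu>" and k: "\<And>x. \<bar>k x\<bar> \<le> 1" for k
  proof -
    have "integrable \<mu> (\<lambda>x. C x * (indicator (A j) (e j x) * k x))"
      by (rule int) (auto simp: indicator_def k)
    then show ?thesis by (simp add: mult.assoc)
  qed
  \<comment> \<open>Subtracting the plain cylinder mass removes the added 1 from the weight.\<close>
  have "(\<integral>x. (C x * (1 + cos (h x))) * indicator (A j) (e j x) \<partial>\<mu>)
     = (\<integral>x. C x * indicator (A j) (e j x) * 1 + C x * indicator (A j) (e j x) * cos (h x) \<partial>\<mu>)"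
    by (intro Bochner_Integration.integral_cong) (auto simp: algebra_simps)
  also have "\<dots> = P * ?N + (\<integral>x. C x * indicator (A j) (e j x) * cos (h x) \<partial>\<mu>)"
    by (subst Bochner_Integration.integral_add[OF int' int']) (auto simp: 1)
  finally have cos: "(\<integral>x. C x * indicator (A j) (e j x) * cos (h x) \<partial>\<mu>) = exp (- cov h h / 2) * (P * ?N)"
    unfolding 2 by (simp add: algebra_simps)
  have "(\<integral>x. (C x * (1 + sin (h x))) * indicator (A j) (e j x) \<partial>\<mu>)
     = (\<integral>x. C x * indicator (A j) (e j x) * 1 + C x * indicator (A j) (e j x) * sin (h x) \<partial>\<mu>)"
    by (intro Bochner_Integration.integral_cong) (auto simp: algebra_simps)
  also have "\<dots> = P * ?N + (\<integral>x. C x * indicator (A j) (e j x) * sin (h x) \<partial>\<mu>)"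
    by (subst Bochner_Integration.integral_add[OF int' int']) (auto simp: 1)
  finally have sin: "(\<integral>x. C x * indicator (A j) (e j x) * sin (h x) \<partial>\<mu>) = 0"
    unfolding 3 by simp
  show ?case
    using insert.hyps by (simp add: prod cos sin) (simp add: P_def mult.commute)
qed

text \<open>Product sets determine the measure, and on them the cylinder formula with h = 0
  factorizes.\<close>

lemma orthonormal_joint_law:
  assumes "finite I" and e: "orthonormal_on I e"
  shows "distr \<mu> (std_normal_product I) (\<lambda>x. \<lambda>i\<in>I. e i x) = std_normal_product I"
proof (rule std_normal_product.PiM_eqI[OF \<open>finite I\<close>])
  have e_meas: "\<And>i. i \<in> I \<Longrightarrow> e i \<in> borel_measurable \<mu>"
    using e by (auto simp: orthonormal_on_def intro: functional_measurable)
  have T[measurable]: "(\<lambda>x. \<lambda>i\<in>I. e i x) \<in> \<mu> \<rightarrow>\<^sub>M std_normal_product I"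
    by (rule measurable_restrict_std_normal_product) (rule e_meas)
  fix A :: "'b \<Rightarrow> real set" assume A: "\<And>i. i \<in> I \<Longrightarrow> A i \<in> sets std_normal_distribution"
  have "emeasure (distr \<mu> (std_normal_product I) (\<lambda>x. \<lambda>i\<in>I. e i x)) (Pi\<^sub>E I A)
      = emeasure \<mu> ((\<lambda>x. \<lambda>i\<in>I. e i x) -` Pi\<^sub>E I A \<inter> space \<mu>)"
    using A \<open>finite I\<close> by (intro emeasure_distr T sets_PiM_I_finite) auto
  also have "(\<lambda>x. \<lambda>i\<in>I. e i x) -` Pi\<^sub>E I A \<inter> space \<mu> = {x. \<forall>i\<in>I. e i x \<in> A i}"
    by (auto simp: PiE_iff)
  also have "emeasure \<mu> \<dots> = ennreal (measure \<mu> {x. \<forall>i\<in>I. e i x \<in> A i})"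
    by (simp add: emeasure_eq_measure)
  also have "measure \<mu> {x. \<forall>i\<in>I. e i x \<in> A i} = (\<integral>x. indicator {x. \<forall>i\<in>I. e i x \<in> A i} x \<partial>\<mu>)"
    by simp
  also have "\<dots> = (\<integral>x. (\<Prod>i\<in>I. indicator (A i) (e i x)) * cos 0 \<partial>\<mu>)"
  proof (rule Bochner_Integration.integral_cong)
    fix x
    show "indicator {x. \<forall>i\<in>I. e i x \<in> A i} x = (\<Prod>i\<in>I. indicator (A i) (e i x)) * cos (0::real)"
      using \<open>finite I\<close> by (auto simp: indicator_def prod_zero_iff)
  qed simp
  also have "\<dots> = (\<Prod>i\<in>I. measure std_normal_distribution (A i))"
    using orthonormal_cylinder_cos_sin[OF assms, of A "\<lambda>x. 0"] A by (simp add: cov_def bounded_linear_zero)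
  also have "ennreal \<dots> = (\<Prod>i\<in>I. emeasure std_normal_distribution (A i))"
    by (simp add: std_normal.emeasure_eq_measure prod_ennreal)
  finally show "emeasure (distr \<mu> (std_normal_product I) (\<lambda>x. \<lambda>i\<in>I. e i x)) (Pi\<^sub>E I A)
      = (\<Prod>i\<in>I. emeasure std_normal_distribution (A i))" .
qed simp

end

section \<open>Finite intersections of strips\<close>

context centred_gaussian begin

lemma orthonormal_sum:
  assumes "finite I" and e: "orthonormal_on I e"
  shows "bounded_linear (\<lambda>x. \<Sum>i\<in>I. b i * e i x)"
    and "j \<in> I \<Longrightarrow> cov (\<lambda>x. \<Sum>i\<in>I. b i * e i x) (e j) = b j"
    and "cov (\<lambda>x. \<Sum>i\<in>I. b i * e i x) (\<lambda>x. \<Sum>i\<in>I. b i * e i x) = (\<Sum>i\<in>I. (b i)\<^sup>2)"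
proof -
  let ?f = "\<lambda>x. \<Sum>i\<in>I. b i * e i x"
  have be: "bounded_linear (\<lambda>x. b i * e i x)" if "i \<in> I" for i
    using e that by (auto simp: orthonormal_on_def intro: bounded_linear_const_mult)
  show f: "bounded_linear ?f"
    by (rule bounded_linear_sum) (rule be)
  show c: "cov ?f (e j) = b j" if "j \<in> I" for j
  proof -
    have "cov ?f (e j) = (\<Sum>i\<in>I. cov (\<lambda>x. b i * e i x) (e j))"
      using e that by (intro cov_sum_left be) (auto simp: orthonormal_on_def)
    also have "\<dots> = (\<Sum>i\<in>I. if i = j then b i else 0)"
      using e that by (intro sum.cong) (auto simp: orthonormal_on_def cov_scale_left)
    finally show ?thesis using that \<open>finite I\<close> by simp
  qed
  have "cov ?f ?f = (\<Sum>i\<in>I. cov (\<lambda>x. b i * e i x) ?f)"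
    using f by (intro cov_sum_left be)
  also have "\<dots> = (\<Sum>i\<in>I. (b i)\<^sup>2)"
  proof (rule sum.cong)
    fix i assume "i \<in> I"
    then show "cov (\<lambda>x. b i * e i x) ?f = (b i)\<^sup>2"
      using c[of i] by (simp add: cov_scale_left cov_commute[of "e i"] power2_eq_square)
  qed simp
  finally show "cov ?f ?f = (\<Sum>i\<in>I. (b i)\<^sup>2)" .
qed

text \<open>The residual r of a new functional either vanishes and adds nothing, so that k may be
  smaller than n, or has positive variance by nondegeneracy and can be normalized.\<close>

lemma Gram_Schmidt_functionals:
  fixes f :: "nat \<Rightarrow> 'a \<Rightarrow> real"
  assumes "\<And>l. l < n \<Longrightarrow> bounded_linear (f l)"
  shows "\<exists>k e a. orthonormal_on {..<k::nat} e \<and> (\<forall>l<n. f l = (\<lambda>x. \<Sum>i<k. a l i * e i x))"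
  using assms
proof (induction n)
  case 0
  show ?case by (rule exI[of _ 0]) (simp add: orthonormal_on_def)
next
  case (Suc n)
  then obtain k e a where e: "orthonormal_on {..<k::nat} e"
    and a: "\<And>l. l < n \<Longrightarrow> f l = (\<lambda>x. \<Sum>i<k. a l i * e i x)"
    by (auto simp: less_Suc_eq)
  define b where "b i = cov (f n) (e i)" for i
  define p where "p x = (\<Sum>i<k. b i * e i x)" for x
  define r where "r x = f n x - p x" for x
  have p: "bounded_linear p" and p_e: "\<And>j. j < k \<Longrightarrow> cov p (e j) = b j"
    using orthonormal_sum[OF _ e, where b = b] by (simp_all add: p_def[abs_def])
  have fn: "bounded_linear (f n)" using Suc.prems by simp
  have r: "bounded_linear r"
    unfolding r_def[abs_def] using fn p by (rule bounded_linear_sub)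
  have r_e: "cov r (e j) = 0" if "j < k" for j
    using that e fn p p_e by (simp add: r_def[abs_def] cov_diff_left orthonormal_on_def b_def)
  show ?case
  proof (cases "r = (\<lambda>x. 0)")
    case True
    have "f n x = p x" for x
      using fun_cong[OF True, of x] by (simp add: r_def)
    then have "f l = (\<lambda>x. \<Sum>i<k. (a(n := b)) l i * e i x)" if "l < Suc n" for l
      using that a by (auto simp: less_Suc_eq p_def[abs_def])
    with e show ?thesis by blast
  next
    case False
    define s where "s = sqrt (cov r r)"
    have s: "s > 0" "cov r r = s\<^sup>2"
      using cov_self_pos[OF r False] by (auto simp: s_def)
    define e' where "e' = e(k := (\<lambda>x. (1 / s) * r x))"
    have e'_k: "cov (e' k) (e' k) = 1"
    proof -
      have "cov (e' k) (e' k) = (1 / s) * ((1 / s) * cov r r)"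
        by (simp only: e'_def fun_upd_same cov_scale_left cov_commute[of r "\<lambda>x. (1 / s) * r x"])
      then show ?thesis using s by (simp add: power2_eq_square)
    qed
    have e'_kj: "cov (e' k) (e' j) = 0" if "j < k" for j
      unfolding e'_def using that r_e[OF that] cov_scale_left[of "1 / s" r "e j"] by simp
    have "orthonormal_on {..<Suc k} e'"
      unfolding orthonormal_on_def
    proof (intro conjI ballI)
      fix i assume "i \<in> {..<Suc k}"
      then show "bounded_linear (e' i)"
        using e bounded_linear_const_mult[OF r, of "1 / s"]
        by (auto simp: e'_def orthonormal_on_def less_Suc_eq)
      fix j assume "j \<in> {..<Suc k}"
      then consider "i = k" "j = k" | "i = k" "j < k" | "i < k" "j = k" | "i < k" "j < k"
        using \<open>i \<in> {..<Suc k}\<close> by fastforce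
      then show "cov (e' i) (e' j) = (if i = j then 1 else 0)"
      proof cases
        case 3
        then show ?thesis using e'_kj cov_commute[of "e' i" "e' k"] by simp
      next
        case 4
        then show ?thesis using e by (simp add: e'_def orthonormal_on_def)
      qed (use e'_k e'_kj in auto)
    qed
    \<comment> \<open>The new row n consists of the projection coefficients followed by the standard
      deviation s of the residual; old rows get coefficient 0 at the new functional.\<close>
    moreover define a' where "a' l i = (if l = n then if i = k then s else b i else if i = k then 0 else a l i)" for l i
    have "f l = (\<lambda>x. \<Sum>i<Suc k. a' l i * e' i x)"
      if "l < Suc n" for l
    proof (cases "l = n")
      case True
      have "f n x = (\<Sum>i<k. b i * e i x) + r x" for x
        by (simp add: r_def p_def)
      then show ?thesis using True s by (simp add: e'_def a'_def fun_eq_iff)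
    next
      case False
      then show ?thesis using that a by (simp add: e'_def a'_def fun_eq_iff)
    qed
    ultimately show ?thesis
      by blast
  qed
qed

text \<open>These are the properties of C that the tilt and translation estimates require. The last
  one evaluates membership for restricted functions, the form in which coordinate vectors and their
  translates occur.\<close>

lemma strips_std_normal_product:
  fixes a :: "nat \<Rightarrow> 'i \<Rightarrow> real" and n :: nat and \<delta> :: real
  assumes "finite I"
  defines "C \<equiv> {y \<in> space (std_normal_product I). \<forall>l<n. \<bar>\<Sum>i\<in>I. a l i * y i\<bar> \<le> \<delta>}"
  shows "C \<in> sets (std_normal_product I)"
    and "x \<in> extensional I \<Longrightarrow> (\<lambda>i\<in>I. - x i) \<in> C \<longleftrightarrow> x \<in> C"
    and "x \<in> C \<Longrightarrow> y \<in> C \<Longrightarrow> (\<lambda>i\<in>I. (x i + y i) / 2) \<in> C"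
    and "(\<lambda>i\<in>I. z i) \<in> C \<longleftrightarrow> (\<forall>l<n. \<bar>\<Sum>i\<in>I. a l i * z i\<bar> \<le> \<delta>)"
proof -
  note [measurable (raw)] = measurable_component_std_normal_product
  show "C \<in> sets (std_normal_product I)"
    unfolding C_def by measurable
  show mem: "(\<lambda>i\<in>I. z i) \<in> C \<longleftrightarrow> (\<forall>l<n. \<bar>\<Sum>i\<in>I. a l i * z i\<bar> \<le> \<delta>)" for z
    by (auto simp: C_def in_space_std_normal_product)
  show "(\<lambda>i\<in>I. - x i) \<in> C \<longleftrightarrow> x \<in> C" if "x \<in> extensional I" for x
    using that unfolding mem by (simp add: C_def in_space_std_normal_product sum_negf)
  show "(\<lambda>i\<in>I. (x i + y i) / 2) \<in> C" if "x \<in> C" "y \<in> C" for x y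
    unfolding mem
  proof (intro allI impI)
    fix l assume "l < n"
    with that have "\<bar>\<Sum>i\<in>I. a l i * x i\<bar> \<le> \<delta>" "\<bar>\<Sum>i\<in>I. a l i * y i\<bar> \<le> \<delta>"
      by (auto simp: C_def)
    moreover have "(\<Sum>i\<in>I. a l i * ((x i + y i) / 2)) = ((\<Sum>i\<in>I. a l i * x i) + (\<Sum>i\<in>I. a l i * y i)) / 2"
      by (simp add: sum_divide_distrib distrib_left add_divide_distrib flip: sum.distrib)
    moreover have "\<bar>(X + Y) / 2\<bar> \<le> \<delta>" if "\<bar>X\<bar> \<le> \<delta>" "\<bar>Y\<bar> \<le> \<delta>" for X Y
      using that by (simp add: abs_le_iff)
    ultimately show "\<bar>\<Sum>i\<in>I. a l i * ((x i + y i) / 2)\<bar> \<le> \<delta>"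
      by (simp only:)
  qed
qed

lemma strips_tilt_le:
  fixes f :: "nat \<Rightarrow> 'a \<Rightarrow> real"
  assumes f: "\<And>l. l < n \<Longrightarrow> bounded_linear (f l)" and g: "bounded_linear g"
  shows "(\<integral>\<^sup>+u. indicator {u. \<forall>l<n. \<bar>f l u - f l x\<bar> \<le> \<delta>} u * ennreal (exp (g u)) \<partial>\<mu>)
    \<le> ennreal (exp (cov g g / 2)) * emeasure \<mu> {u. \<forall>l<n. \<bar>f l u\<bar> \<le> \<delta>}"
proof -
  \<comment> \<open>The tilt g joins the strip functionals as number n, so that strips and tilt are
    expressed in the same orthonormal coordinates.\<close>
  define f' where "f' l = (if l < n then f l else g)" for l
  have "\<And>l. l < Suc n \<Longrightarrow> bounded_linear (f' l)"
    using f g by (auto simp: f'_def)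
  from Gram_Schmidt_functionals[of "Suc n" f', OF this]
  obtain k :: nat and e a where e: "orthonormal_on {..<k} e" and a: "\<forall>l<Suc n. f' l = (\<lambda>x. \<Sum>i<k. a l i * e i x)"
    by blast
  have fa: "f l u = (\<Sum>i<k. a l i * e i u)" if "l < n" for l u
    using a[rule_format, of l] that by (simp add: f'_def)
  have ga: "g = (\<lambda>u. \<Sum>i<k. a n i * e i u)"
    using a[rule_format, of n] by (simp add: f'_def)
  have cov_g: "cov g g = (\<Sum>i<k. (a n i)\<^sup>2)"
    unfolding ga using orthonormal_sum(3)[OF _ e, where b = "a n"] by simp
  define T where "T u = (\<lambda>i\<in>{..<k}. e i u)" for u
  have law: "distr \<mu> (std_normal_product {..<k}) T = std_normal_product {..<k}"
    unfolding T_def using e by (intro orthonormal_joint_law) auto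
  have T[measurable]: "T \<in> \<mu> \<rightarrow>\<^sub>M std_normal_product {..<k}"
    unfolding T_def using e by (intro measurable_restrict_std_normal_product functional_measurable) (auto simp: orthonormal_on_def)
  define C where "C = {y \<in> space (std_normal_product {..<k}). \<forall>l<n. \<bar>\<Sum>i<k. a l i * y i\<bar> \<le> \<delta>}"
  note C = strips_std_normal_product[where I = "{..<k}" and n = n and a = a and \<delta> = \<delta>, folded C_def, OF finite_lessThan]
  note [measurable] = C(1)
  note [measurable (raw)] = measurable_component_std_normal_product
  have "(\<integral>\<^sup>+u. indicator {u. \<forall>l<n. \<bar>f l u - f l x\<bar> \<le> \<delta>} u * ennreal (exp (g u)) \<partial>\<mu>)
      = (\<integral>\<^sup>+u. indicator C (\<lambda>i\<in>{..<k}. T u i - e i x) * ennreal (exp (\<Sum>i<k. a n i * T u i)) \<partial>\<mu>)"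
  proof (rule nn_integral_cong)
    fix u
    have "(\<lambda>i\<in>{..<k}. T u i - e i x) \<in> C \<longleftrightarrow> (\<forall>l<n. \<bar>f l u - f l x\<bar> \<le> \<delta>)"
      unfolding C(4) by (simp add: T_def fa right_diff_distrib sum_subtractf)
    moreover have "g u = (\<Sum>i<k. a n i * T u i)"
      by (simp add: T_def ga)
    ultimately show "indicator {u. \<forall>l<n. \<bar>f l u - f l x\<bar> \<le> \<delta>} u * ennreal (exp (g u))
        = indicator C (\<lambda>i\<in>{..<k}. T u i - e i x) * ennreal (exp (\<Sum>i<k. a n i * T u i))"
      by (simp only: indicator_def mem_Collect_eq)
  qed
  also have "\<dots> = (\<integral>\<^sup>+y. indicator C (\<lambda>i\<in>{..<k}. y i - e i x) * ennreal (exp (\<Sum>i<k. a n i * y i))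
      \<partial>distr \<mu> (std_normal_product {..<k}) T)"
    by (subst nn_integral_distr) measurable
  also have "\<dots> \<le> ennreal (exp ((\<Sum>i<k. (a n i)\<^sup>2) / 2)) * emeasure (std_normal_product {..<k}) C"
    unfolding law by (rule nn_integral_std_normal_product_tilt_le[OF finite_lessThan C(1)])
      (use C(2,3) in \<open>auto simp: C_def in_space_std_normal_product\<close>)
  also have "emeasure (std_normal_product {..<k}) C = emeasure \<mu> {u. \<forall>l<n. \<bar>f l u\<bar> \<le> \<delta>}"
  proof -
    have "emeasure (distr \<mu> (std_normal_product {..<k}) T) C = emeasure \<mu> (T -` C \<inter> space \<mu>)"
      by (intro emeasure_distr T C(1))
    also have "T -` C \<inter> space \<mu> = {u. \<forall>l<n. \<bar>f l u\<bar> \<le> \<delta>}"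
      by (auto simp: T_def C(4) fa)
    finally show ?thesis unfolding law .
  qed
  finally show ?thesis unfolding cov_g .
qed

text \<open>Scaled to unit variance, f becomes a competitor in the supremum that defines the norm;
  the zero functional, which cannot be scaled, is immediate.\<close>

lemma functional_le_cm_norm:
  assumes h: "h \<in> cm_space \<mu>" and f: "bounded_linear f"
  shows "f h \<le> cm_norm \<mu> h * sqrt (cov f f)"
proof (cases "f = (\<lambda>x. 0)")
  case True
  then show ?thesis by (simp add: cov_def)
next
  case False
  define s where "s = sqrt (cov f f)"
  have s: "s > 0" "cov f f = s\<^sup>2"
    using cov_self_pos[OF f False] by (auto simp: s_def)
  have "cov (\<lambda>x. (1 / s) * f x) (\<lambda>x. (1 / s) * f x) = (1 / s) * ((1 / s) * cov f f)"
    by (simp only: cov_scale_left cov_commute[of f "\<lambda>x. (1 / s) * f x"])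
  also have "\<dots> = 1" using s by (simp add: power2_eq_square)
  finally have "(1 / s) * f h \<in> cm_values \<mu> h"
    using bounded_linear_const_mult[OF f, of "1 / s"] unfolding cm_values_def cov_self by force
  then have "(1 / s) * f h \<le> cm_norm \<mu> h"
    unfolding cm_norm_def using h by (intro cSup_upper) (simp_all add: cm_space_def)
  then show ?thesis
    using s by (simp add: s_def[symmetric] field_simps)
qed

lemma strips_shift_ge:
  fixes f :: "nat \<Rightarrow> 'a \<Rightarrow> real"
  assumes f: "\<And>l. l < n \<Longrightarrow> bounded_linear (f l)" and h: "h \<in> cm_space \<mu>"
  shows "ennreal (exp (- (cm_norm \<mu> h)\<^sup>2 / 2)) * emeasure \<mu> {u. \<forall>l<n. \<bar>f l u\<bar> \<le> \<delta>}
    \<le> emeasure \<mu> {u. \<forall>l<n. \<bar>f l u - f l h\<bar> \<le> \<delta>}"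
proof -
  from Gram_Schmidt_functionals[of n f, OF f]
  obtain k :: nat and e a where e: "orthonormal_on {..<k} e" and a: "\<forall>l<n. f l = (\<lambda>x. \<Sum>i<k. a l i * e i x)"
    by blast
  have fa: "f l u = (\<Sum>i<k. a l i * e i u)" if "l < n" for l u
    using a[rule_format, of l] that by simp
  define T where "T u = (\<lambda>i\<in>{..<k}. e i u)" for u
  have law: "distr \<mu> (std_normal_product {..<k}) T = std_normal_product {..<k}"
    unfolding T_def using e by (intro orthonormal_joint_law) auto
  have T[measurable]: "T \<in> \<mu> \<rightarrow>\<^sub>M std_normal_product {..<k}"
    unfolding T_def using e by (intro measurable_restrict_std_normal_product functional_measurable) (auto simp: orthonormal_on_def)
  define C where "C = {y \<in> space (std_normal_product {..<k}). \<forall>l<n. \<bar>\<Sum>i<k. a l i * y i\<bar> \<le> \<delta>}"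
  define D where "D = {y \<in> space (std_normal_product {..<k}). (\<lambda>i\<in>{..<k}. y i - e i h) \<in> C}"
  note C = strips_std_normal_product[where I = "{..<k}" and n = n and a = a and \<delta> = \<delta>, folded C_def, OF finite_lessThan]
  note [measurable] = C(1)
  note [measurable (raw)] = measurable_component_std_normal_product
  have D[measurable]: "D \<in> sets (std_normal_product {..<k})"
    unfolding D_def by measurable
  let ?s = "\<Sum>i<k. (e i h)\<^sup>2"
  \<comment> \<open>The norm is tested with the functional whose coefficients are the coordinates
    \<open>e i h\<close> themselves: its value at h and its variance are both \<open>?s\<close>, so
    \<open>?s\<close> is at most |h| times its own square root.\<close>
  have "?s \<le> (cm_norm \<mu> h)\<^sup>2"
  proof -
    have "?s \<le> cm_norm \<mu> h * sqrt ?s"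
      using functional_le_cm_norm[OF h orthonormal_sum(1)[OF _ e, where b = "\<lambda>i. e i h"]]
        orthonormal_sum(3)[OF _ e, where b = "\<lambda>i. e i h"] by (simp add: power2_eq_square)
    moreover have s: "0 \<le> ?s" by (simp add: sum_nonneg)
    moreover have sq: "sqrt ?s * sqrt ?s = ?s" by (simp add: sum_nonneg)
    ultimately have "sqrt ?s \<le> cm_norm \<mu> h" if "?s \<noteq> 0"
      using that mult_right_le_imp_le[of "sqrt ?s" "sqrt ?s" "cm_norm \<mu> h"] by simp
    then show ?thesis
      using power_mono[of "sqrt ?s" "cm_norm \<mu> h" 2] s by (cases "?s = 0") auto
  qed
  then have "ennreal (exp (- (cm_norm \<mu> h)\<^sup>2 / 2)) * emeasure (std_normal_product {..<k}) C
      \<le> ennreal (exp (- ?s / 2)) * emeasure (std_normal_product {..<k}) C"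
    by (intro mult_right_mono ennreal_leI) auto
  also have "\<dots> \<le> emeasure (std_normal_product {..<k}) D"
    unfolding D_def by (rule emeasure_std_normal_product_shift_ge[OF finite_lessThan C(1) C(2)])
  also have "\<dots> = emeasure \<mu> {u. \<forall>l<n. \<bar>f l u - f l h\<bar> \<le> \<delta>}"
  proof -
    have "emeasure (distr \<mu> (std_normal_product {..<k}) T) D = emeasure \<mu> (T -` D \<inter> space \<mu>)"
      by (intro emeasure_distr T D)
    also have "T u \<in> D \<longleftrightarrow> (\<forall>l<n. \<bar>f l u - f l h\<bar> \<le> \<delta>)" for u
      unfolding D_def mem_Collect_eq C(4)
      by (simp add: in_space_std_normal_product T_def fa right_diff_distrib sum_subtractf)
    then have "T -` D \<inter> space \<mu> = {u. \<forall>l<n. \<bar>f l u - f l h\<bar> \<le> \<delta>}"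
      by auto
    finally show ?thesis unfolding law .
  qed
  also have "emeasure (std_normal_product {..<k}) C = emeasure \<mu> {u. \<forall>l<n. \<bar>f l u\<bar> \<le> \<delta>}"
  proof -
    have "emeasure (distr \<mu> (std_normal_product {..<k}) T) C = emeasure \<mu> (T -` C \<inter> space \<mu>)"
      by (intro emeasure_distr T C(1))
    also have "T -` C \<inter> space \<mu> = {u. \<forall>l<n. \<bar>f l u\<bar> \<le> \<delta>}"
      by (auto simp: T_def C(4) fa)
    finally show ?thesis unfolding law .
  qed
  finally show ?thesis .
qed

end

section \<open>Norming functionals\<close>

text \<open>Homogeneity as an inequality, with c = 0 included, is easier to verify for infima;
  equality follows in \<open>sublinear_scale\<close>.\<close>

definition sublinear :: "('a::real_vector \<Rightarrow> real) \<Rightarrow> bool" where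
  "sublinear q \<longleftrightarrow> (\<forall>x y. q (x + y) \<le> q x + q y) \<and> (\<forall>c x. 0 \<le> c \<longrightarrow> q (c *\<^sub>R x) \<le> c * q x)"

lemma sublinear_add: "sublinear q \<Longrightarrow> q (x + y) \<le> q x + q y"
  by (simp add: sublinear_def)

lemma sublinear_scale_le: "sublinear q \<Longrightarrow> 0 \<le> c \<Longrightarrow> q (c *\<^sub>R x) \<le> c * q x"
  by (simp add: sublinear_def)

lemma sublinear_zero: "sublinear q \<Longrightarrow> q 0 = 0"
  using sublinear_add[of q 0 0] sublinear_scale_le[of q 0 0] by simp

lemma sublinear_uminus: "sublinear q \<Longrightarrow> - q (- x) \<le> q x"
  using sublinear_add[of q x "- x"] by (simp add: sublinear_zero)

lemma sublinear_scale:
  assumes q: "sublinear q" and "0 \<le> c"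
  shows "q (c *\<^sub>R x) = c * q x"
proof (cases "c = 0")
  case False
  then have "q ((1 / c) *\<^sub>R (c *\<^sub>R x)) \<le> (1 / c) * q (c *\<^sub>R x)"
    using assms by (intro sublinear_scale_le) auto
  then have "c * q x \<le> q (c *\<^sub>R x)"
    using False \<open>0 \<le> c\<close> by (simp add: field_simps)
  then show ?thesis
    using sublinear_scale_le[OF assms] by (simp add: antisym)
qed (simp add: sublinear_zero[OF q])

text \<open>The construction lowers q by moving along the ray of z and subtracting the corresponding
  multiple of q z. At x = - z the last bound reads q' (- z) \<le> - q z, so a linear functional
  below q' is at least q z at z.\<close>

lemma sublinear_reduction:
  assumes q: "sublinear q"
  obtains q' where "sublinear q'" "\<And>x. q' x \<le> q x" "\<And>x. q' x \<le> q (x + z) - q z"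
proof
  define q' where "q' x = (INF t\<in>{0..}. q (x + t *\<^sub>R z) - t * q z)" for x
  have bdd: "bdd_below ((\<lambda>t. q (x + t *\<^sub>R z) - t * q z) ` {0..})" for x
  proof (rule bdd_belowI2)
    fix t :: real assume "t \<in> {0..}"
    then have "t * q z \<le> q (x + t *\<^sub>R z) + q (- x)"
      using sublinear_add[OF q, of "x + t *\<^sub>R z" "- x"] by (simp add: sublinear_scale[OF q])
    then show "- q (- x) \<le> q (x + t *\<^sub>R z) - t * q z" by simp
  qed
  have le: "q' x \<le> q (x + t *\<^sub>R z) - t * q z" if "0 \<le> t" for x t
    unfolding q'_def using that by (intro cINF_lower[OF bdd]) auto
  show "q' x \<le> q x" for x
    using le[of 0 x] by simp
  show "q' x \<le> q (x + z) - q z" for x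
    using le[of 1 x] by simp
  show "sublinear q'"
    unfolding sublinear_def
  proof (intro conjI allI impI)
    fix x y
    have "q' (x + y) - (q (y + s *\<^sub>R z) - s * q z) \<le> q' x" if "0 \<le> s" for s
      unfolding q'_def[of x]
    proof (rule cINF_greatest)
      fix t :: real assume "t \<in> {0..}"
      then have "q' (x + y) \<le> q ((x + t *\<^sub>R z) + (y + s *\<^sub>R z)) - (t + s) * q z"
        using le[of "t + s" "x + y"] that by (simp add: algebra_simps)
      also have "\<dots> \<le> (q (x + t *\<^sub>R z) + q (y + s *\<^sub>R z)) - (t + s) * q z"
        by (intro diff_right_mono sublinear_add q)
      finally show "q' (x + y) - (q (y + s *\<^sub>R z) - s * q z) \<le> q (x + t *\<^sub>R z) - t * q z"
        by (simp add: algebra_simps)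
    qed simp
    then have "q' (x + y) - q' x \<le> q' y"
      unfolding q'_def[of y] by (intro cINF_greatest) (auto simp: algebra_simps)
    then show "q' (x + y) \<le> q' x + q' y" by simp
  next
    fix c :: real and x assume "0 \<le> c"
    show "q' (c *\<^sub>R x) \<le> c * q' x"
    proof (cases "c = 0")
      case True
      then show ?thesis using le[of 0 0] by (simp add: sublinear_zero[OF q])
    next
      case False
      then have c: "c > 0" using \<open>0 \<le> c\<close> by simp
      have "q' (c *\<^sub>R x) / c \<le> q' x"
        unfolding q'_def[of x]
      proof (rule cINF_greatest)
        fix t :: real assume "t \<in> {0..}"
        then have "q' (c *\<^sub>R x) \<le> q (c *\<^sub>R x + (c * t) *\<^sub>R z) - (c * t) * q z"
          using le[of "c * t" "c *\<^sub>R x"] c by simp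
        also have "q (c *\<^sub>R x + (c * t) *\<^sub>R z) = c * q (x + t *\<^sub>R z)"
          using sublinear_scale[OF q, of c "x + t *\<^sub>R z"] c by (simp add: scaleR_add_right)
        finally show "q' (c *\<^sub>R x) / c \<le> q (x + t *\<^sub>R z) - t * q z"
          unfolding pos_divide_le_eq[OF c] by (simp add: algebra_simps)
      qed simp
      then show ?thesis using c by (simp add: field_simps)
    qed
  qed
qed

text \<open>The pointwise infimum is finite because each member is at least - p (- x). Comparability
  enters in subadditivity, where two members are replaced by the smaller one.\<close>

lemma sublinear_chain_Inf:
  assumes "C \<noteq> {}" and C: "\<And>q. q \<in> C \<Longrightarrow> sublinear q" "\<And>q x. q \<in> C \<Longrightarrow> q x \<le> p x"
    and chain: "\<And>q r. q \<in> C \<Longrightarrow> r \<in> C \<Longrightarrow> q \<le> r \<or> r \<le> q"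
  obtains u where "sublinear u" "\<And>q. q \<in> C \<Longrightarrow> u \<le> q"
proof
  define u where "u x = (INF q\<in>C. q x)" for x
  have bdd: "bdd_below ((\<lambda>q. q x) ` C)" for x
  proof (rule bdd_belowI2)
    fix q assume "q \<in> C"
    then show "- p (- x) \<le> q x"
      using sublinear_uminus[of q x] C(2)[of q "- x"] C(1) by fastforce
  qed
  have le: "u x \<le> q x" if "q \<in> C" for q x
    unfolding u_def by (rule cINF_lower[OF bdd that])
  then show "u \<le> q" if "q \<in> C" for q
    using that by (simp add: le_fun_def)
  show "sublinear u"
    unfolding sublinear_def
  proof (intro conjI allI impI)
    fix x y
    have *: "u (x + y) \<le> q x + r y" if qr: "q \<in> C" "r \<in> C" for q r
    proof -
      obtain s where s: "s \<in> C" "s \<le> q" "s \<le> r"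
        using chain[OF qr] qr by blast
      have "u (x + y) \<le> s x + s y"
        using le[OF s(1), of "x + y"] sublinear_add[OF C(1)[OF s(1)], of x y] by linarith
      also have "\<dots> \<le> q x + r y"
        using s by (intro add_mono) (auto simp: le_fun_def)
      finally show ?thesis .
    qed
    have "u (x + y) - r y \<le> u x" if "r \<in> C" for r
      unfolding u_def[of x] using * that \<open>C \<noteq> {}\<close> by (intro cINF_greatest) (auto simp: algebra_simps)
    then have "u (x + y) - u x \<le> u y"
      unfolding u_def[of y] using \<open>C \<noteq> {}\<close> by (intro cINF_greatest) (auto simp: algebra_simps)
    then show "u (x + y) \<le> u x + u y" by simp
  next
    fix c :: real and x assume "0 \<le> c"
    obtain r where r: "r \<in> C" using \<open>C \<noteq> {}\<close> by auto
    show "u (c *\<^sub>R x) \<le> c * u x"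
    proof (cases "c = 0")
      case True
      then show ?thesis using le[OF r, of 0] sublinear_zero[OF C(1)[OF r]] by simp
    next
      case False
      then have c: "c > 0" using \<open>0 \<le> c\<close> by simp
      have "u (c *\<^sub>R x) / c \<le> u x"
        unfolding u_def[of x]
      proof (rule cINF_greatest[OF \<open>C \<noteq> {}\<close>])
        fix q assume "q \<in> C"
        then show "u (c *\<^sub>R x) / c \<le> q x"
          using le[of q "c *\<^sub>R x"] sublinear_scale[OF C(1), of q c x] c by (simp add: field_simps)
      qed
      then show ?thesis using c by (simp add: field_simps)
    qed
  qed
qed

text \<open>A minimal sublinear functional equals its own reductions, which forces additivity.\<close>

lemma linear_below_sublinear:
  fixes p :: "'a::real_vector \<Rightarrow> real"
  assumes p: "sublinear p"
  obtains f where "linear f" "\<And>x. f x \<le> p x"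
proof -
  define A where "A = {q. sublinear q \<and> (\<forall>x. q x \<le> p x)}"
  have "\<exists>m\<in>A. \<forall>q\<in>A. m \<ge> q \<longrightarrow> q = m"
  proof (rule predicate_Zorn)
    show "partial_order_on A (relation_of (\<ge>) A)"
      by (rule partial_order_on_relation_ofI) auto
    fix C assume C: "C \<in> Chains (relation_of (\<ge>) A)"
    then have CA: "C \<subseteq> A" and chain: "\<And>q r. q \<in> C \<Longrightarrow> r \<in> C \<Longrightarrow> q \<le> r \<or> r \<le> q"
      by (auto simp: Chains_def relation_of_def)
    show "\<exists>u\<in>A. \<forall>q\<in>C. q \<ge> u"
    proof (cases "C = {}")
      case True
      then show ?thesis using p by (auto simp: A_def)
    next
      case False
      obtain u where u: "sublinear u" "\<And>q. q \<in> C \<Longrightarrow> u \<le> q"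
        using sublinear_chain_Inf[of C p] False CA chain by (auto simp: A_def subset_iff)
      have "u x \<le> p x" for x
      proof -
        obtain q where "q \<in> C" using False by auto
        then have "u x \<le> q x" "q x \<le> p x"
          using u(2)[of q] CA by (auto simp: le_fun_def A_def)
        then show ?thesis by linarith
      qed
      with u show ?thesis by (auto simp: A_def)
    qed
  qed
  then obtain m where m: "sublinear m" "\<And>x. m x \<le> p x"
    and min: "\<And>q. sublinear q \<Longrightarrow> (\<And>x. q x \<le> p x) \<Longrightarrow> q \<le> m \<Longrightarrow> q = m"
    by (auto simp: A_def)
  have add: "m (x + z) = m x + m z" for x z
  proof -
    obtain q where q: "sublinear q" "\<And>x. q x \<le> m x" "\<And>x. q x \<le> m (x + z) - m z"
      using sublinear_reduction[OF m(1)] by blast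
    have "q = m"
      using q m by (intro min) (auto simp: le_fun_def intro: order_trans)
    then have "m x \<le> m (x + z) - m z" using q(3) by simp
    then show ?thesis using sublinear_add[OF m(1), of x z] by linarith
  qed
  have neg: "m (- x) = - m x" for x
    using add[of x "- x"] sublinear_zero[OF m(1)] by simp
  have "linear m"
  proof (rule linearI)
    show "m (c *\<^sub>R x) = c *\<^sub>R m x" for c x
      using sublinear_scale[OF m(1), of c x] sublinear_scale[OF m(1), of "- c" x] neg[of "c *\<^sub>R x"]
      by (cases "0 \<le> c") auto
  qed (rule add)
  then show thesis using m(2) that by blast
qed

text \<open>The norm is reduced at z before a linear functional is taken below it. The reduction
  bounds the functional at - z by - norm z, which forces the value norm z at z.\<close>

lemma norming_functional:
  fixes z :: "'a::real_normed_vector"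
  obtains f :: "'a \<Rightarrow> real" where "bounded_linear f" "\<And>x. \<bar>f x\<bar> \<le> norm x" "f z = norm z"
proof -
  have norm: "sublinear (norm :: 'a \<Rightarrow> real)"
    by (simp add: sublinear_def norm_triangle_ineq)
  obtain q where q: "sublinear q" "\<And>x. q x \<le> norm x" "\<And>x. q x \<le> norm (x + z) - norm z"
    using sublinear_reduction[OF norm, of z] by blast
  obtain f where f: "linear f" "\<And>x. f x \<le> q x"
    using linear_below_sublinear[OF q(1)] by blast
  have abs: "\<bar>f x\<bar> \<le> norm x" for x
    using f(2)[of x] f(2)[of "- x"] q(2)[of x] q(2)[of "- x"] by (simp add: linear_neg[OF f(1)] abs_le_iff)
  have "norm z \<le> f z"
    using f(2)[of "- z"] q(3)[of "- z"] by (simp add: linear_neg[OF f(1)])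
  with abs[of z] have "f z = norm z" by linarith
  moreover have "bounded_linear f"
    using f(1) abs by (intro bounded_linear_intro[where K = 1]) (auto simp: linear_add linear_scale)
  ultimately show thesis using abs that by blast
qed

text \<open>Norming functionals of a dense sequence suffice: the one belonging to a point within e/2
  of x attains at least norm x - e at x.\<close>

lemma norming_sequence:
  obtains g :: "nat \<Rightarrow> 'a::{real_normed_vector, second_countable_topology} \<Rightarrow> real"
  where "\<And>n. bounded_linear (g n)" "\<And>n x. \<bar>g n x\<bar> \<le> norm x"
    "\<And>x \<delta>. (\<And>n. \<bar>g n x\<bar> \<le> \<delta>) \<Longrightarrow> norm x \<le> \<delta>"
proof -
  obtain D :: "'a set" where D: "countable D" "\<And>X. open X \<Longrightarrow> X \<noteq> {} \<Longrightarrow> \<exists>d\<in>D. d \<in> X"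
    using countable_dense_exists by blast
  have "D \<noteq> {}" using D(2)[of UNIV] by auto
  define d where "d = from_nat_into D"
  have range_d: "range d = D"
    unfolding d_def by (rule range_from_nat_into[OF \<open>D \<noteq> {}\<close> D(1)])
  have "\<exists>f. bounded_linear f \<and> (\<forall>x. \<bar>f x\<bar> \<le> norm x) \<and> f (d n) = norm (d n)" for n
    using norming_functional[of "d n"] by blast
  then obtain g where g: "\<And>n. bounded_linear (g n)" "\<And>n x. \<bar>g n x\<bar> \<le> norm x" "\<And>n. g n (d n) = norm (d n)"
    by metis
  have "norm x \<le> \<delta>" if x: "\<And>n. \<bar>g n x\<bar> \<le> \<delta>" for x \<delta>
  proof (rule field_le_epsilon)
    fix e :: real assume "e > 0"
    then have "ball x (e / 2) \<noteq> {}" by simp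
    then obtain v where "v \<in> D" "v \<in> ball x (e / 2)"
      using D(2)[OF open_ball] by blast
    then obtain n where n: "dist x (d n) < e / 2"
      unfolding range_d[symmetric] by auto
    have "norm x \<le> norm (d n) + norm (x - d n)"
      using norm_triangle_ineq[of "d n" "x - d n"] by simp
    moreover have "norm (d n) = g n x - g n (x - d n)"
      using g(1)[of n] by (simp add: g(3) bounded_linear.linear linear_diff)
    ultimately show "norm x \<le> \<delta> + e"
      using x[of n] g(2)[of n "x - d n"] n by (simp add: dist_norm)
  qed
  with g show thesis using that by blast
qed

section \<open>Small balls under the Gaussian measure\<close>

context centred_gaussian begin

lemma cball_measurable [measurable]: "cball x \<delta> \<in> sets \<mu>"
  by simp

text \<open>Closed strips intersect to closed balls, whereas the results concern open ones; this
  limit passes between the two.\<close>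

lemma measure_cball_tendsto_ball:
  assumes "\<delta> > 0"
  shows "(\<lambda>n. measure \<mu> (cball x (\<delta> - \<delta> / Suc n))) \<longlonglongrightarrow> measure \<mu> (ball x \<delta>)"
proof -
  have "(\<lambda>n. measure \<mu> (cball x (\<delta> - \<delta> / Suc n))) \<longlonglongrightarrow> measure \<mu> (\<Union>n. cball x (\<delta> - \<delta> / Suc n))"
  proof (rule finite_Lim_measure_incseq)
    show "incseq (\<lambda>n. cball x (\<delta> - \<delta> / Suc n))"
      using assms by (intro incseq_SucI subset_cball) (simp add: field_simps)
  qed auto
  also have "(\<Union>n. cball x (\<delta> - \<delta> / Suc n)) = ball x \<delta>"
  proof (intro equalityI subsetI)
    fix u assume "u \<in> ball x \<delta>"
    then have "(\<delta> - dist x u) / \<delta> > 0" using assms by simp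
    then obtain n where "inverse (real (Suc n)) < (\<delta> - dist x u) / \<delta>"
      using reals_Archimedean by blast
    then have "u \<in> cball x (\<delta> - \<delta> / Suc n)"
      using assms by (simp add: field_simps)
    then show "u \<in> (\<Union>n. cball x (\<delta> - \<delta> / Suc n))" by blast
  next
    fix u assume "u \<in> (\<Union>n. cball x (\<delta> - \<delta> / Suc n))"
    then obtain n where "dist x u \<le> \<delta> - \<delta> / Suc n" by auto
    also have "\<dots> < \<delta>" using assms by simp
    finally show "u \<in> ball x \<delta>" by simp
  qed
  finally show ?thesis .
qed

text \<open>One sequence of functionals serves all centres and radii, so a ball and its translates
  are approximated by corresponding strips.\<close>

lemma cball_strips:
  obtains g :: "nat \<Rightarrow> 'a \<Rightarrow> real" where "\<And>n. bounded_linear (g n)"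
    "\<And>x \<delta> n. cball x \<delta> \<subseteq> {u. \<forall>l<n. \<bar>g l u - g l x\<bar> \<le> \<delta>}"
    "\<And>x \<delta>. (\<lambda>n. emeasure \<mu> {u. \<forall>l<n. \<bar>g l u - g l x\<bar> \<le> \<delta>}) \<longlonglongrightarrow> emeasure \<mu> (cball x \<delta>)"
proof -
  obtain g :: "nat \<Rightarrow> 'a \<Rightarrow> real" where g: "\<And>n. bounded_linear (g n)" "\<And>n x. \<bar>g n x\<bar> \<le> norm x"
    "\<And>x \<delta>. (\<And>n. \<bar>g n x\<bar> \<le> \<delta>) \<Longrightarrow> norm x \<le> \<delta>"
    using norming_sequence by blast
  have diff: "g l u - g l x = g l (u - x)" for l u x
    using g(1)[of l] by (simp add: bounded_linear.linear linear_diff)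
  have sub: "cball x \<delta> \<subseteq> {u. \<forall>l<n. \<bar>g l u - g l x\<bar> \<le> \<delta>}" for x \<delta> n
  proof
    fix u assume "u \<in> cball x \<delta>"
    then have "norm (u - x) \<le> \<delta>" by (simp add: dist_norm norm_minus_commute)
    then show "u \<in> {u. \<forall>l<n. \<bar>g l u - g l x\<bar> \<le> \<delta>}"
      unfolding diff using g(2)[of _ "u - x"] by (auto intro: order_trans)
  qed
  have [measurable]: "g l \<in> borel_measurable borel" for l
    using g(1) by (rule bounded_linear_imp_borel_measurable)
  have meas: "{u. \<forall>l<n. \<bar>g l u - g l x\<bar> \<le> \<delta>} \<in> sets \<mu>" for n x \<delta>
    by simp
  have "(\<lambda>n. emeasure \<mu> {u. \<forall>l<n. \<bar>g l u - g l x\<bar> \<le> \<delta>}) \<longlonglongrightarrow> emeasure \<mu> (cball x \<delta>)" for x \<delta>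
  proof -
    have "(\<lambda>n. emeasure \<mu> {u. \<forall>l<n. \<bar>g l u - g l x\<bar> \<le> \<delta>}) \<longlonglongrightarrow>
      emeasure \<mu> (\<Inter>n. {u. \<forall>l<n. \<bar>g l u - g l x\<bar> \<le> \<delta>})"
      using meas by (intro Lim_emeasure_decseq) (auto simp: decseq_def)
    also have "(\<Inter>n. {u. \<forall>l<n. \<bar>g l u - g l x\<bar> \<le> \<delta>}) = cball x \<delta>"
    proof (intro equalityI subsetI)
      fix u assume "u \<in> (\<Inter>n. {u. \<forall>l<n. \<bar>g l u - g l x\<bar> \<le> \<delta>})"
      then have "\<bar>g l (u - x)\<bar> \<le> \<delta>" for l
        unfolding diff by (auto dest: spec[of _ "Suc l"])
      then show "u \<in> cball x \<delta>"
        using g(3)[of "u - x" \<delta>] by (simp add: dist_norm norm_minus_commute)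
    qed (use sub in blast)
    finally show ?thesis .
  qed
  with g(1) sub show thesis using that by blast
qed

text \<open>On the ball around x, f stays within N * \<delta> of f x, so undoing the tilt by exp f
  costs the factor exp (N * \<delta> - f x).\<close>

lemma cball_tilt_le:
  assumes f: "bounded_linear f" and N: "\<And>u. \<bar>f u\<bar> \<le> N * norm u" "0 \<le> N"
  shows "measure \<mu> (cball x \<delta>) \<le> exp (N * \<delta> + cov f f / 2 - f x) * measure \<mu> (cball 0 \<delta>)"
proof -
  obtain g :: "nat \<Rightarrow> 'a \<Rightarrow> real" where g: "\<And>n. bounded_linear (g n)"
    "\<And>x \<delta> n. cball x \<delta> \<subseteq> {u. \<forall>l<n. \<bar>g l u - g l x\<bar> \<le> \<delta>}"
    "\<And>x \<delta>. (\<lambda>n. emeasure \<mu> {u. \<forall>l<n. \<bar>g l u - g l x\<bar> \<le> \<delta>}) \<longlonglongrightarrow> emeasure \<mu> (cball x \<delta>)"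
    using cball_strips by blast
  have g0: "g l 0 = 0" for l
    using g(1)[of l] by (simp add: bounded_linear.linear linear_0)
  note [measurable] = functional_measurable[OF f]
  let ?J = "\<integral>\<^sup>+u. indicator (cball x \<delta>) u * ennreal (exp (f u)) \<partial>\<mu>"
  have "?J \<le> ennreal (exp (cov f f / 2)) * emeasure \<mu> {u. \<forall>l<n. \<bar>g l u - g l 0\<bar> \<le> \<delta>}" for n
  proof -
    have "?J \<le> (\<integral>\<^sup>+u. indicator {u. \<forall>l<n. \<bar>g l u - g l x\<bar> \<le> \<delta>} u * ennreal (exp (f u)) \<partial>\<mu>)"
      using g(2)[of x \<delta> n] by (intro nn_integral_mono mult_right_mono) (auto split: split_indicator)
    also have "\<dots> \<le> ennreal (exp (cov f f / 2)) * emeasure \<mu> {u. \<forall>l<n. \<bar>g l u\<bar> \<le> \<delta>}"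
      by (rule strips_tilt_le[OF g(1) f])
    finally show ?thesis by (simp add: g0)
  qed
  \<comment> \<open>Only the strips around 0 have to converge to their ball; for those around x,
    containment of the ball suffices.\<close>
  then have J: "?J \<le> ennreal (exp (cov f f / 2)) * emeasure \<mu> (cball 0 \<delta>)"
    by (intro tendsto_lowerbound[OF ennreal_tendsto_cmult[OF _ g(3)]]) auto
  have "emeasure \<mu> (cball x \<delta>) = (\<integral>\<^sup>+u. indicator (cball x \<delta>) u \<partial>\<mu>)"
    by simp
  also have "\<dots> \<le> (\<integral>\<^sup>+u. ennreal (exp (N * \<delta> - f x)) * (indicator (cball x \<delta>) u * ennreal (exp (f u))) \<partial>\<mu>)"
  proof (rule nn_integral_mono)
    fix u
    show "indicator (cball x \<delta>) u \<le> ennreal (exp (N * \<delta> - f x)) * (indicator (cball x \<delta>) u * ennreal (exp (f u)))"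
    proof (cases "u \<in> cball x \<delta>")
      case True
      then have "N * norm (x - u) \<le> N * \<delta>"
        using N(2) by (intro mult_left_mono) (auto simp: dist_norm)
      then have "f (x - u) \<le> N * \<delta>"
        using N(1)[of "x - u"] by linarith
      then have "1 \<le> exp (N * \<delta> - f x) * exp (f u)"
        using f by (simp add: bounded_linear.linear linear_diff flip: exp_add)
      then have "ennreal 1 \<le> ennreal (exp (N * \<delta> - f x) * exp (f u))"
        by (rule ennreal_leI)
      then show ?thesis using True by (simp add: ennreal_mult')
    qed simp
  qed
  also have "\<dots> = ennreal (exp (N * \<delta> - f x)) * ?J"
    by (rule nn_integral_cmult) measurable
  also have "\<dots> \<le> ennreal (exp (N * \<delta> - f x)) * (ennreal (exp (cov f f / 2)) * emeasure \<mu> (cball 0 \<delta>))"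
    by (intro mult_left_mono J) simp
  also have "\<dots> = ennreal (exp (N * \<delta> - f x) * exp (cov f f / 2) * measure \<mu> (cball 0 \<delta>))"
    by (simp add: emeasure_eq_measure ennreal_mult' mult.assoc)
  also have "exp (N * \<delta> - f x) * exp (cov f f / 2) = exp (N * \<delta> + cov f f / 2 - f x)"
    by (simp flip: exp_add)
  finally show ?thesis
    by (simp add: emeasure_eq_measure)
qed

lemma ball_tilt_le:
  assumes f: "bounded_linear f" and N: "\<And>u. \<bar>f u\<bar> \<le> N * norm u" "0 \<le> N" and "\<delta> > 0"
  shows "measure \<mu> (ball x \<delta>) \<le> exp (N * \<delta> + cov f f / 2 - f x) * measure \<mu> (ball 0 \<delta>)"
proof (rule LIMSEQ_le_const2[OF measure_cball_tendsto_ball[OF \<open>\<delta> > 0\<close>]], intro exI allI impI)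
  fix n
  let ?r = "\<delta> - \<delta> / Suc n"
  have r: "?r < \<delta>" using \<open>\<delta> > 0\<close> by simp
  have "measure \<mu> (cball x ?r) \<le> exp (N * ?r + cov f f / 2 - f x) * measure \<mu> (cball 0 ?r)"
    by (rule cball_tilt_le[OF f N])
  also have "\<dots> \<le> exp (N * \<delta> + cov f f / 2 - f x) * measure \<mu> (ball 0 \<delta>)"
    using N(2) r by (intro mult_mono finite_measure_mono) (auto intro!: mult_left_mono)
  finally show "measure \<mu> (cball x ?r) \<le> exp (N * \<delta> + cov f f / 2 - f x) * measure \<mu> (ball 0 \<delta>)" .
qed

lemma ball_shift_ge:
  assumes h: "h \<in> cm_space \<mu>" and "\<delta> > 0"
  shows "exp (- (cm_norm \<mu> h)\<^sup>2 / 2) * measure \<mu> (ball 0 \<delta>) \<le> measure \<mu> (ball h \<delta>)"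
proof -
  have "exp (- (cm_norm \<mu> h)\<^sup>2 / 2) * measure \<mu> (cball 0 r) \<le> measure \<mu> (cball h r)" for r
  proof -
    obtain g :: "nat \<Rightarrow> 'a \<Rightarrow> real" where g: "\<And>n. bounded_linear (g n)"
      "\<And>x \<delta> n. cball x \<delta> \<subseteq> {u. \<forall>l<n. \<bar>g l u - g l x\<bar> \<le> \<delta>}"
      "\<And>x \<delta>. (\<lambda>n. emeasure \<mu> {u. \<forall>l<n. \<bar>g l u - g l x\<bar> \<le> \<delta>}) \<longlonglongrightarrow> emeasure \<mu> (cball x \<delta>)"
      using cball_strips by blast
    have g0: "g l 0 = 0" for l
      using g(1)[of l] by (simp add: bounded_linear.linear linear_0)
    have "ennreal (exp (- (cm_norm \<mu> h)\<^sup>2 / 2)) * emeasure \<mu> {u. \<forall>l<n. \<bar>g l u - g l 0\<bar> \<le> r}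
        \<le> emeasure \<mu> {u. \<forall>l<n. \<bar>g l u - g l h\<bar> \<le> r}" for n
      using strips_shift_ge[where f = g and n = n, OF g(1) h] by (simp add: g0)
    then have "ennreal (exp (- (cm_norm \<mu> h)\<^sup>2 / 2)) * emeasure \<mu> (cball 0 r) \<le> emeasure \<mu> (cball h r)"
      by (intro LIMSEQ_le[OF ennreal_tendsto_cmult[OF _ g(3)] g(3)]) auto
    then show ?thesis
      by (simp add: emeasure_eq_measure flip: ennreal_mult')
  qed
  then show ?thesis
    by (intro LIMSEQ_le[OF tendsto_mult_left[OF measure_cball_tendsto_ball] measure_cball_tendsto_ball] \<open>\<delta> > 0\<close>)
      auto
qed

text \<open>By the tilt estimate with f = 0, a null ball at 0 makes all balls of the same radius
  null, yet countably many of them cover the separable space.\<close>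

lemma ball_0_pos:
  assumes "\<delta> > 0"
  shows "0 < measure \<mu> (ball 0 \<delta>)"
proof (rule ccontr)
  assume "\<not> 0 < measure \<mu> (ball 0 \<delta>)"
  then have "measure \<mu> (ball 0 \<delta>) = 0"
    using measure_nonneg[of \<mu> "ball 0 \<delta>"] by linarith
  then have zero: "emeasure \<mu> (ball x \<delta>) = 0" for x
    using ball_tilt_le[of "\<lambda>x. 0" 0 \<delta> x] assms measure_nonneg[of \<mu> "ball x \<delta>"]
    by (simp add: bounded_linear_zero emeasure_eq_measure)
  obtain D :: "'a set" where D: "countable D" "\<And>X. open X \<Longrightarrow> X \<noteq> {} \<Longrightarrow> \<exists>d\<in>D. d \<in> X"
    using countable_dense_exists by blast
  have "u \<in> (\<Union>d\<in>D. ball d \<delta>)" for u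
    using D(2)[of "ball u \<delta>"] assms by (auto simp: dist_commute)
  then have "(\<Union>d\<in>D. ball d \<delta>) = UNIV" by blast
  moreover have "(\<Union>d\<in>D. ball d \<delta>) \<in> null_sets \<mu>"
    using D(1) zero by (intro null_sets_UN') (auto simp: null_sets_def)
  ultimately have "emeasure \<mu> UNIV = 0" by (simp add: null_sets_def)
  then show False using emeasure_space_1 by simp
qed

end

section \<open>Small balls under the posterior\<close>

locale gaussian_posterior = centred_gaussian \<mu>
  for \<mu> :: "'a::{banach, second_countable_topology} measure" +
  fixes \<Phi> :: "'a \<Rightarrow> real"
  assumes admissible: "admissible_potential \<Phi>"
begin

abbreviation "\<nu> \<equiv> posterior \<mu> \<Phi>"
abbreviation "E \<equiv> cm_space \<mu>"
abbreviation "OM \<equiv> onsager_machlup \<mu> \<Phi>"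

lemma potential_lower_bound: obtains M where "\<And>u. M \<le> \<Phi> u"
  using admissible unfolding admissible_potential_def by blast

lemma potential_upper_bound:
  assumes "0 < r"
  obtains K where "\<And>u. norm u < r \<Longrightarrow> \<Phi> u \<le> K"
  using admissible assms unfolding admissible_potential_def by blast

lemma potential_Lipschitz:
  assumes "0 < r"
  obtains L where "0 < L" "\<And>u v. norm u \<le> r \<Longrightarrow> norm v \<le> r \<Longrightarrow> \<bar>\<Phi> u - \<Phi> v\<bar> \<le> L * norm (u - v)"
  using admissible assms unfolding admissible_potential_def by blast

lemma potential_ball:
  obtains L where "0 < L"
    "\<And>x u \<delta>. norm (x - z) \<le> 1 \<Longrightarrow> \<delta> \<le> 1 \<Longrightarrow> u \<in> ball x \<delta> \<Longrightarrow> \<bar>\<Phi> u - \<Phi> z\<bar> \<le> L * (norm (x - z) + \<delta>)"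
proof -
  \<comment> \<open>Radius norm z + 2 covers every ball of radius at most 1 whose centre is within
    distance 1 of z, which makes L uniform for moving centres.\<close>
  obtain L where L: "0 < L" "\<And>u v. norm u \<le> norm z + 2 \<Longrightarrow> norm v \<le> norm z + 2 \<Longrightarrow> \<bar>\<Phi> u - \<Phi> v\<bar> \<le> L * norm (u - v)"
    using potential_Lipschitz[of "norm z + 2"] by (metis add_nonneg_pos norm_ge_zero zero_less_numeral)
  have "\<bar>\<Phi> u - \<Phi> z\<bar> \<le> L * (norm (x - z) + \<delta>)" if "norm (x - z) \<le> 1" "\<delta> \<le> 1" "u \<in> ball x \<delta>" for x u \<delta>
  proof -
    have "norm (u - z) \<le> norm (u - x) + norm (x - z)"
      using norm_triangle_ineq[of "u - x" "x - z"] by simp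
    moreover have "norm (u - x) < \<delta>"
      using that by (simp add: dist_norm norm_minus_commute)
    ultimately have uz: "norm (u - z) \<le> norm (x - z) + \<delta>" by linarith
    moreover have "norm u \<le> norm z + norm (u - z)"
      using norm_triangle_ineq[of z "u - z"] by simp
    ultimately have "norm u \<le> norm z + 2" using that by linarith
    then have "\<bar>\<Phi> u - \<Phi> z\<bar> \<le> L * norm (u - z)" by (intro L) auto
    also have "\<dots> \<le> L * (norm (x - z) + \<delta>)"
      using uz L(1) by (intro mult_left_mono) auto
    finally show ?thesis .
  qed
  with L(1) show thesis using that by blast
qed

lemma potential_continuous: "continuous_on UNIV \<Phi>"
  unfolding continuous_on_def
proof
  fix z :: 'a
  obtain L where L: "0 < L" "\<And>u v. norm u \<le> norm z + 1 \<Longrightarrow> norm v \<le> norm z + 1 \<Longrightarrow> \<bar>\<Phi> u - \<Phi> v\<bar> \<le> L * norm (u - v)"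
    using potential_Lipschitz[of "norm z + 1"] by (metis add_nonneg_pos norm_ge_zero zero_less_one)
  have "\<forall>\<^sub>F u in at z. dist u z < 1"
    unfolding eventually_at by (intro exI[of _ 1]) auto
  then have "\<forall>\<^sub>F u in at z. norm (\<Phi> u - \<Phi> z) \<le> L * norm (u - z)"
  proof eventually_elim
    case (elim u)
    have "norm u \<le> norm z + norm (u - z)"
      using norm_triangle_ineq[of z "u - z"] by simp
    with elim have "norm u \<le> norm z + 1" by (simp add: dist_norm)
    then show ?case using L(2)[of u z] by simp
  qed
  moreover have "((\<lambda>u. L * norm (u - z)) \<longlongrightarrow> 0) (at z)"
    by (auto intro!: tendsto_eq_intros)
  ultimately have "((\<lambda>u. \<Phi> u - \<Phi> z) \<longlongrightarrow> 0) (at z)"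
    by (rule Lim_null_comparison)
  then show "(\<Phi> \<longlongrightarrow> \<Phi> z) (at z within UNIV)"
    by (simp add: LIM_zero_iff)
qed

lemma potential_measurable [measurable]: "\<Phi> \<in> borel_measurable \<mu>"
  using borel_measurable_continuous_onI[OF potential_continuous] measurable_cong_sets[OF sets_borel refl] by blast

definition evidence :: real where "evidence = (\<integral>u. exp (- \<Phi> u) \<partial>\<mu>)"

lemma integrable_exp_potential: "integrable \<mu> (\<lambda>u. exp (- \<Phi> u))"
proof -
  obtain M where "\<And>u. M \<le> \<Phi> u" using potential_lower_bound by blast
  then show ?thesis by (intro integrable_const_bound[where B = "exp (- M)"]) auto
qed

lemma evidence_pos: "0 < evidence"
proof -
  have "evidence \<noteq> 0"
  proof
    assume "evidence = 0"
    then have "AE u in \<mu>. exp (- \<Phi> u) = 0"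
      using integral_nonneg_eq_0_iff_AE[OF integrable_exp_potential] by (simp add: evidence_def)
    then show False by simp
  qed
  moreover have "0 \<le> evidence" by (simp add: evidence_def)
  ultimately show ?thesis by simp
qed

lemma posterior_eq: "\<nu> = density \<mu> (\<lambda>u. ennreal (exp (- \<Phi> u) / evidence))"
  by (simp add: posterior_def evidence_def Let_def)

lemma emeasure_posterior:
  "A \<in> sets borel \<Longrightarrow> emeasure \<nu> A = (\<integral>\<^sup>+u. ennreal (exp (- \<Phi> u) / evidence) * indicator A u \<partial>\<mu>)"
  by (simp add: posterior_eq emeasure_density)

lemma prob_space_posterior: "prob_space \<nu>"
proof (rule prob_spaceI)
  have "emeasure \<nu> (space \<nu>) = (\<integral>\<^sup>+u. ennreal (exp (- \<Phi> u) / evidence) \<partial>\<mu>)"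
    by (simp add: posterior_eq emeasure_density)
  also have "\<dots> = ennreal (\<integral>u. exp (- \<Phi> u) / evidence \<partial>\<mu>)"
    using integrable_exp_potential evidence_pos by (intro nn_integral_eq_integral) auto
  also have "\<dots> = 1" using evidence_pos by (simp add: evidence_def)
  finally show "emeasure \<nu> (space \<nu>) = 1" .
qed

sublocale posterior: prob_space \<nu>
  by (rule prob_space_posterior)

lemma posterior_le:
  assumes [measurable]: "A \<in> sets borel" and a: "\<And>u. u \<in> A \<Longrightarrow> a \<le> \<Phi> u"
  shows "evidence * measure \<nu> A \<le> exp (- a) * measure \<mu> A"
proof -
  have "emeasure \<nu> A \<le> (\<integral>\<^sup>+u. ennreal (exp (- a) / evidence) * indicator A u \<partial>\<mu>)"
    unfolding emeasure_posterior[OF assms(1)] using a evidence_pos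
    by (intro nn_integral_mono) (auto split: split_indicator intro!: ennreal_leI divide_right_mono)
  also have "\<dots> = ennreal (exp (- a) / evidence) * emeasure \<mu> A"
    by (simp add: nn_integral_cmult)
  finally have "measure \<nu> A \<le> exp (- a) / evidence * measure \<mu> A"
    using evidence_pos by (simp add: emeasure_eq_measure posterior.emeasure_eq_measure flip: ennreal_mult')
  then show ?thesis using evidence_pos by (simp add: field_simps)
qed

lemma posterior_ge:
  assumes [measurable]: "A \<in> sets borel" and b: "\<And>u. u \<in> A \<Longrightarrow> \<Phi> u \<le> b"
  shows "exp (- b) * measure \<mu> A \<le> evidence * measure \<nu> A"
proof -
  have "(\<integral>\<^sup>+u. ennreal (exp (- b) / evidence) * indicator A u \<partial>\<mu>) \<le> emeasure \<nu> A"
    unfolding emeasure_posterior[OF assms(1)] using b evidence_pos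
    by (intro nn_integral_mono) (auto split: split_indicator intro!: ennreal_leI divide_right_mono)
  moreover have "(\<integral>\<^sup>+u. ennreal (exp (- b) / evidence) * indicator A u \<partial>\<mu>) = ennreal (exp (- b) / evidence) * emeasure \<mu> A"
    by (simp add: nn_integral_cmult)
  ultimately have "exp (- b) / evidence * measure \<mu> A \<le> measure \<nu> A"
    using evidence_pos by (simp add: emeasure_eq_measure posterior.emeasure_eq_measure flip: ennreal_mult')
  then show ?thesis using evidence_pos by (simp add: field_simps)
qed

text \<open>\<open>scaled_ball \<delta> z\<close> is normalized so that it tends to \<open>exp (- I z)\<close> for \<open>z\<close> in the Cameron--Martin space.\<close>

definition sup_ball :: "real \<Rightarrow> real" where "sup_ball \<delta> = (SUP x. measure \<nu> (ball x \<delta>))"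

definition scaled_ball :: "real \<Rightarrow> 'a \<Rightarrow> real" where "scaled_ball \<delta> x = evidence * measure \<nu> (ball x \<delta>) / measure \<mu> (ball 0 \<delta>)"

definition scaled_sup :: "real \<Rightarrow> real" where "scaled_sup \<delta> = evidence * sup_ball \<delta> / measure \<mu> (ball 0 \<delta>)"

lemma bdd_above_posterior_balls: "bdd_above (range (\<lambda>x. measure \<nu> (ball x \<delta>)))"
  by (rule bdd_aboveI2[where M = 1]) simp

lemma posterior_ball_le_sup_ball: "measure \<nu> (ball x \<delta>) \<le> sup_ball \<delta>"
  unfolding sup_ball_def by (rule cSUP_upper[OF _ bdd_above_posterior_balls]) simp

lemma posterior_ball_0_pos:
  assumes "0 < \<delta>"
  shows "0 < measure \<nu> (ball 0 \<delta>)"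
proof -
  obtain K where "\<And>u. norm u < \<delta> \<Longrightarrow> \<Phi> u \<le> K"
    using potential_upper_bound[OF assms] by blast
  then have "exp (- K) * measure \<mu> (ball 0 \<delta>) \<le> evidence * measure \<nu> (ball 0 \<delta>)"
    by (intro posterior_ge) auto
  moreover have "0 < exp (- K) * measure \<mu> (ball 0 \<delta>)"
    using ball_0_pos[OF assms] by simp
  ultimately have "0 < evidence * measure \<nu> (ball 0 \<delta>)" by linarith
  then show ?thesis using evidence_pos by (simp add: zero_less_mult_iff)
qed

lemma sup_ball_pos: "0 < \<delta> \<Longrightarrow> 0 < sup_ball \<delta>"
  using posterior_ball_0_pos[of \<delta>] posterior_ball_le_sup_ball[of 0 \<delta>] by linarith

lemma scaled_sup_pos: "0 < \<delta> \<Longrightarrow> 0 < scaled_sup \<delta>"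
  by (simp add: scaled_sup_def sup_ball_pos evidence_pos ball_0_pos)

lemma scaled_ball_le_scaled_sup: "0 < \<delta> \<Longrightarrow> scaled_ball \<delta> x \<le> scaled_sup \<delta>"
  unfolding scaled_ball_def scaled_sup_def using evidence_pos
  by (intro divide_right_mono mult_left_mono posterior_ball_le_sup_ball) auto

lemma scaled_ball_div_scaled_sup: "0 < \<delta> \<Longrightarrow> scaled_ball \<delta> x / scaled_sup \<delta> = measure \<nu> (ball x \<delta>) / (SUP x. measure \<nu> (ball x \<delta>))"
  using evidence_pos ball_0_pos[of \<delta>] by (simp add: scaled_ball_def scaled_sup_def sup_ball_def)

section \<open>MAP estimators and maximizing families in terms of normalized ball masses\<close>

lemma MAP_iff: "MAP_estimator \<nu> z \<longleftrightarrow> ((\<lambda>\<delta>. scaled_ball \<delta> z / scaled_sup \<delta>) \<longlongrightarrow> 1) (at_right 0)"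
  unfolding MAP_estimator_def
  by (intro tendsto_cong eventually_at_right_less[THEN eventually_mono]) (simp add: scaled_ball_div_scaled_sup)

lemma AMF_tendsto:
  assumes "asymptotic_maximizing_family \<nu> \<zeta>"
  shows "((\<lambda>\<delta>. scaled_ball \<delta> (\<zeta> \<delta>) / scaled_sup \<delta>) \<longlongrightarrow> 1) (at_right 0)"
proof -
  obtain \<epsilon> where \<epsilon>: "(\<epsilon> \<longlongrightarrow> 0) (at_right 0)"
    "\<And>\<delta>. 0 < \<delta> \<Longrightarrow> 1 - \<epsilon> \<delta> < scaled_ball \<delta> (\<zeta> \<delta>) / scaled_sup \<delta>"
    using assms unfolding asymptotic_maximizing_family_def by (auto simp: scaled_ball_div_scaled_sup)
  have "((\<lambda>\<delta>. 1 - \<epsilon> \<delta>) \<longlongrightarrow> 1 - 0) (at_right 0)"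
    by (intro tendsto_intros \<epsilon>)
  then have lim: "((\<lambda>\<delta>. 1 - \<epsilon> \<delta>) \<longlongrightarrow> 1) (at_right 0)" by simp
  have "\<forall>\<^sub>F \<delta> in at_right 0. 1 - \<epsilon> \<delta> \<le> scaled_ball \<delta> (\<zeta> \<delta>) / scaled_sup \<delta>" "\<forall>\<^sub>F \<delta> in at_right 0. scaled_ball \<delta> (\<zeta> \<delta>) / scaled_sup \<delta> \<le> 1"
    using \<epsilon>(2) scaled_ball_le_scaled_sup scaled_sup_pos
    by (auto intro!: eventually_at_right_less[THEN eventually_mono] simp: divide_le_eq_1_pos less_imp_le)
  then show ?thesis
    by (rule tendsto_sandwich[OF _ _ lim tendsto_const])
qed

lemma AMF_I:
  assumes pos: "\<And>\<delta>. 0 < \<delta> \<Longrightarrow> 0 < scaled_ball \<delta> (\<zeta> \<delta>)"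
    and lim: "((\<lambda>\<delta>. scaled_ball \<delta> (\<zeta> \<delta>) / scaled_sup \<delta>) \<longlongrightarrow> 1) (at_right 0)"
  shows "asymptotic_maximizing_family \<nu> \<zeta>"
  unfolding asymptotic_maximizing_family_def
proof (intro exI conjI allI impI)
  define \<rho> where "\<rho> \<delta> = scaled_ball \<delta> (\<zeta> \<delta>) / scaled_sup \<delta>" for \<delta>
  \<comment> \<open>The definition asks for a strict inequality and \<epsilon> in (0, 1) at every
    \<delta>. The factor 1 - min \<delta> 1 / 2 lies in [1/2, 1) and tends to 1, so \<epsilon> stays
    positive even where the ratio \<rho> equals 1; positivity of \<rho> keeps \<epsilon> below
    1.\<close>
  define \<epsilon> where "\<epsilon> \<delta> = 1 - \<rho> \<delta> * (1 - min \<delta> 1 / 2)" for \<delta>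
  have \<rho>: "0 < \<rho> \<delta>" "\<rho> \<delta> \<le> 1" if "0 < \<delta>" for \<delta>
    using that pos scaled_sup_pos scaled_ball_le_scaled_sup by (auto simp: \<rho>_def divide_le_eq_1_pos)
  show "0 < \<epsilon> \<delta>" if "0 < \<delta>" for \<delta>
  proof -
    have "\<rho> \<delta> * (1 - min \<delta> 1 / 2) \<le> 1 * (1 - min \<delta> 1 / 2)"
      using \<rho>[OF that] that by (intro mult_right_mono) auto
    also have "\<dots> < 1" using that by simp
    finally show ?thesis by (simp add: \<epsilon>_def)
  qed
  show "\<epsilon> \<delta> < 1" if "0 < \<delta>" for \<delta>
    using \<rho>[OF that] that by (simp add: \<epsilon>_def)
  have "((\<lambda>\<delta>. 1 - \<rho> \<delta> * (1 - min \<delta> 1 / 2)) \<longlongrightarrow> 1 - 1 * (1 - min 0 1 / 2)) (at_right 0)"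
    by (intro tendsto_intros lim[folded \<rho>_def]) auto
  then show "(\<epsilon> \<longlongrightarrow> 0) (at_right 0)"
    by (simp add: \<epsilon>_def[abs_def])
  show "1 - \<epsilon> \<delta> < measure \<nu> (ball (\<zeta> \<delta>) \<delta>) / (SUP x. measure \<nu> (ball x \<delta>))" if "0 < \<delta>" for \<delta>
  proof -
    have "\<rho> \<delta> * (1 - min \<delta> 1 / 2) < \<rho> \<delta> * 1"
      using \<rho>[OF that] that by (intro mult_strict_left_mono) auto
    then show ?thesis by (simp add: \<epsilon>_def \<rho>_def flip: scaled_ball_div_scaled_sup[OF that])
  qed
qed

lemma MAP_imp_AMF_const:
  assumes "MAP_estimator \<nu> z"
  shows "asymptotic_maximizing_family \<nu> (\<lambda>_. z)"
proof (rule AMF_I)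
  fix \<delta> :: real assume "0 < \<delta>"
  have "\<forall>\<^sub>F \<eta> in at_right 0. 0 < scaled_ball \<eta> z / scaled_sup \<eta>"
    using assms unfolding MAP_iff by (rule order_tendstoD) simp
  then obtain b where b: "0 < b" "\<And>\<eta>. 0 < \<eta> \<Longrightarrow> \<eta> < b \<Longrightarrow> 0 < scaled_ball \<eta> z / scaled_sup \<eta>"
    unfolding eventually_at_right_field by blast
  \<comment> \<open>The limit yields positive mass at small radii only; a small concentric ball
    passes it on to every \<delta>.\<close>
  define \<eta> where "\<eta> = min \<delta> (b / 2)"
  have "0 < \<eta>" "\<eta> < b" "\<eta> \<le> \<delta>" using b(1) \<open>0 < \<delta>\<close> by (auto simp: \<eta>_def)
  then have "0 < scaled_ball \<eta> z"
    using b(2)[of \<eta>] scaled_sup_pos[of \<eta>] by (simp add: zero_less_divide_iff)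
  then have "0 < measure \<nu> (ball z \<eta>)"
    using evidence_pos by (auto simp: scaled_ball_def zero_less_divide_iff zero_less_mult_iff)
  also have "\<dots> \<le> measure \<nu> (ball z \<delta>)"
    using \<open>\<eta> \<le> \<delta>\<close> by (intro posterior.finite_measure_mono subset_ball) (auto simp: posterior_eq)
  finally show "0 < scaled_ball \<delta> z"
    using evidence_pos ball_0_pos[OF \<open>0 < \<delta>\<close>] by (simp add: scaled_ball_def)
qed (use assms MAP_iff in blast)

lemma AMF_exists: "\<exists>\<zeta>. asymptotic_maximizing_family \<nu> \<zeta>"
proof -
  \<comment> \<open>The slack min \<delta> 1 / 2 lies in (0, 1), tends to 0 and leaves a strict gap
    below the positive supremum.\<close>
  have "\<exists>x. (1 - min \<delta> 1 / 2) * sup_ball \<delta> < measure \<nu> (ball x \<delta>)" if "0 < \<delta>" for \<delta>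
  proof -
    have "(1 - min \<delta> 1 / 2) * sup_ball \<delta> < 1 * sup_ball \<delta>"
      using that sup_ball_pos by (intro mult_strict_right_mono) auto
    then show ?thesis
      using less_cSUP_iff[OF _ bdd_above_posterior_balls] by (auto simp: sup_ball_def)
  qed
  then obtain \<zeta> where \<zeta>: "\<And>\<delta>. 0 < \<delta> \<Longrightarrow> (1 - min \<delta> 1 / 2) * sup_ball \<delta> < measure \<nu> (ball (\<zeta> \<delta>) \<delta>)"
    by metis
  have "asymptotic_maximizing_family \<nu> \<zeta>"
    unfolding asymptotic_maximizing_family_def
  proof (intro exI conjI allI impI)
    have "((\<lambda>\<delta>. min \<delta> 1 / 2) \<longlongrightarrow> min 0 1 / 2) (at_right (0::real))"
      by (intro tendsto_intros) auto
    then show "((\<lambda>\<delta>. min \<delta> 1 / 2) \<longlongrightarrow> 0) (at_right (0::real))" by simp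
    show "1 - min \<delta> 1 / 2 < measure \<nu> (ball (\<zeta> \<delta>) \<delta>) / (SUP x. measure \<nu> (ball x \<delta>))" if "0 < \<delta>" for \<delta>
      using \<zeta>[OF that] sup_ball_pos[OF that] by (simp add: pos_less_divide_eq flip: sup_ball_def)
  qed auto
  then show ?thesis by blast
qed

text \<open>The ball at 0 is a competitor of normalized mass at least exp (- K), where K bounds the
  potential on the unit ball. Eventually the family reaches more than half of the supremum, and
  \<Phi> \<ge> M converts posterior mass back to \<mu>; this explains the constant exp (M - K) /
  2.\<close>

lemma AMF_ball_ratio_ge:
  assumes "asymptotic_maximizing_family \<nu> \<zeta>"
  shows "\<exists>K>0. \<exists>\<delta>\<^sub>0>0. \<forall>\<delta>. 0 < \<delta> \<and> \<delta> < \<delta>\<^sub>0 \<longrightarrow> ball_ratio \<mu> \<delta> (\<zeta> \<delta>) \<ge> K"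
proof -
  have "\<forall>\<^sub>F \<delta> in at_right 0. 1 / 2 < scaled_ball \<delta> (\<zeta> \<delta>) / scaled_sup \<delta>"
    using AMF_tendsto[OF assms] by (rule order_tendstoD) simp
  then obtain b where b: "0 < b" "\<And>\<delta>. 0 < \<delta> \<Longrightarrow> \<delta> < b \<Longrightarrow> 1 / 2 < scaled_ball \<delta> (\<zeta> \<delta>) / scaled_sup \<delta>"
    unfolding eventually_at_right_field by blast
  obtain M where M: "\<And>u. M \<le> \<Phi> u" using potential_lower_bound by blast
  obtain K where K: "\<And>u. norm u < 1 \<Longrightarrow> \<Phi> u \<le> K"
    using potential_upper_bound[of 1] by auto
  have "exp (M - K) / 2 \<le> ball_ratio \<mu> \<delta> (\<zeta> \<delta>)" if "0 < \<delta>" "\<delta> < min b 1" for \<delta>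
  proof -
    have pos: "0 < measure \<mu> (ball 0 \<delta>)" using ball_0_pos that by simp
    have "exp (- K) * measure \<mu> (ball 0 \<delta>) \<le> evidence * measure \<nu> (ball 0 \<delta>)"
      using K that by (intro posterior_ge) auto
    then have "exp (- K) \<le> scaled_ball \<delta> 0"
      using pos by (simp add: scaled_ball_def field_simps)
    also have "\<dots> \<le> scaled_sup \<delta>" using scaled_ball_le_scaled_sup that by simp
    also have "\<dots> < 2 * scaled_ball \<delta> (\<zeta> \<delta>)"
      using b(2)[of \<delta>] that scaled_sup_pos[of \<delta>] by (simp add: field_simps)
    also have "scaled_ball \<delta> (\<zeta> \<delta>) \<le> exp (- M) * ball_ratio \<mu> \<delta> (\<zeta> \<delta>)"
      using posterior_le[of "ball (\<zeta> \<delta>) \<delta>" M] M pos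
      by (simp add: scaled_ball_def ball_ratio_def divide_right_mono)
    finally have "exp M * exp (- K) \<le> exp M * (2 * (exp (- M) * ball_ratio \<mu> \<delta> (\<zeta> \<delta>)))"
      by simp
    also have "\<dots> = 2 * ball_ratio \<mu> \<delta> (\<zeta> \<delta>)"
      by (simp add: exp_minus)
    also have "exp M * exp (- K) = exp (M - K)"
      by (simp flip: exp_add)
    finally show ?thesis by simp
  qed
  moreover have "0 < min b 1" "0 < exp (M - K) / 2" using b(1) by auto
  ultimately show ?thesis by blast
qed

section \<open>Asymptotics of small posterior balls\<close>

text \<open>Half the squared norm is the Legendre transform of half the variance. A near-maximizer
  is a * g, where a is the norm of z and g, of variance at most 1, nearly attains a at z.\<close>

lemma cm_norm_dual:
  assumes "z \<in> E" "0 < \<eta>"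
  obtains f where "bounded_linear f" "(cm_norm \<mu> z)\<^sup>2 / 2 - \<eta> \<le> f z - cov f f / 2"
proof -
  let ?a = "cm_norm \<mu> z"
  have bdd: "bdd_above (cm_values \<mu> z)"
    using assms(1) by (simp add: cm_space_def)
  have zero: "0 \<in> cm_values \<mu> z"
    unfolding cm_values_def by (rule CollectI, rule exI[of _ "\<lambda>x. 0"]) (simp add: bounded_linear_zero)
  have a: "0 \<le> ?a"
    unfolding cm_norm_def by (rule cSup_upper[OF zero bdd])
  \<comment> \<open>The tolerance is divided by a + 1 so that it stays below \<eta> after
    multiplication by a, also when a = 0.\<close>
  have "\<exists>y\<in>cm_values \<mu> z. ?a - \<eta> / (?a + 1) < y"
    using zero bdd assms(2) a unfolding cm_norm_def[symmetric]
    by (subst less_cSup_iff[symmetric]) (auto simp flip: cm_norm_def)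
  then obtain g where g: "bounded_linear g" "cov g g \<le> 1" "?a - \<eta> / (?a + 1) < g z"
    unfolding cm_values_def by (auto simp: cov_self)
  show thesis
  proof (rule that)
    show "bounded_linear (\<lambda>x. ?a * g x)"
      using g(1) by (rule bounded_linear_const_mult)
    have "cov (\<lambda>x. ?a * g x) (\<lambda>x. ?a * g x) = ?a * (?a * cov g g)"
      by (simp only: cov_scale_left cov_commute[of g "\<lambda>x. ?a * g x"])
    also have "\<dots> \<le> ?a * (?a * 1)"
      using g(2) a by (intro mult_left_mono) auto
    finally have c: "cov (\<lambda>x. ?a * g x) (\<lambda>x. ?a * g x) \<le> ?a\<^sup>2"
      by (simp add: power2_eq_square)
    have "?a * (?a - \<eta> / (?a + 1)) \<le> ?a * g z"
      using g(3) a by (intro mult_left_mono) auto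
    moreover have "?a * (\<eta> / (?a + 1)) \<le> \<eta>"
      using a assms(2) by (simp add: field_simps)
    ultimately have "?a\<^sup>2 - \<eta> \<le> ?a * g z"
      by (simp add: power2_eq_square right_diff_distrib)
    with c show "?a\<^sup>2 / 2 - \<eta> \<le> ?a * g z - cov (\<lambda>x. ?a * g x) (\<lambda>x. ?a * g x) / 2"
      by linarith
  qed
qed

text \<open>One functional, chosen for the limit z, is used at all centres x n, which may lie
  outside E; only f (x n) has to converge. The general filter covers both sequences with moving
  centres and a fixed centre as \<delta> tends to 0.\<close>

lemma scaled_ball_upper:
  assumes z: "z \<in> E" and \<delta>: "filterlim \<delta> (at_right 0) F" and x: "(x \<longlongrightarrow> z) F"
    and c: "exp (- OM z) < c"
  shows "\<forall>\<^sub>F n in F. scaled_ball (\<delta> n) (x n) < c"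
proof -
  have \<delta>0: "(\<delta> \<longlongrightarrow> 0) F" and \<delta>_pos: "\<forall>\<^sub>F n in F. 0 < \<delta> n"
    using \<delta> by (auto simp: filterlim_at elim: eventually_mono)
  have "0 < c" using c by (meson exp_gt_zero less_trans)
  \<comment> \<open>Half of the gap between - OM z and ln c is spent on the choice of f; the other
    half leaves the limit of the bounds B strictly below c.\<close>
  define \<eta> where "\<eta> = (ln c + OM z) / 2"
  have "- OM z < ln c"
    using c \<open>0 < c\<close> by (metis exp_less_cancel_iff exp_ln)
  then have \<eta>: "0 < \<eta>" "- OM z + \<eta> < ln c"
    by (auto simp: \<eta>_def)
  obtain f where f: "bounded_linear f" "(cm_norm \<mu> z)\<^sup>2 / 2 - \<eta> \<le> f z - cov f f / 2"
    using cm_norm_dual[OF z \<eta>(1)] by blast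
  obtain N where N: "0 \<le> N" "\<And>u. \<bar>f u\<bar> \<le> N * norm u"
    using bounded_linear.nonneg_bounded[OF f(1)] by (auto simp: mult.commute)
  obtain L where L: "0 < L" "\<And>x u \<delta>. norm (x - z) \<le> 1 \<Longrightarrow> \<delta> \<le> 1 \<Longrightarrow> u \<in> ball x \<delta> \<Longrightarrow> \<bar>\<Phi> u - \<Phi> z\<bar> \<le> L * (norm (x - z) + \<delta>)"
    using potential_ball[of z] by blast
  define B where "B n = exp (- (\<Phi> z - L * (norm (x n - z) + \<delta> n))) * exp (N * \<delta> n + cov f f / 2 - f (x n))" for n
  have "(B \<longlongrightarrow> exp (- (\<Phi> z - L * (norm (z - z) + 0))) * exp (N * 0 + cov f f / 2 - f z)) F"
    unfolding B_def by (intro tendsto_intros \<delta>0 x bounded_linear.tendsto[OF f(1)])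
  moreover have "exp (- (\<Phi> z - L * (norm (z - z) + 0))) * exp (N * 0 + cov f f / 2 - f z) < c"
  proof -
    have "- \<Phi> z + (cov f f / 2 - f z) < ln c"
      using f(2) \<eta>(2) by (simp add: onsager_machlup_def)
    then have "exp (- \<Phi> z + (cov f f / 2 - f z)) < exp (ln c)"
      by (rule exp_less_mono)
    then show ?thesis using \<open>0 < c\<close> by (simp flip: exp_add)
  qed
  ultimately have "\<forall>\<^sub>F n in F. B n < c"
    by (rule order_tendstoD)
  moreover have "\<forall>\<^sub>F n in F. \<delta> n < 1"
    by (rule order_tendstoD[OF \<delta>0]) simp
  moreover have "\<forall>\<^sub>F n in F. norm (x n - z) < 1"
  proof -
    have "\<forall>\<^sub>F n in F. dist (x n) z < 1" by (rule tendstoD[OF x]) simp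
    then show ?thesis by (simp add: dist_norm)
  qed
  ultimately show ?thesis
    using \<delta>_pos
  proof eventually_elim
    case (elim n)
    have pos: "0 < measure \<mu> (ball 0 (\<delta> n))" using ball_0_pos elim by simp
    have "evidence * measure \<nu> (ball (x n) (\<delta> n)) \<le> exp (- (\<Phi> z - L * (norm (x n - z) + \<delta> n))) * measure \<mu> (ball (x n) (\<delta> n))"
    proof (rule posterior_le)
      fix u assume "u \<in> ball (x n) (\<delta> n)"
      then show "\<Phi> z - L * (norm (x n - z) + \<delta> n) \<le> \<Phi> u"
        using L(2)[of "x n" "\<delta> n" u] elim by linarith
    qed simp
    also have "\<dots> \<le> exp (- (\<Phi> z - L * (norm (x n - z) + \<delta> n))) *
        (exp (N * \<delta> n + cov f f / 2 - f (x n)) * measure \<mu> (ball 0 (\<delta> n)))"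
      using elim by (intro mult_left_mono ball_tilt_le f N) auto
    finally have "scaled_ball (\<delta> n) (x n) \<le> B n"
      using pos by (simp add: scaled_ball_def B_def pos_divide_le_eq mult.assoc)
    with elim show ?case by simp
  qed
qed

text \<open>In contrast to the upper bound the centre is fixed: the translation estimate is
  available at points of E, and nearby centres may lie outside.\<close>

lemma scaled_ball_lower:
  assumes z: "z \<in> E" and c: "c < exp (- OM z)"
  shows "\<forall>\<^sub>F \<delta> in at_right 0. c < scaled_ball \<delta> z"
proof -
  obtain L where L: "0 < L" "\<And>x u \<delta>. norm (x - z) \<le> 1 \<Longrightarrow> \<delta> \<le> 1 \<Longrightarrow> u \<in> ball x \<delta> \<Longrightarrow> \<bar>\<Phi> u - \<Phi> z\<bar> \<le> L * (norm (x - z) + \<delta>)"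
    using potential_ball[of z] by blast
  define B where "B \<delta> = exp (- (\<Phi> z + L * \<delta>)) * exp (- (cm_norm \<mu> z)\<^sup>2 / 2)" for \<delta>
  have "(B \<longlongrightarrow> exp (- (\<Phi> z + L * 0)) * exp (- (cm_norm \<mu> z)\<^sup>2 / 2)) (at_right 0)"
    unfolding B_def by (intro tendsto_intros)
  also have "exp (- (\<Phi> z + L * 0)) * exp (- (cm_norm \<mu> z)\<^sup>2 / 2) = exp (- OM z)"
    by (simp add: onsager_machlup_def flip: exp_add)
  finally have "\<forall>\<^sub>F \<delta> in at_right 0. c < B \<delta>"
    using c by (rule order_tendstoD)
  moreover have "\<forall>\<^sub>F \<delta> in at_right (0::real). \<delta> < 1 \<and> 0 < \<delta>"
    unfolding eventually_at_right_field by (intro exI[of _ 1]) auto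
  ultimately show ?thesis
  proof eventually_elim
    case (elim \<delta>)
    have pos: "0 < measure \<mu> (ball 0 \<delta>)" using ball_0_pos elim by simp
    have "exp (- (\<Phi> z + L * \<delta>)) * (exp (- (cm_norm \<mu> z)\<^sup>2 / 2) * measure \<mu> (ball 0 \<delta>))
        \<le> exp (- (\<Phi> z + L * \<delta>)) * measure \<mu> (ball z \<delta>)"
      using elim by (intro mult_left_mono ball_shift_ge z) auto
    also have "\<dots> \<le> evidence * measure \<nu> (ball z \<delta>)"
    proof (rule posterior_ge)
      fix u assume "u \<in> ball z \<delta>"
      then show "\<Phi> u \<le> \<Phi> z + L * \<delta>"
        using L(2)[of z \<delta> u] elim by (simp; linarith)
    qed simp
    finally have "B \<delta> \<le> scaled_ball \<delta> z"
      using pos by (simp add: scaled_ball_def B_def pos_le_divide_eq mult.assoc)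
    with elim show ?case by simp
  qed
qed

lemma scaled_ball_tendsto:
  assumes "z \<in> E"
  shows "((\<lambda>\<delta>. scaled_ball \<delta> z) \<longlongrightarrow> exp (- OM z)) (at_right 0)"
proof (rule order_tendstoI)
  show "\<forall>\<^sub>F \<delta> in at_right 0. scaled_ball \<delta> z < c" if "exp (- OM z) < c" for c
    using scaled_ball_upper[OF assms filterlim_ident tendsto_const that] .
qed (rule scaled_ball_lower[OF assms])

lemma positive_null_seq_filterlim: "positive_null_seq \<delta> \<Longrightarrow> filterlim \<delta> (at_right 0) sequentially"
  by (auto simp: positive_null_seq_def filterlim_at intro!: always_eventually) (metis less_irrefl)

text \<open>The supremum is squeezed: the fixed centre z bounds it from below, and the nearly
  maximal centres, which converge to z, bound it from above. A fixed centre x in E is a further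
  competitor, whence z minimizes.\<close>

lemma AMF_limit:
  assumes amf: "asymptotic_maximizing_family \<nu> \<zeta>" and \<delta>: "positive_null_seq \<delta>"
    and lim: "(\<lambda>n. \<zeta> (\<delta> n)) \<longlonglongrightarrow> z" and z: "z \<in> E"
  shows "(\<lambda>n. scaled_sup (\<delta> n)) \<longlonglongrightarrow> exp (- OM z)" and "x \<in> E \<Longrightarrow> OM z \<le> OM x"
proof -
  note fl = positive_null_seq_filterlim[OF \<delta>]
  have pos: "0 < \<delta> n" for n using \<delta> by (simp add: positive_null_seq_def)
  have ratio: "(\<lambda>n. scaled_ball (\<delta> n) (\<zeta> (\<delta> n)) / scaled_sup (\<delta> n)) \<longlonglongrightarrow> 1"
    by (rule filterlim_compose[OF AMF_tendsto[OF amf] fl])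
  have scaled_ball_lim: "(\<lambda>n. scaled_ball (\<delta> n) x) \<longlonglongrightarrow> exp (- OM x)" if "x \<in> E" for x
    by (rule filterlim_compose[OF scaled_ball_tendsto[OF that] fl])
  show scaled_sup: "(\<lambda>n. scaled_sup (\<delta> n)) \<longlonglongrightarrow> exp (- OM z)"
  proof (rule order_tendstoI)
    fix c assume c: "c < exp (- OM z)"
    have "\<forall>\<^sub>F n in sequentially. c < scaled_ball (\<delta> n) z"
      by (rule order_tendstoD(1)[OF scaled_ball_lim[OF z] c])
    then show "\<forall>\<^sub>F n in sequentially. c < scaled_sup (\<delta> n)"
      by eventually_elim (use scaled_ball_le_scaled_sup pos in \<open>auto intro: less_le_trans\<close>)
  next
    fix c assume "exp (- OM z) < c"
    \<comment> \<open>The intermediate d leaves room for the ratio: ball mass below d together with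
      a ratio above d / c puts the supremum below c.\<close>
    then obtain d where d: "exp (- OM z) < d" "d < c" using dense by blast
    have "0 < d" using d(1) by (meson exp_gt_zero less_trans)
    have "\<forall>\<^sub>F n in sequentially. scaled_ball (\<delta> n) (\<zeta> (\<delta> n)) < d"
      by (rule scaled_ball_upper[OF z fl lim d(1)])
    moreover have "\<forall>\<^sub>F n in sequentially. d / c < scaled_ball (\<delta> n) (\<zeta> (\<delta> n)) / scaled_sup (\<delta> n)"
      by (rule order_tendstoD[OF ratio]) (use d \<open>0 < d\<close> in simp)
    ultimately show "\<forall>\<^sub>F n in sequentially. scaled_sup (\<delta> n) < c"
    proof eventually_elim
      case (elim n)
      then have "d / c < d / scaled_sup (\<delta> n)"
        using scaled_sup_pos[OF pos, of n] by (meson divide_strict_right_mono less_trans)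
      then show ?case
        using \<open>0 < d\<close> d scaled_sup_pos[OF pos, of n] by (simp add: field_simps)
    qed
  qed
  show "OM z \<le> OM x" if "x \<in> E"
  proof -
    have "exp (- OM x) \<le> exp (- OM z)"
      using scaled_ball_le_scaled_sup pos by (intro LIMSEQ_le[OF scaled_ball_lim[OF that] scaled_sup]) auto
    then show ?thesis by simp
  qed
qed

section \<open>Limits of maximizing families under the conditions (C1)--(C4)\<close>

text \<open>This contradicts the conclusion of C1, C3 and C4, which are used contrapositively
  throughout.\<close>

lemma liminf_ball_ratio_pos:
  assumes "0 < K" "\<forall>\<^sub>F m in sequentially. K \<le> ball_ratio \<mu> (\<delta> m) (x m)"
  shows "liminf (\<lambda>m. ereal (ball_ratio \<mu> (\<delta> m) (x m))) \<noteq> 0"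
proof -
  have "ereal K \<le> liminf (\<lambda>m. ereal (ball_ratio \<mu> (\<delta> m) (x m)))"
    using assms(2) by (intro Liminf_bounded) (auto elim: eventually_mono)
  then show ?thesis using assms(1) by auto
qed

text \<open>One K serves all null sequences and hence survives the passage to subsequences.\<close>

lemma AMF_eventually_ratio:
  assumes "asymptotic_maximizing_family \<nu> \<zeta>"
  obtains K where "0 < K" "\<And>\<delta>. positive_null_seq \<delta> \<Longrightarrow> \<forall>\<^sub>F m in sequentially. K \<le> ball_ratio \<mu> (\<delta> m) (\<zeta> (\<delta> m))"
proof -
  obtain K \<delta>0 where K: "0 < K" "0 < \<delta>0" "\<And>\<delta>. 0 < \<delta> \<Longrightarrow> \<delta> < \<delta>0 \<Longrightarrow> K \<le> ball_ratio \<mu> \<delta> (\<zeta> \<delta>)"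
    using AMF_ball_ratio_ge[OF assms] by blast
  have "\<forall>\<^sub>F m in sequentially. K \<le> ball_ratio \<mu> (\<delta> m) (\<zeta> (\<delta> m))" if "positive_null_seq \<delta>" for \<delta>
  proof -
    have "\<forall>\<^sub>F m in sequentially. \<delta> m < \<delta>0"
      using that K(2) by (intro order_tendstoD[where y = 0]) (auto simp: positive_null_seq_def)
    then show ?thesis
      by eventually_elim (use that K(3) in \<open>auto simp: positive_null_seq_def\<close>)
  qed
  with K(1) show thesis using that by blast
qed

lemma LIMSEQ_imp_weakly: "x \<longlonglongrightarrow> z \<Longrightarrow> weakly_converges_to x z"
  by (simp add: weakly_converges_to_def bounded_linear.tendsto)

text \<open>Weak convergence is assumed because compactness first yields weak limits only; strong
  limits are a special case.\<close>

lemma AMF_limit_in_cm_space: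
  assumes "C3 \<mu>" "asymptotic_maximizing_family \<nu> \<zeta>" "positive_null_seq \<delta>" "weakly_converges_to (\<lambda>n. \<zeta> (\<delta> n)) z"
  shows "z \<in> E"
proof (rule ccontr)
  assume "z \<notin> E"
  obtain K where K: "0 < K" "\<forall>\<^sub>F m in sequentially. K \<le> ball_ratio \<mu> (\<delta> m) (\<zeta> (\<delta> m))"
    using AMF_eventually_ratio[OF assms(2)] assms(3) by metis
  have "liminf (\<lambda>m. ereal (ball_ratio \<mu> (\<delta> m) (\<zeta> (\<delta> m)))) = 0"
    using assms \<open>z \<notin> E\<close> unfolding C3_def by blast
  then show False using liminf_ball_ratio_pos[OF K] by simp
qed

lemma positive_null_seq_subseq: "positive_null_seq \<delta> \<Longrightarrow> strict_mono r \<Longrightarrow> positive_null_seq (\<lambda>m. \<delta> (r m))"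
  using LIMSEQ_subseq_LIMSEQ[of \<delta> 0 r] by (auto simp: positive_null_seq_def o_def)

text \<open>C1 makes the centres bounded, C2 extracts a weak limit, C3 places it in E, and C4
  upgrades the convergence to a strong one.\<close>

lemma AMF_compactness:
  assumes C: "C1 \<mu>" "C2 \<mu>" "C3 \<mu>" "C4 \<mu>" and amf: "asymptotic_maximizing_family \<nu> \<zeta>"
    and \<delta>: "positive_null_seq \<delta>"
  obtains r w where "strict_mono r" "w \<in> E" "(\<lambda>m. \<zeta> (\<delta> (r m))) \<longlonglongrightarrow> w"
proof -
  obtain K where K: "0 < K" "\<And>\<delta>. positive_null_seq \<delta> \<Longrightarrow> \<forall>\<^sub>F m in sequentially. K \<le> ball_ratio \<mu> (\<delta> m) (\<zeta> (\<delta> m))"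
    using AMF_eventually_ratio[OF amf] by blast
  obtain N where N: "\<And>m. N \<le> m \<Longrightarrow> K \<le> ball_ratio \<mu> (\<delta> m) (\<zeta> (\<delta> m))"
    using K(2)[OF \<delta>] by (auto simp: eventually_sequentially)
  \<comment> \<open>C2 demands the lower bound at every index, so the finitely many terms before it
    holds are dropped.\<close>
  define \<delta>' where "\<delta>' m = \<delta> (m + N)" for m
  have \<delta>': "positive_null_seq \<delta>'"
    unfolding \<delta>'_def by (rule positive_null_seq_subseq[OF \<delta>]) (simp add: strict_mono_def)
  have K': "K \<le> ball_ratio \<mu> (\<delta>' m) (\<zeta> (\<delta>' m))" for m
    unfolding \<delta>'_def by (rule N) simp
  have "bounded (range (\<lambda>m. \<zeta> (\<delta>' m)))"
    using C(1) \<delta>' liminf_ball_ratio_pos[OF K(1) K(2)[OF \<delta>']] unfolding C1_def by blast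
  then obtain r z where r: "strict_mono r" and z: "weakly_converges_to ((\<lambda>m. \<zeta> (\<delta>' m)) \<circ> r) z"
    using C(2) \<delta>' K(1) K' unfolding C2_def by blast
  let ?x = "\<lambda>m. \<zeta> (\<delta>' (r m))"
  have z: "weakly_converges_to ?x z" using z by (simp add: o_def)
  have \<delta>r: "positive_null_seq (\<lambda>m. \<delta>' (r m))"
    by (rule positive_null_seq_subseq[OF \<delta>' r])
  have "z \<in> E"
    by (rule AMF_limit_in_cm_space[OF C(3) amf \<delta>r z])
  then have "convergent ?x"
    using C(4) \<delta>r z liminf_ball_ratio_pos[OF K(1) K(2)[OF \<delta>r]] unfolding C4_def by blast
  then obtain w where w: "?x \<longlonglongrightarrow> w" by (auto simp: convergent_def)
  \<comment> \<open>The strong limit w comes from \<open>convergent\<close> and is not identified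
    with the weak limit z; C3 is applied to it afresh.\<close>
  have "w \<in> E"
    by (rule AMF_limit_in_cm_space[OF C(3) amf \<delta>r LIMSEQ_imp_weakly[OF w]])
  moreover have "strict_mono (\<lambda>m. r m + N)"
    using r by (simp add: strict_mono_def)
  ultimately show thesis
    using w that by (simp add: \<delta>'_def)
qed

lemma minimizes_iff: "z \<in> E \<and> minimizes_OM \<mu> \<Phi> z \<longleftrightarrow> z \<in> E \<and> (\<forall>x\<in>E. OM z \<le> OM x)"
  by (auto simp: minimizes_OM_def is_arg_min_def not_less)

lemma MAP_I:
  assumes "z \<in> E" "(scaled_sup \<longlongrightarrow> exp (- OM z)) (at_right 0)"
  shows "MAP_estimator \<nu> z"
  unfolding MAP_iff using tendsto_divide[OF scaled_ball_tendsto[OF assms(1)] assms(2)] by simp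

text \<open>The limit point controls the supremum along one sequence of radii, while a MAP estimator
  requires all radii. If some null sequence kept \<open>scaled_sup\<close> away from exp (- OM z),
  compactness would give a limit w in E along a subsequence of it, and there the supremum tends to
  exp (- OM w).\<close>

lemma AMF_limit_point_MAP:
  assumes C: "C1 \<mu>" "C2 \<mu>" "C3 \<mu>" "C4 \<mu>" and amf: "asymptotic_maximizing_family \<nu> \<zeta>"
    and z: "family_limit_point \<zeta> z"
  shows "z \<in> E" "MAP_estimator \<nu> z"
proof -
  obtain \<delta> where \<delta>: "positive_null_seq \<delta>" "(\<lambda>n. \<zeta> (\<delta> n)) \<longlonglongrightarrow> z"
    using z unfolding family_limit_point_def by blast
  show zE: "z \<in> E"
    by (rule AMF_limit_in_cm_space[OF C(3) amf \<delta>(1) LIMSEQ_imp_weakly[OF \<delta>(2)]])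
  have "(scaled_sup \<longlongrightarrow> exp (- OM z)) (at_right 0)"
  proof (rule tendsto_at_right_sequentially[of 0 1])
    fix s :: "nat \<Rightarrow> real"
    assume s: "\<And>n. 0 < s n" "s \<longlonglongrightarrow> 0"
    show "(\<lambda>n. scaled_sup (s n)) \<longlonglongrightarrow> exp (- OM z)"
    proof (rule ccontr)
      assume "\<not> (\<lambda>n. scaled_sup (s n)) \<longlonglongrightarrow> exp (- OM z)"
      then obtain e where e: "0 < e" "\<exists>\<^sub>F n in sequentially. e \<le> dist (scaled_sup (s n)) (exp (- OM z))"
        unfolding tendsto_iff frequently_def by (auto simp: not_le)
      define Q where "Q = {n. e \<le> dist (scaled_sup (s n)) (exp (- OM z))}"
      have "infinite Q"
        using e(2) by (simp add: Q_def INFM_iff_infinite flip: cofinite_eq_sequentially)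
      then obtain r :: "nat \<Rightarrow> nat" where r: "strict_mono r" "\<And>n. r n \<in> Q"
        using infinite_enumerate by blast
      have sr: "positive_null_seq (\<lambda>n. s (r n))"
        by (rule positive_null_seq_subseq[OF _ r(1)]) (simp add: positive_null_seq_def s)
      obtain q w where q: "strict_mono q" "w \<in> E" "(\<lambda>m. \<zeta> (s (r (q m)))) \<longlonglongrightarrow> w"
        using AMF_compactness[OF C amf sr] by blast
      note srq = positive_null_seq_subseq[OF sr q(1)]
      \<comment> \<open>Both z and w are limits of the family, so each minimizes over E and the two
        values agree.\<close>
      have "OM w = OM z"
        using AMF_limit(2)[OF amf srq q(3,2) zE] AMF_limit(2)[OF amf \<delta> zE q(2)] by simp
      then have "(\<lambda>m. scaled_sup (s (r (q m)))) \<longlonglongrightarrow> exp (- OM z)"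
        using AMF_limit(1)[OF amf srq q(3,2)] by simp
      from tendstoD[OF this e(1)] obtain m where "dist (scaled_sup (s (r (q m)))) (exp (- OM z)) < e"
        by (auto simp: eventually_sequentially)
      then show False using r(2)[of "q m"] by (simp add: Q_def)
    qed
  qed simp
  then show "MAP_estimator \<nu> z" by (rule MAP_I[OF zE])
qed

lemma positive_null_seq_inverse: "positive_null_seq (\<lambda>n. inverse (real (Suc n)))" "decseq (\<lambda>n. inverse (real (Suc n)))"
  using LIMSEQ_inverse_real_of_nat by (auto simp: positive_null_seq_def decseq_def)

text \<open>A MAP estimator is a limit point of its own constant family, so the results on limits of
  maximizing families apply to it.\<close>

lemma MAP_imp_minimizer:
  assumes "C3 \<mu>" and map: "MAP_estimator \<nu> z"
  shows "z \<in> E" "minimizes_OM \<mu> \<Phi> z"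
    "\<exists>\<zeta>. asymptotic_maximizing_family \<nu> \<zeta> \<and> family_limit_point \<zeta> z"
proof -
  note amf = MAP_imp_AMF_const[OF map]
  show z: "z \<in> E"
    by (rule AMF_limit_in_cm_space[OF assms(1) amf positive_null_seq_inverse(1) LIMSEQ_imp_weakly]) simp
  have "OM z \<le> OM x" if "x \<in> E" for x
    using AMF_limit(2)[OF amf positive_null_seq_inverse(1) _ z that] by simp
  then show "minimizes_OM \<mu> \<Phi> z"
    using z minimizes_iff by blast
  have "family_limit_point (\<lambda>_. z) z"
    unfolding family_limit_point_def using positive_null_seq_inverse by auto
  with amf show "\<exists>\<zeta>. asymptotic_maximizing_family \<nu> \<zeta> \<and> family_limit_point \<zeta> z" by blast
qed

text \<open>The given estimator z fixes the asymptotics of the supremum, which is the ball mass at z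
  divided by a ratio tending to 1. Two minimizers have equal values, so the ball mass at x has the
  same limit.\<close>

lemma minimizer_imp_MAP:
  assumes "C3 \<mu>" and map: "MAP_estimator \<nu> z" and x: "x \<in> E" "minimizes_OM \<mu> \<Phi> x"
  shows "MAP_estimator \<nu> x"
proof (rule MAP_I[OF x(1)])
  have z: "z \<in> E" "minimizes_OM \<mu> \<Phi> z"
    using MAP_imp_minimizer[OF assms(1) map] by auto
  then have eq: "OM x = OM z"
    using x minimizes_iff by (meson order_antisym)
  have "((\<lambda>\<delta>. scaled_ball \<delta> z / (scaled_ball \<delta> z / scaled_sup \<delta>)) \<longlongrightarrow> exp (- OM z) / 1) (at_right 0)"
    using map unfolding MAP_iff by (intro tendsto_divide scaled_ball_tendsto z) auto
  moreover have "\<forall>\<^sub>F \<delta> in at_right 0. scaled_ball \<delta> z / (scaled_ball \<delta> z / scaled_sup \<delta>) = scaled_sup \<delta>"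
  proof -
    have "\<forall>\<^sub>F \<delta> in at_right 0. 0 < scaled_ball \<delta> z"
      by (rule order_tendstoD[OF scaled_ball_tendsto[OF z(1)]]) simp
    then show ?thesis by eventually_elim simp
  qed
  ultimately have "(scaled_sup \<longlongrightarrow> exp (- OM z) / 1) (at_right 0)"
    by (rule Lim_transform_eventually)
  then show "(scaled_sup \<longlongrightarrow> exp (- OM x)) (at_right 0)"
    unfolding eq by simp
qed

text \<open>The estimator is a strong limit of a maximizing family along radii 1/(n+1); a strictly
  monotone selection keeps the radii decreasing, as a limit point requires.\<close>

lemma MAP_exists:
  assumes C: "C1 \<mu>" "C2 \<mu>" "C3 \<mu>" "C4 \<mu>"
  shows "\<exists>z. MAP_estimator \<nu> z"
proof -
  obtain \<zeta> where amf: "asymptotic_maximizing_family \<nu> \<zeta>" using AMF_exists by blast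
  obtain r w where r: "strict_mono r" "w \<in> E" "(\<lambda>m. \<zeta> (inverse (real (Suc (r m))))) \<longlonglongrightarrow> w"
    using AMF_compactness[OF C amf positive_null_seq_inverse(1)] by blast
  have "family_limit_point \<zeta> w"
    unfolding family_limit_point_def
  proof (intro exI conjI)
    show "positive_null_seq (\<lambda>m. inverse (real (Suc (r m))))"
      by (rule positive_null_seq_subseq[OF positive_null_seq_inverse(1) r(1)])
    show "decseq (\<lambda>m. inverse (real (Suc (r m))))"
      using strict_mono_mono[OF r(1)] by (auto simp: decseq_def mono_def)
  qed (rule r(3))
  then show ?thesis using AMF_limit_point_MAP(2)[OF C amf] by blast
qed

end

theorem theorem2p8:
  fixes \<mu> :: "'a::{banach, second_countable_topology} measure"
    and \<Phi> :: "'a \<Rightarrow> real"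
  assumes "gaussian_measure \<mu>" and "centred \<mu>" and "nondegenerate \<mu>"
    and "admissible_potential \<Phi>"
  shows
    "(\<forall>\<zeta>. asymptotic_maximizing_family (posterior \<mu> \<Phi>) \<zeta> \<longrightarrow>
        (\<exists>K>0. \<exists>\<delta>\<^sub>0>0. \<forall>\<delta>. 0 < \<delta> \<and> \<delta> < \<delta>\<^sub>0 \<longrightarrow> ball_ratio \<mu> \<delta> (\<zeta> \<delta>) \<ge> K)) \<and>
     (C1 \<mu> \<and> C2 \<mu> \<and> C3 \<mu> \<and> C4 \<mu> \<longrightarrow>
        (\<forall>\<zeta>. asymptotic_maximizing_family (posterior \<mu> \<Phi>) \<zeta> \<longrightarrow>
           (\<forall>\<delta>. positive_null_seq \<delta> \<longrightarrow>
              (\<exists>r w. strict_mono r \<and> w \<in> cm_space \<mu> \<and> (\<lambda>m. \<zeta> (\<delta> (r m))) \<longlonglongrightarrow> w)) \<and>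
           (\<forall>z. family_limit_point \<zeta> z \<longrightarrow>
              z \<in> cm_space \<mu> \<and> MAP_estimator (posterior \<mu> \<Phi>) z))) \<and>
     (C3 \<mu> \<longrightarrow>
        (\<forall>z. MAP_estimator (posterior \<mu> \<Phi>) z \<longrightarrow>
           z \<in> cm_space \<mu> \<and> minimizes_OM \<mu> \<Phi> z \<and>
           (\<exists>\<zeta>. asymptotic_maximizing_family (posterior \<mu> \<Phi>) \<zeta> \<and> family_limit_point \<zeta> z))) \<and>
     (C3 \<mu> \<and> (\<exists>z. MAP_estimator (posterior \<mu> \<Phi>) z) \<longrightarrow>
        (\<forall>x. x \<in> cm_space \<mu> \<and> minimizes_OM \<mu> \<Phi> x \<longrightarrow> MAP_estimator (posterior \<mu> \<Phi>) x)) \<and>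
     (C1 \<mu> \<and> C2 \<mu> \<and> C3 \<mu> \<and> C4 \<mu> \<longrightarrow>
        (\<exists>z. MAP_estimator (posterior \<mu> \<Phi>) z) \<and>
        (\<forall>z.
           ((\<exists>\<zeta>. asymptotic_maximizing_family (posterior \<mu> \<Phi>) \<zeta> \<and> family_limit_point \<zeta> z)
              \<longleftrightarrow> z \<in> cm_space \<mu> \<and> minimizes_OM \<mu> \<Phi> z) \<and>
           (z \<in> cm_space \<mu> \<and> minimizes_OM \<mu> \<Phi> z \<longleftrightarrow> MAP_estimator (posterior \<mu> \<Phi>) z)))"
proof -
  interpret prob_space \<mu>
    using assms(1) by (simp add: gaussian_measure_def)
  interpret gaussian_posterior \<mu> \<Phi>
    by unfold_locales (rule assms)+
  show ?thesis
  proof (intro conjI impI allI, goal_cases)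
    case (1 \<zeta>)
    then show ?case by (rule AMF_ball_ratio_ge)
  next
    case (2 \<zeta> \<delta>)
    then show ?case using AMF_compactness[of \<zeta> \<delta>] by metis
  next
    case (3 \<zeta> z)
    then show ?case using AMF_limit_point_MAP(1) by blast
  next
    case (4 \<zeta> z)
    then show ?case using AMF_limit_point_MAP(2) by blast
  next
    case (5 z)
    then show ?case using MAP_imp_minimizer(1) by blast
  next
    case (6 z)
    then show ?case using MAP_imp_minimizer(2) by blast
  next
    case (7 z)
    then show ?case using MAP_imp_minimizer(3) by blast
  next
    case (8 x)
    then show ?case using minimizer_imp_MAP by blast
  next
    case 9
    then show ?case using MAP_exists by blast
  next
    \<comment> \<open>Both equivalences pass through the MAP property. The way back from minimizers
      rests on \<open>MAP_exists\<close>, since \<open>minimizer_imp_MAP\<close> presupposes some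
      estimator.\<close>
    case (10 z)
    then show ?case
      using AMF_limit_point_MAP(2) MAP_imp_minimizer minimizer_imp_MAP MAP_exists by metis
  next
    case (11 z)
    then show ?case
      using MAP_imp_minimizer minimizer_imp_MAP MAP_exists by metis
  qed
qed

end
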